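(* Let $I$ be an ideal of $B(H)$ and let $\xi\in c_0^*$. Then the following conditions are equivalent. (i) $\xi\in\Sigma(I^-)$. (ii) $\xi\prec\eta$ for some $\eta\in\Sigma(I)$. (ii$'$) $\xi\preccurlyeq\eta$ for some $\eta\in\Sigma(I)$. (iii) $\xi=P\eta$ for some $\eta\in\Sigma(I)$ and some substochastic matrix $P$. (iii$'$) $\xi=Q\eta$ for some $\eta\in\Sigma(I)$ and some orthostochastic matrix $Q$. (iv) $\operatorname{diag}\xi=E(L\,\operatorname{diag}\eta\,L^* )$ for some $\eta\in\Sigma(I)$ and some contraction $L\in B(H)$. (iv$'$) $\operatorname{diag}\xi=E(U\,\operatorname{diag}\eta\,U^* )$ for some $\eta\in\Sigma(I)$ and some orthogonal matrix $U$. If moreover $I\supset\mathscr L_1$ (the trace class), then these conditions are all also equivalent to each of: (ii$''$) $\xi\prec_b\eta$ for some $\eta\in\Sigma(I)$. (iii$''$) $\xi=Q\eta$ for some $\eta\in\Sigma(I)$ and some block orthostochastic matrix $Q$. (iv$''$) $\operatorname{diag}\xi=E(U\,\operatorname{diag}\eta\,U^* )$ for some $\eta\in\Sigma(I)$ and some matrix $U$ that is a direct sum of finite orthogonal matrices.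
   Context: $\mathbb N=\{1,2,\dots\}$. $c_0^*$ is the cone of nonincreasing sequences of nonnegative reals converging to $0$ (not a dual space). For $\xi,\eta\in c_0^*$: $\xi\prec\eta$ means $\sum_{j=1}^n\xi_j\le\sum_{j=1}^n\eta_j$ for all $n\in\mathbb N$; $\xi\preccurlyeq\eta$ means $\xi\prec\eta$ and $\liminf_n\sum_{j=1}^n(\eta_j-\xi_j)=0$; $\xi\prec_b\eta$ means $\xi\prec\eta$ and $\sum_{j=1}^{n_k}\xi_j=\sum_{j=1}^{n_k}\eta_j$ for some sequence of positive integers $n_k\uparrow\infty$. $H$ is a separable infinite-dimensional Hilbert space with a fixed orthonormal basis $\{e_n\}_{n\in\mathbb N}$; operators are identified with their matrices in this basis. $\operatorname{diag}\xi$ is the diagonal operator with diagonal $\xi$, and $E$ is the conditional expectation of $B(H)$ onto the diagonal operators, i.e. $E(A)$ is the main diagonal of $A$. An ideal is a (proper) two-sided ideal of $B(H)$, hence consists of compact operators; its characteristic set is $\Sigma(I)=\{s(X): X\in I\}\subset c_0^*$, where $s(X)$ is the singular number sequence of $X$ (eigenvalues of $|X|$ in decreasing order, repeated with multiplicity). $I\mapsto\Sigma(I)$ is a bijection onto the hereditary (solid) subcones of $c_0^*$ invariant under all ampliations $\xi\mapsto\langle\xi_1,\dots,\xi_1,\xi_2,\dots,\xi_2,\dots\rangle$ (each entry repeated $m$ times). For $\xi\in c_0^*$, $\xi_a:=\langle\frac1n\sum_{j=1}^n\xi_j\rangle_n$. The ideals ${}_aI$ and $I_a$ are defined by $\Sigma({}_aI)=\{\xi\in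 c_0^*:\xi_a\in\Sigma(I)\}$ and $\Sigma(I_a)=\{\xi\in c_0^*:\xi=O(\eta_a)\text{ for some }\eta\in\Sigma(I)\}$, and the am-closure of $I$ is $I^-:={}_a(I_a)$. Infinite matrices are indexed by $\mathbb N\times\mathbb N$ and $(P\rho)_i=\sum_jP_{ij}\rho_j$. A matrix with nonnegative entries is substochastic if all its row and column sums are at most $1$. An orthogonal matrix is a unitary matrix with real entries; a matrix $Q$ is orthostochastic if $Q_{ij}=(U_{ij})^2$ for some orthogonal matrix $U$; it is block orthostochastic if $Q_{ij}=(U_{ij})^2$ for a matrix $U$ which is a direct sum of finite orthogonal matrices. *)

theory Defs
  imports "HOL-Analysis.Analysis" "HOL-Algebra.Ideal"
begin

text \<open>
  A complex Hilbert space is presented on top of its underlying real Hilbert space, so that the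
  norm, the topology and the type of bounded (real-linear) operators are those of the library.
  The inner product is linear in the first argument, and its real part is the real inner product.
\<close>

class complex_hilbert_space = real_inner + complete_space +
  fixes scaleC :: "complex \<Rightarrow> 'a \<Rightarrow> 'a"  (infixr \<open>*\<^sub>C\<close> 75)
    and cinner :: "'a \<Rightarrow> 'a \<Rightarrow> complex"
  assumes scaleC_add_right: "c *\<^sub>C (x + y) = c *\<^sub>C x + c *\<^sub>C y"
    and scaleC_add_left: "(c + d) *\<^sub>C x = c *\<^sub>C x + d *\<^sub>C x"
    and scaleC_scaleC: "c *\<^sub>C (d *\<^sub>C x) = (c * d) *\<^sub>C x"
    and scaleR_scaleC: "r *\<^sub>R x = complex_of_real r *\<^sub>C x"
    and cinner_commute: "cinner x y = cnj (cinner y x)"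
    and cinner_add_left: "cinner (x + y) z = cinner x z + cinner y z"
    and cinner_scaleC_left: "cinner (c *\<^sub>C x) y = c * cinner x y"
    and inner_eq_Re_cinner: "inner x y = Re (cinner x y)"

definition orthonormal_basis :: "(nat \<Rightarrow> 'h::complex_hilbert_space) \<Rightarrow> bool" where
  "orthonormal_basis e \<longleftrightarrow>
     (\<forall>i j. cinner (e i) (e j) = (if i = j then 1 else 0)) \<and>
     closure (module.span scaleC (range e)) = UNIV"


definition B_H :: "('h::complex_hilbert_space \<Rightarrow>\<^sub>L 'h) set" where
  "B_H = {A. \<forall>c x. blinfun_apply A (c *\<^sub>C x) = c *\<^sub>C blinfun_apply A x}"

definition B_H_ring :: "('h::complex_hilbert_space \<Rightarrow>\<^sub>L 'h) ring" where
  "B_H_ring = \<lparr>carrier = B_H, mult = (o\<^sub>L), one = id_blinfun, zero = 0, add = (+)\<rparr>"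

definition proper_ideal :: "('h::complex_hilbert_space \<Rightarrow>\<^sub>L 'h) set \<Rightarrow> bool" where
  "proper_ideal I \<longleftrightarrow> ideal I B_H_ring \<and> I \<noteq> B_H"

definition adj :: "('h::complex_hilbert_space \<Rightarrow>\<^sub>L 'h) \<Rightarrow> ('h \<Rightarrow>\<^sub>L 'h)" where
  "adj A = (THE B. B \<in> B_H \<and>
     (\<forall>x y. cinner (blinfun_apply A x) y = cinner x (blinfun_apply B y)))"

definition positive_op :: "('h::complex_hilbert_space \<Rightarrow>\<^sub>L 'h) \<Rightarrow> bool" where
  "positive_op A \<longleftrightarrow> A \<in> B_H \<and> (\<forall>x. cinner (blinfun_apply A x) x \<in> \<real>\<^sub>\<ge>\<^sub>0)"

definition abs_op :: "('h::complex_hilbert_space \<Rightarrow>\<^sub>L 'h) \<Rightarrow> ('h \<Rightarrow>\<^sub>L 'h)" where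
  "abs_op X = (THE A. positive_op A \<and> A o\<^sub>L A = adj X o\<^sub>L X)"

definition compact_ops :: "('h::complex_hilbert_space \<Rightarrow>\<^sub>L 'h) set" where
  "compact_ops = {A \<in> B_H. compact (closure (blinfun_apply A ` cball 0 1))}"

definition unitary_op :: "('h::complex_hilbert_space \<Rightarrow>\<^sub>L 'h) \<Rightarrow> bool" where
  "unitary_op U \<longleftrightarrow> U \<in> B_H \<and> adj U o\<^sub>L U = id_blinfun \<and> U o\<^sub>L adj U = id_blinfun"


text \<open>
  All sequences and matrices are indexed from 0, so that the entry with index \<open>n\<close> of a
  sequence on \<open>{1, 2, \<dots>}\<close> becomes the one with index \<open>n - 1\<close>, and the sum of the first \<open>n\<close> entries runs over \<open>j < n\<close>.
\<close>

definition c0_star :: "(nat \<Rightarrow> real) set" where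
  "c0_star = {\<xi>. decseq \<xi> \<and> (\<forall>n. 0 \<le> \<xi> n) \<and> \<xi> \<longlonglongrightarrow> 0}"

definition majorized :: "(nat \<Rightarrow> real) \<Rightarrow> (nat \<Rightarrow> real) \<Rightarrow> bool"  (infix \<open>\<prec>\<close> 50) where
  "\<xi> \<prec> \<eta> \<longleftrightarrow> (\<forall>n. (\<Sum>j<n. \<xi> j) \<le> (\<Sum>j<n. \<eta> j))"

definition strongly_majorized :: "(nat \<Rightarrow> real) \<Rightarrow> (nat \<Rightarrow> real) \<Rightarrow> bool"
    (infix \<open>\<preceq>\<close> 50) where
  "\<xi> \<preceq> \<eta> \<longleftrightarrow> \<xi> \<prec> \<eta> \<and> liminf (\<lambda>n. ereal (\<Sum>j<n. \<eta> j - \<xi> j)) = 0"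

definition block_majorized :: "(nat \<Rightarrow> real) \<Rightarrow> (nat \<Rightarrow> real) \<Rightarrow> bool"
    (infix \<open>\<prec>\<^sub>b\<close> 50) where
  "\<xi> \<prec>\<^sub>b \<eta> \<longleftrightarrow> \<xi> \<prec> \<eta> \<and>
     (\<exists>n :: nat \<Rightarrow> nat. strict_mono n \<and> (\<forall>k. 0 < n k) \<and>
        (\<forall>k. (\<Sum>j<n k. \<xi> j) = (\<Sum>j<n k. \<eta> j)))"

definition arith_mean :: "(nat \<Rightarrow> real) \<Rightarrow> nat \<Rightarrow> real" where
  "arith_mean \<xi> n = (\<Sum>j\<le>n. \<xi> j) / real (Suc n)"


text \<open>
  For compact \<open>X\<close>, the sequence of eigenvalues of \<open>|X|\<close> in decreasing order and repeated with
  multiplicity is the unique element of \<open>c0_star\<close> in which every \<open>t > 0\<close> occurs exactly as often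
  as the complex dimension of the eigenspace of \<open>|X|\<close> at \<open>t\<close>. (It is padded with zeros when \<open>X\<close>
  has finite rank, and contains no zero otherwise.) The value for noncompact \<open>X\<close> is irrelevant.
\<close>

definition singular_numbers :: "('h::complex_hilbert_space \<Rightarrow>\<^sub>L 'h) \<Rightarrow> nat \<Rightarrow> real" where
  "singular_numbers X = (THE s. s \<in> c0_star \<and>
     (\<forall>t>0. card {n. s n = t} =
        vector_space.dim scaleC {x. blinfun_apply (abs_op X) x = complex_of_real t *\<^sub>C x}))"

definition char_set :: "('h::complex_hilbert_space \<Rightarrow>\<^sub>L 'h) set \<Rightarrow> (nat \<Rightarrow> real) set" where
  "char_set I = singular_numbers ` I"

definition ideal_of_char_set ::
    "(nat \<Rightarrow> real) set \<Rightarrow> ('h::complex_hilbert_space \<Rightarrow>\<^sub>L 'h) set" where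
  "ideal_of_char_set S = {X \<in> compact_ops. singular_numbers X \<in> S}"

definition pre_am :: "('h::complex_hilbert_space \<Rightarrow>\<^sub>L 'h) set \<Rightarrow> ('h \<Rightarrow>\<^sub>L 'h) set" where
  "pre_am I = ideal_of_char_set {\<xi> \<in> c0_star. arith_mean \<xi> \<in> char_set I}"

text \<open>
  The relation \<open>\<xi> = O(\<eta>\<^sub>a)\<close> is required for all indices and not just eventually; the two differ
  only for \<open>\<eta> = 0\<close>, where the eventual version would admit all finitely supported \<open>\<xi>\<close>.
\<close>

definition am :: "('h::complex_hilbert_space \<Rightarrow>\<^sub>L 'h) set \<Rightarrow> ('h \<Rightarrow>\<^sub>L 'h) set" where
  "am I = ideal_of_char_set
     {\<xi> \<in> c0_star. \<exists>\<eta> \<in> char_set I. \<exists>M. \<forall>n. \<xi> n \<le> M * arith_mean \<eta> n}"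

definition am_closure :: "('h::complex_hilbert_space \<Rightarrow>\<^sub>L 'h) set \<Rightarrow> ('h \<Rightarrow>\<^sub>L 'h) set" where
  "am_closure I = pre_am (am I)"

definition trace_class :: "('h::complex_hilbert_space \<Rightarrow>\<^sub>L 'h) set" where
  "trace_class = {X \<in> compact_ops. summable (singular_numbers X)}"


definition entry ::
    "(nat \<Rightarrow> 'h::complex_hilbert_space) \<Rightarrow> ('h \<Rightarrow>\<^sub>L 'h) \<Rightarrow> nat \<Rightarrow> nat \<Rightarrow> complex" where
  "entry e A i j = cinner (blinfun_apply A (e j)) (e i)"

text \<open>Only meaningful for bounded diagonal sequences.\<close>

definition diag :: "(nat \<Rightarrow> 'h::complex_hilbert_space) \<Rightarrow> (nat \<Rightarrow> complex) \<Rightarrow> ('h \<Rightarrow>\<^sub>L 'h)" where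
  "diag e a = Blinfun (\<lambda>x. \<Sum>n. (a n * cinner x (e n)) *\<^sub>C e n)"

abbreviation diag_real ::
    "(nat \<Rightarrow> 'h::complex_hilbert_space) \<Rightarrow> (nat \<Rightarrow> real) \<Rightarrow> ('h \<Rightarrow>\<^sub>L 'h)" where
  "diag_real e \<xi> \<equiv> diag e (\<lambda>n. complex_of_real (\<xi> n))"

definition cond_exp ::
    "(nat \<Rightarrow> 'h::complex_hilbert_space) \<Rightarrow> ('h \<Rightarrow>\<^sub>L 'h) \<Rightarrow> ('h \<Rightarrow>\<^sub>L 'h)" where
  "cond_exp e A = diag e (\<lambda>n. entry e A n n)"

definition orthogonal_matrix_op ::
    "(nat \<Rightarrow> 'h::complex_hilbert_space) \<Rightarrow> ('h \<Rightarrow>\<^sub>L 'h) \<Rightarrow> bool" where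
  "orthogonal_matrix_op e U \<longleftrightarrow> unitary_op U \<and> (\<forall>i j. entry e U i j \<in> \<real>)"

definition finite_orthogonal_matrix :: "nat set \<Rightarrow> (nat \<Rightarrow> nat \<Rightarrow> complex) \<Rightarrow> bool" where
  "finite_orthogonal_matrix B M \<longleftrightarrow> finite B \<and>
     (\<forall>i\<in>B. \<forall>j\<in>B. M i j \<in> \<real> \<and>
        (\<Sum>l\<in>B. M i l * M j l) = (if i = j then 1 else 0) \<and>
        (\<Sum>l\<in>B. M l i * M l j) = (if i = j then 1 else 0))"

text \<open>
  The consecutive index blocks of the direct sum are \<open>{m k..<m (Suc k)}\<close>; they are nonempty and
  partition the natural numbers.
\<close>

definition direct_sum_finite_orthogonal ::
    "(nat \<Rightarrow> 'h::complex_hilbert_space) \<Rightarrow> ('h \<Rightarrow>\<^sub>L 'h) \<Rightarrow> bool" where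
  "direct_sum_finite_orthogonal e U \<longleftrightarrow> U \<in> B_H \<and>
     (\<exists>m :: nat \<Rightarrow> nat. strict_mono m \<and> m 0 = 0 \<and>
        (\<forall>k. finite_orthogonal_matrix {m k..<m (Suc k)} (entry e U)) \<and>
        (\<forall>k. \<forall>i \<in> {m k..<m (Suc k)}. \<forall>j. j \<notin> {m k..<m (Suc k)} \<longrightarrow> entry e U i j = 0))"

definition mat_apply :: "(nat \<Rightarrow> nat \<Rightarrow> real) \<Rightarrow> (nat \<Rightarrow> real) \<Rightarrow> nat \<Rightarrow> real" where
  "mat_apply P \<rho> i = (\<Sum>j. P i j * \<rho> j)"

definition substochastic :: "(nat \<Rightarrow> nat \<Rightarrow> real) \<Rightarrow> bool" where
  "substochastic P \<longleftrightarrow> (\<forall>i j. 0 \<le> P i j) \<and>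
     (\<forall>i. summable (\<lambda>j. P i j) \<and> (\<Sum>j. P i j) \<le> 1) \<and>
     (\<forall>j. summable (\<lambda>i. P i j) \<and> (\<Sum>i. P i j) \<le> 1)"

definition orthostochastic ::
    "(nat \<Rightarrow> 'h::complex_hilbert_space) \<Rightarrow> (nat \<Rightarrow> nat \<Rightarrow> real) \<Rightarrow> bool" where
  "orthostochastic e Q \<longleftrightarrow>
     (\<exists>U. orthogonal_matrix_op e U \<and> (\<forall>i j. complex_of_real (Q i j) = (entry e U i j)\<^sup>2))"

definition block_orthostochastic ::
    "(nat \<Rightarrow> 'h::complex_hilbert_space) \<Rightarrow> (nat \<Rightarrow> nat \<Rightarrow> real) \<Rightarrow> bool" where
  "block_orthostochastic e Q \<longleftrightarrow>
     (\<exists>U. direct_sum_finite_orthogonal e U \<and>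
          (\<forall>i j. complex_of_real (Q i j) = (entry e U i j)\<^sup>2))"

end

theory Submission
  imports Defs
begin

text \<open>
  A proper ideal \<open>I\<close> consists of compact operators, and by their singular value decomposition
  \<open>\<eta> \<in> char_set I\<close> amounts to \<open>diag \<eta> \<in> I\<close>, so that membership in the am-closure unfolds to \<open>\<xi> \<prec> \<eta>\<close>.
  A pointwise minimal majorant \<open>\<zeta> \<le> \<eta>\<close> of \<open>\<xi>\<close> has gaps of partial sums with lower limit zero.
  If the trace class lies in \<open>I\<close>, cutting the partial sums of \<open>\<zeta>\<close> by tangents to those of \<open>\<xi>\<close>
  makes the gap vanish infinitely often at the cost of a summable perturbation.

  An orthogonal matrix is then obtained from the Schur-Horn algorithm: rotate two neighbouring
  vectors of an orthonormal system that diagonalizes \<open>diag \<eta>\<close> so that one of them takes the value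
  \<open>\<xi>\<^sub>0\<close>, remove it, and repeat. The rows so produced are orthonormal, and a column with
  \<open>\<eta>\<^sub>j > 0\<close> that is not a unit vector would keep the gaps away from zero. If \<open>\<eta>\<close> has finite support,
  only finitely many columns matter, and Householder reflections extend them to an orthogonal matrix.
\<close>

text \<open>In infinite dimension the rotations may produce orthonormal rows that are not complete:
  the mass of a column can escape to infinity, and the matrix is then only a coisometry. Plain
  majorization does not prevent this, which is why \<open>\<preceq>\<close> stands between
  \<open>\<prec>\<close> and the orthogonal matrices; a mass \<delta> missing in column
  \<open>k\<close> would cost at least \<open>\<delta> * (\<eta> k / 2)\<close> in every late gap of
  the partial sums. A rotation also needs a positive target, since only then do the entries of
  \<eta> fall below it. A sequence \<xi> with finitely many nonzero entries is therefore treated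
  apart: it lies in the characteristic set itself, and the identity matrix serves. All matrix
  conditions return to majorization by one estimate: the first \<open>n\<close> rows of a
  substochastic matrix have column sums at most 1 and total mass at most \<open>n\<close>, so they
  cannot collect more than the \<open>n\<close> largest entries. Adjoint, modulus and singular
  numbers are definite descriptions, so existence and uniqueness have to be settled before any of
  this can be said about operators.\<close>

instance complex_hilbert_space \<subseteq> banach ..

section \<open>Algebra and estimates for the complex inner product\<close>

lemma scaleC_one: "1 *\<^sub>C x = (x::'h::complex_hilbert_space)"
  using scaleR_scaleC[of 1 x] by simp

interpretation cvs: vector_space "scaleC :: complex \<Rightarrow> 'h \<Rightarrow> 'h::complex_hilbert_space"
  by unfold_locales (simp_all add: scaleC_add_right scaleC_add_left scaleC_scaleC scaleC_one)

lemma cnj_cinner: "cnj (cinner x y) = cinner y (x::'h::complex_hilbert_space)"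
  by (metis cinner_commute)

lemma cinner_add_right: "cinner x (y + z) = cinner x y + cinner x (z::'h::complex_hilbert_space)"
  by (metis cinner_add_left cinner_commute complex_cnj_add)

lemma cinner_scaleC_right: "cinner x (c *\<^sub>C y) = cnj c * cinner x (y::'h::complex_hilbert_space)"
  by (metis cinner_scaleC_left cinner_commute complex_cnj_mult)

lemma cinner_scaleR_left: "cinner (r *\<^sub>R x) y = of_real r * cinner x (y::'h::complex_hilbert_space)"
  by (simp add: scaleR_scaleC cinner_scaleC_left)

lemma cinner_scaleR_right: "cinner x (r *\<^sub>R y) = of_real r * cinner x (y::'h::complex_hilbert_space)"
  by (simp add: scaleR_scaleC cinner_scaleC_right)

lemma cinner_zero [simp]: "cinner 0 (x::'h::complex_hilbert_space) = 0" "cinner x (0::'h) = 0"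
  using cinner_scaleR_left[of 0 x x] cinner_scaleR_right[of x 0 x] by simp_all

lemma cinner_minus_left: "cinner (- x) y = - cinner x (y::'h::complex_hilbert_space)"
  using cinner_scaleR_left[of "-1" x y] by simp

lemma cinner_minus_right: "cinner x (- y) = - cinner x (y::'h::complex_hilbert_space)"
  using cinner_scaleR_right[of x "-1" y] by simp

lemma cinner_diff_left: "cinner (x - y) z = cinner x z - cinner y (z::'h::complex_hilbert_space)"
  using cinner_add_left[of x "-y" z] by (simp add: cinner_minus_left)

lemma cinner_diff_right: "cinner z (x - y) = cinner z x - cinner z (y::'h::complex_hilbert_space)"
  using cinner_add_right[of z x "-y"] by (simp add: cinner_minus_right)

lemma cinner_sum_left: "cinner (\<Sum>i\<in>F. f i) y = (\<Sum>i\<in>F. cinner (f i) (y::'h::complex_hilbert_space))"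
  by (induction F rule: infinite_finite_induct) (simp_all add: cinner_add_left)

lemma cinner_sum_right: "cinner y (\<Sum>i\<in>F. f i) = (\<Sum>i\<in>F. cinner y (f i::'h::complex_hilbert_space))"
  by (induction F rule: infinite_finite_induct) (simp_all add: cinner_add_right)

lemmas cinner_linear = cinner_add_left cinner_add_right cinner_diff_left cinner_diff_right
  cinner_scaleC_left cinner_scaleC_right cinner_scaleR_left cinner_scaleR_right
  cinner_minus_left cinner_minus_right

lemma cinner_self: "cinner x x = of_real ((norm (x::'h::complex_hilbert_space))\<^sup>2)"
proof -
  have "Im (cinner x x) = 0"
    using cinner_commute[of x x] by (simp add: complex_eq_iff)
  moreover have "Re (cinner x x) = (norm x)\<^sup>2"
    by (metis inner_eq_Re_cinner power2_norm_eq_inner)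
  ultimately show ?thesis by (simp add: complex_eq_iff)
qed

lemma norm_eq_1I: "cinner x x = 1 \<Longrightarrow> norm (x::'h::complex_hilbert_space) = 1"
proof -
  assume "cinner x x = 1"
  then have "complex_of_real ((norm x)\<^sup>2) = of_real 1" by (simp add: cinner_self)
  then have "(norm x)\<^sup>2 = 1" by (simp only: of_real_eq_iff)
  then show ?thesis using norm_ge_zero[of x] by (simp add: power2_eq_1_iff)
qed

lemma cinner_eq_zero_commute: "cinner x y = 0 \<longleftrightarrow> cinner y (x::'h::complex_hilbert_space) = 0"
  by (metis cinner_commute complex_cnj_zero_iff)

lemma norm_scaleC: "norm (c *\<^sub>C x) = cmod c * norm (x::'h::complex_hilbert_space)"
proof -
  have "complex_of_real ((norm (c *\<^sub>C x))\<^sup>2) = of_real ((cmod c * norm x)\<^sup>2)"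
    unfolding cinner_self[symmetric] cinner_scaleC_left cinner_scaleC_right
    by (simp add: cinner_self power_mult_distrib mult.assoc[symmetric] complex_norm_square
        flip: of_real_power)
  then have "(norm (c *\<^sub>C x))\<^sup>2 = (cmod c * norm x)\<^sup>2" by (simp only: of_real_eq_iff)
  then show ?thesis by (simp add: power2_eq_iff_nonneg)
qed

lemma cinner_Cauchy_Schwarz: "cmod (cinner x y) \<le> norm x * norm (y::'h::complex_hilbert_space)"
proof (cases "cinner x y = 0")
  case False
  \<comment> \<open>A phase of modulus one that makes the product real and nonnegative; the real
    Cauchy-Schwarz inequality then applies to \<open>c *\<^sub>C x\<close>.\<close>
  define c where "c = cnj (cinner x y) / of_real (cmod (cinner x y))"
  have c: "cmod c = 1" using False by (simp add: c_def norm_divide)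
  have "cinner (c *\<^sub>C x) y = of_real (cmod (cinner x y))"
    using False complex_norm_square[of "cinner x y"]
    by (simp add: cinner_scaleC_left c_def field_simps power2_eq_square)
  then have "cmod (cinner x y) = inner (c *\<^sub>C x) y"
    by (simp add: inner_eq_Re_cinner)
  also have "\<dots> \<le> norm (c *\<^sub>C x) * norm y" by (rule norm_cauchy_schwarz)
  finally show ?thesis by (simp add: norm_scaleC c)
qed simp

lemma bounded_linear_cinner_left: "bounded_linear (\<lambda>x. cinner x (y::'h::complex_hilbert_space))"
  by (rule bounded_linear_intro[where K="norm y"])
     (simp_all add: cinner_add_left cinner_scaleR_left cinner_Cauchy_Schwarz scaleR_conv_of_real)

lemma bounded_linear_cinner_right: "bounded_linear (\<lambda>y. cinner (x::'h::complex_hilbert_space) y)"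
  by (rule bounded_linear_intro[where K="norm x"])
     (simp_all add: cinner_add_right cinner_scaleR_right scaleR_conv_of_real,
      metis cinner_Cauchy_Schwarz mult.commute)

lemma bounded_linear_scaleC_right: "bounded_linear (\<lambda>x. c *\<^sub>C (x::'h::complex_hilbert_space))"
  by (rule bounded_linear_intro[where K="cmod c"])
     (simp_all add: scaleC_add_right scaleR_scaleC scaleC_scaleC norm_scaleC mult.commute)

lemma bounded_linear_scaleC_left: "bounded_linear (\<lambda>c. c *\<^sub>C (x::'h::complex_hilbert_space))"
  by (rule bounded_linear_intro[where K="norm x"])
     (simp_all add: scaleC_add_left scaleR_scaleC scaleC_scaleC norm_scaleC scaleR_conv_of_real)

lemma cinner_ext: "(\<And>y. cinner x y = cinner x' y) \<Longrightarrow> x = (x'::'h::complex_hilbert_space)"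
proof -
  assume "\<And>y. cinner x y = cinner x' y"
  then have "cinner (x - x') (x - x') = 0" by (simp add: cinner_diff_left)
  then show ?thesis by (simp add: cinner_self)
qed

lemma cinner_ext_right: "(\<And>y. cinner y x = cinner y x') \<Longrightarrow> x = (x'::'h::complex_hilbert_space)"
  by (rule cinner_ext) (metis cinner_commute)

lemma norm_add_orthogonal:
  "cinner x y = 0 \<Longrightarrow> (norm (x + y))\<^sup>2 = (norm x)\<^sup>2 + (norm (y::'h::complex_hilbert_space))\<^sup>2"
proof -
  assume *: "cinner x y = 0"
  then have "cinner y x = 0" by (simp add: cinner_eq_zero_commute)
  then have "complex_of_real ((norm (x + y))\<^sup>2) = of_real ((norm x)\<^sup>2 + (norm y)\<^sup>2)"
    using * unfolding cinner_self[symmetric] of_real_add by (simp add: cinner_linear)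
  then show ?thesis by (simp only: of_real_eq_iff)
qed

lemma norm_diff_orthogonal:
  "cinner x y = 0 \<Longrightarrow> (norm (x - y))\<^sup>2 = (norm x)\<^sup>2 + (norm (y::'h::complex_hilbert_space))\<^sup>2"
  using norm_add_orthogonal[of x "-y"] by (simp add: cinner_minus_right)

section \<open>Orthogonal systems\<close>

text \<open>Zero vectors are admitted so that operators of finite and of infinite rank are covered by the
  same formulas.\<close>

definition suborth :: "(nat \<Rightarrow> 'h::complex_hilbert_space) \<Rightarrow> bool" where
  "suborth f \<longleftrightarrow> (\<forall>i j. i \<noteq> j \<longrightarrow> cinner (f i) (f j) = 0) \<and> (\<forall>i. f i = 0 \<or> norm (f i) = 1)"

lemma suborth_cinner:
  "suborth f \<Longrightarrow> cinner (f i) (f j) = (if i = j \<and> f i \<noteq> 0 then 1 else 0)"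
  unfolding suborth_def by (cases "i = j") (auto simp: cinner_self dest: spec[of _ i])

lemma suborth_norm: "suborth f \<Longrightarrow> f i \<noteq> 0 \<Longrightarrow> norm (f i) = 1"
  unfolding suborth_def by blast

lemma suborth_norm_le: "suborth f \<Longrightarrow> norm (f i) \<le> 1"
  unfolding suborth_def by (metis norm_zero order_refl zero_le_one)

lemma suborthI:
  "(\<And>i j. i < j \<Longrightarrow> cinner (f i) (f j) = 0) \<Longrightarrow> (\<And>i. f i = 0 \<or> norm (f i) = 1) \<Longrightarrow> suborth f"
  unfolding suborth_def by (metis cinner_eq_zero_commute nat_neq_iff)

lemma suborthD0: "suborth f \<Longrightarrow> i \<noteq> j \<Longrightarrow> cinner (f i) (f j) = 0"
  unfolding suborth_def by blast

text \<open>Pythagoras with an inequality, since a vanishing \<open>f n\<close> contributes nothing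
  on the left.\<close>

lemma norm_sum_suborth_le:
  assumes "suborth f" "finite F"
  shows "(norm (\<Sum>n\<in>F. a n *\<^sub>C f n))\<^sup>2 \<le> (\<Sum>n\<in>F. (cmod (a n))\<^sup>2)"
  using assms(2)
proof (induction F)
  case (insert m F)
  have "cinner (a m *\<^sub>C f m) (\<Sum>n\<in>F. a n *\<^sub>C f n) = 0"
    unfolding cinner_sum_right cinner_scaleC_right cinner_scaleC_left
    using insert by (intro sum.neutral) (auto, metis suborthD0[OF assms(1)])
  moreover have "(norm (a m *\<^sub>C f m))\<^sup>2 \<le> (cmod (a m))\<^sup>2"
    unfolding norm_scaleC
    by (intro power_mono mult_left_le suborth_norm_le assms) auto
  ultimately show ?case using insert
    by (simp only: sum.insert[OF insert.hyps] norm_add_orthogonal add_mono)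
qed simp

text \<open>With \<open>p\<close> the partial expansion, \<open>S = cinner x p\<close> is at most
  \<open>norm x * norm p\<close>, and \<open>norm p\<close> is at most the root of \<open>S\<close>,
  so one factor \<open>S\<close> cancels.\<close>

lemma bessel_finite:
  assumes f: "suborth f" and "finite F"
  shows "(\<Sum>n\<in>F. (cmod (cinner x (f n)))\<^sup>2) \<le> (norm x)\<^sup>2"
proof -
  define p where "p = (\<Sum>n\<in>F. cinner x (f n) *\<^sub>C f n)"
  define S where "S = (\<Sum>n\<in>F. (cmod (cinner x (f n)))\<^sup>2)"
  have xp: "cinner x p = of_real S"
    unfolding p_def S_def cinner_sum_right cinner_scaleC_right of_real_sum
    by (intro sum.cong refl) (metis complex_norm_square mult.commute of_real_power)
  have np: "(norm p)\<^sup>2 \<le> S" unfolding p_def S_def by (rule norm_sum_suborth_le[OF assms])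
  have "S = Re (cinner x p)" using xp by simp
  also have "\<dots> \<le> norm x * norm p"
    using cinner_Cauchy_Schwarz[of x p] complex_Re_le_cmod order_trans by blast
  finally have 1: "S \<le> norm x * norm p" .
  have "S\<^sup>2 \<le> (norm x * norm p)\<^sup>2"
    by (rule power_mono[OF 1]) (simp add: S_def sum_nonneg)
  also have "\<dots> \<le> (norm x)\<^sup>2 * S" using np by (simp add: power_mult_distrib mult_left_mono)
  finally have "S * S \<le> (norm x)\<^sup>2 * S" by (simp add: power2_eq_square)
  moreover have "0 \<le> S" by (simp add: S_def sum_nonneg)
  ultimately show ?thesis unfolding S_def[symmetric]
    by (metis mult_right_le_imp_le order_le_less zero_le_power2)
qed

lemma bessel_summable:
  assumes "suborth f" shows "summable (\<lambda>n. (cmod (cinner x (f n)))\<^sup>2)"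
  by (rule summableI_nonneg_bounded[where x="(norm x)\<^sup>2"]) (auto intro: bessel_finite assms)

lemma bessel:
  assumes "suborth f" shows "(\<Sum>n. (cmod (cinner x (f n)))\<^sup>2) \<le> (norm x)\<^sup>2"
  by (rule suminf_le_const[OF bessel_summable[OF assms]]) (auto intro: bessel_finite assms)

lemma summable_suborth:
  assumes "suborth f" "summable (\<lambda>n. (cmod (a n))\<^sup>2)"
  shows "summable (\<lambda>n. a n *\<^sub>C f n)"
  unfolding summable_Cauchy
proof (intro allI impI)
  fix r :: real assume r: "r > 0"
  obtain N where N: "\<And>m n. m \<ge> N \<Longrightarrow> norm (\<Sum>k=m..<n. (cmod (a k))\<^sup>2) < r\<^sup>2"
    using assms(2) r unfolding summable_Cauchy by (meson zero_less_power)
  show "\<exists>N. \<forall>m\<ge>N. \<forall>n. norm (\<Sum>k=m..<n. a k *\<^sub>C f k) < r"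
  proof (intro exI allI impI)
    fix m n assume "N \<le> m"
    then have "(norm (\<Sum>k=m..<n. a k *\<^sub>C f k))\<^sup>2 < r\<^sup>2"
      using norm_sum_suborth_le[OF assms(1), of "{m..<n}" a] N[of m n] by auto
    then show "norm (\<Sum>k=m..<n. a k *\<^sub>C f k) < r" using r
      by (meson less_imp_le power_less_imp_less_base)
  qed
qed

lemma norm_suminf_suborth_le:
  assumes "suborth f" "summable (\<lambda>n. (cmod (a n))\<^sup>2)"
  shows "(norm (\<Sum>n. a n *\<^sub>C f n))\<^sup>2 \<le> (\<Sum>n. (cmod (a n))\<^sup>2)"
proof (rule LIMSEQ_le)
  show "(\<lambda>N. (norm (\<Sum>n<N. a n *\<^sub>C f n))\<^sup>2) \<longlonglongrightarrow> (norm (\<Sum>n. a n *\<^sub>C f n))\<^sup>2"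
    by (intro tendsto_intros summable_LIMSEQ summable_suborth assms)
  show "(\<lambda>N. (\<Sum>n<N. (cmod (a n))\<^sup>2)) \<longlonglongrightarrow> (\<Sum>n. (cmod (a n))\<^sup>2)"
    by (intro summable_LIMSEQ assms)
qed (auto intro: norm_sum_suborth_le assms)

section \<open>Operators given by two orthogonal systems\<close>

lemma B_H_iff: "A \<in> B_H \<longleftrightarrow> (\<forall>c x. blinfun_apply A (c *\<^sub>C x) = c *\<^sub>C blinfun_apply A x)"
  by (simp add: B_H_def)

lemma B_H_scaleC: "A \<in> B_H \<Longrightarrow> blinfun_apply A (c *\<^sub>C x) = c *\<^sub>C blinfun_apply A x"
  by (simp add: B_H_def)

lemma B_H_compose: "A \<in> B_H \<Longrightarrow> B \<in> B_H \<Longrightarrow> A o\<^sub>L B \<in> B_H"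
  by (simp add: B_H_def)

lemma B_H_add: "A \<in> B_H \<Longrightarrow> B \<in> B_H \<Longrightarrow> A + B \<in> B_H"
  by (simp add: B_H_def blinfun.add_left scaleC_add_right)

lemma B_H_diff: "A \<in> B_H \<Longrightarrow> B \<in> B_H \<Longrightarrow> A - B \<in> B_H"
  by (simp add: B_H_def blinfun.diff_left cvs.scale_right_diff_distrib)

lemma B_H_id: "id_blinfun \<in> B_H" by (simp add: B_H_def)

lemma B_H_zero: "0 \<in> B_H" by (simp add: B_H_def)

text \<open>With \<open>f = g = e\<close> this is a diagonal operator, with constant coefficient 1 a
  partial isometry matching \<open>f\<close> with \<open>g\<close>, and with the singular numbers as
  coefficients a Schmidt decomposition.\<close>

definition opser :: "(nat \<Rightarrow> complex) \<Rightarrow> (nat \<Rightarrow> 'h) \<Rightarrow> (nat \<Rightarrow> 'h) \<Rightarrow> ('h::complex_hilbert_space \<Rightarrow>\<^sub>L 'h)" where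
  "opser a f g = Blinfun (\<lambda>x. \<Sum>n. (a n * cinner x (f n)) *\<^sub>C g n)"

lemma diag_eq_opser: "diag e a = opser a e e"
  by (simp add: diag_def opser_def)

context
  fixes f g :: "nat \<Rightarrow> 'h::complex_hilbert_space" and a :: "nat \<Rightarrow> complex" and M :: real
  assumes f: "suborth f" and g: "suborth g" and a: "\<And>n. cmod (a n) \<le> M"
begin

lemma opser_coeff_summable: "summable (\<lambda>n. (cmod (a n * cinner x (f n)))\<^sup>2)"
  and opser_coeff_le: "(\<Sum>n. (cmod (a n * cinner x (f n)))\<^sup>2) \<le> (M * norm x)\<^sup>2"
proof -
  have le: "(cmod (a n * cinner x (f n)))\<^sup>2 \<le> M\<^sup>2 * (cmod (cinner x (f n)))\<^sup>2" for n
    unfolding norm_mult power_mult_distrib by (intro mult_right_mono power_mono a) auto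
  have s: "summable (\<lambda>n. M\<^sup>2 * (cmod (cinner x (f n)))\<^sup>2)"
    by (intro summable_mult bessel_summable f)
  show s': "summable (\<lambda>n. (cmod (a n * cinner x (f n)))\<^sup>2)"
    by (rule summable_comparison_test'[OF s, of 0]) (use le in auto)
  have "(\<Sum>n. (cmod (a n * cinner x (f n)))\<^sup>2) \<le> (\<Sum>n. M\<^sup>2 * (cmod (cinner x (f n)))\<^sup>2)"
    by (intro suminf_le le s s')
  also have "\<dots> = M\<^sup>2 * (\<Sum>n. (cmod (cinner x (f n)))\<^sup>2)"
    by (intro suminf_mult bessel_summable f)
  also have "\<dots> \<le> M\<^sup>2 * (norm x)\<^sup>2" by (intro mult_left_mono bessel f) auto
  finally show "(\<Sum>n. (cmod (a n * cinner x (f n)))\<^sup>2) \<le> (M * norm x)\<^sup>2"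
    by (simp add: power_mult_distrib)
qed

lemma opser_summable: "summable (\<lambda>n. (a n * cinner x (f n)) *\<^sub>C g n)"
  by (intro summable_suborth g opser_coeff_summable)

lemma opser_bound_nonneg: "0 \<le> M" using a[of 0] norm_ge_zero order_trans by blast

lemma opser_norm_apply: "norm (\<Sum>n. (a n * cinner x (f n)) *\<^sub>C g n) \<le> M * norm x"
proof (rule power2_le_imp_le)
  show "(norm (\<Sum>n. (a n * cinner x (f n)) *\<^sub>C g n))\<^sup>2 \<le> (M * norm x)\<^sup>2"
    using norm_suminf_suborth_le[OF g opser_coeff_summable] opser_coeff_le order_trans by blast
qed (simp add: opser_bound_nonneg)

lemma opser_apply: "blinfun_apply (opser a f g) x = (\<Sum>n. (a n * cinner x (f n)) *\<^sub>C g n)"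
proof -
  have "bounded_linear (\<lambda>x. \<Sum>n. (a n * cinner x (f n)) *\<^sub>C g n)"
  proof (rule bounded_linear_intro[where K=M])
    fix x y
    show "(\<Sum>n. (a n * cinner (x + y) (f n)) *\<^sub>C g n) =
      (\<Sum>n. (a n * cinner x (f n)) *\<^sub>C g n) + (\<Sum>n. (a n * cinner y (f n)) *\<^sub>C g n)"
      by (subst suminf_add[OF opser_summable opser_summable])
        (simp only: cinner_add_left distrib_left scaleC_add_left)
    fix r
    show "(\<Sum>n. (a n * cinner (r *\<^sub>R x) (f n)) *\<^sub>C g n) = r *\<^sub>R (\<Sum>n. (a n * cinner x (f n)) *\<^sub>C g n)"
      by (subst bounded_linear.suminf[OF bounded_linear_scaleR_right opser_summable])
        (simp add: cinner_scaleC_left scaleR_scaleC scaleC_scaleC mult_ac)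
    show "norm (\<Sum>n. (a n * cinner x (f n)) *\<^sub>C g n) \<le> norm x * M"
      using opser_norm_apply by (simp add: mult.commute)
  qed
  then show ?thesis by (simp add: opser_def bounded_linear_Blinfun_apply)
qed

lemma opser_sums: "(\<lambda>n. (a n * cinner x (f n)) *\<^sub>C g n) sums blinfun_apply (opser a f g) x"
  unfolding opser_apply by (intro summable_sums opser_summable)

lemma opser_in_B_H: "opser a f g \<in> B_H"
  unfolding B_H_iff
proof (intro allI)
  fix c x
  have "(\<lambda>n. c *\<^sub>C ((a n * cinner x (f n)) *\<^sub>C g n)) sums (c *\<^sub>C blinfun_apply (opser a f g) x)"
    by (rule bounded_linear.sums[OF bounded_linear_scaleC_right opser_sums])
  then have "(\<lambda>n. (a n * cinner (c *\<^sub>C x) (f n)) *\<^sub>C g n) sums (c *\<^sub>C blinfun_apply (opser a f g) x)"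
    by (simp add: scaleC_scaleC cinner_scaleC_left mult_ac)
  then show "blinfun_apply (opser a f g) (c *\<^sub>C x) = c *\<^sub>C blinfun_apply (opser a f g) x"
    using opser_sums sums_unique2 by blast
qed

lemma norm_opser_le: "norm (opser a f g) \<le> M"
  by (rule norm_blinfun_bound) (simp_all add: opser_bound_nonneg opser_apply opser_norm_apply)

lemma opser_cinner_sums:
  "(\<lambda>n. a n * cinner x (f n) * cinner (g n) y) sums cinner (blinfun_apply (opser a f g) x) y"
  using bounded_linear.sums[OF bounded_linear_cinner_left opser_sums]
  by (simp add: cinner_scaleC_left)

lemma opser_cinner_basis:
  "cinner (blinfun_apply (opser a f g) x) (g m) = (if g m = 0 then 0 else a m * cinner x (f m))"
proof -
  have "(\<lambda>n. a n * cinner x (f n) * cinner (g n) (g m)) =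
      (\<lambda>n. if n = m then (if g m = 0 then 0 else a m * cinner x (f m)) else 0)"
    by (auto simp: fun_eq_iff suborth_cinner[OF g])
  then have "(\<lambda>n. a n * cinner x (f n) * cinner (g n) (g m)) sums (if g m = 0 then 0 else a m * cinner x (f m))"
    using sums_single[of m "\<lambda>_. if g m = 0 then 0 else a m * cinner x (f m)"] by simp
  with opser_cinner_sums[of x "g m"] show ?thesis by (rule sums_unique2)
qed

lemma opser_apply_basis:
  "blinfun_apply (opser a f g) (f m) = (if f m = 0 then 0 else a m *\<^sub>C g m)"
proof -
  have "(\<lambda>n. (a n * cinner (f m) (f n)) *\<^sub>C g n) = (\<lambda>n. if n = m then (if f m = 0 then 0 else a m *\<^sub>C g m) else 0)"
    by (auto simp: fun_eq_iff suborth_cinner[OF f])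
  then have "(\<lambda>n. (a n * cinner (f m) (f n)) *\<^sub>C g n) sums (if f m = 0 then 0 else a m *\<^sub>C g m)"
    using sums_single[of m "\<lambda>_. if f m = 0 then 0 else a m *\<^sub>C g m"] by simp
  with opser_sums[of "f m"] show ?thesis by (rule sums_unique2)
qed

end

section \<open>Adjoints and products of operators built from orthogonal systems\<close>

lemma adjI:
  assumes "B \<in> B_H" "\<And>x y. cinner (blinfun_apply A x) y = cinner x (blinfun_apply B y)"
  shows "adj A = B"
  unfolding adj_def
proof (rule the_equality)
  fix B' assume B': "B' \<in> B_H \<and> (\<forall>x y. cinner (blinfun_apply A x) y = cinner x (blinfun_apply B' y))"
  show "B' = B"
  proof (rule blinfun_eqI, rule cinner_ext_right)
    fix y x show "cinner x (blinfun_apply B' y) = cinner x (blinfun_apply B y)"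
      using B' assms(2) by metis
  qed
qed (use assms in auto)

lemma opser_adjoint:
  assumes "suborth f" "suborth g" "\<And>n. cmod (a n) \<le> M"
  shows "cinner (blinfun_apply (opser a f g) x) y = cinner x (blinfun_apply (opser (\<lambda>n. cnj (a n)) g f) y)"
proof -
  have "(\<lambda>n. cnj (cnj (a n) * cinner y (g n) * cinner (f n) x)) sums
      cnj (cinner (blinfun_apply (opser (\<lambda>n. cnj (a n)) g f) y) x)"
    unfolding sums_cnj by (rule opser_cinner_sums[where M=M]) (use assms in auto)
  then have "(\<lambda>n. a n * cinner x (f n) * cinner (g n) y) sums cinner x (blinfun_apply (opser (\<lambda>n. cnj (a n)) g f) y)"
    by (simp only: complex_cnj_mult complex_cnj_cnj cnj_cinner mult.assoc mult.left_commute mult.commute)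
  with opser_cinner_sums[OF assms] show ?thesis by (rule sums_unique2)
qed

lemma adj_opser:
  assumes "suborth f" "suborth g" "\<And>n. cmod (a n) \<le> M"
  shows "adj (opser a f g) = opser (\<lambda>n. cnj (a n)) g f"
  by (rule adjI, rule opser_in_B_H[where M=M], use assms in \<open>auto intro: opser_adjoint\<close>)

text \<open>A vanishing \<open>g n\<close> erases the term \<open>n\<close> of the composite, so
  \<open>z\<close> demands that this term is zero on the right-hand side as well. This holds when
  zero vectors sit exactly where the coefficients vanish.\<close>

lemma opser_compose:
  assumes "suborth f" "suborth g" "suborth h" "\<And>n. cmod (a n) \<le> M" "\<And>n. cmod (b n) \<le> M'"
  and z: "\<And>n. g n = 0 \<Longrightarrow> a n * b n = 0 \<or> f n = 0 \<or> h n = 0"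
  shows "opser a g h o\<^sub>L opser b f g = opser (\<lambda>n. a n * b n) f h"
proof (rule blinfun_eqI)
  fix x
  have M: "cmod (a n * b n) \<le> M * M'" for n
    unfolding norm_mult by (intro mult_mono assms order_trans[OF norm_ge_zero assms(4)]) auto
  have "(\<lambda>n. (a n * cinner (blinfun_apply (opser b f g) x) (g n)) *\<^sub>C h n) sums
     blinfun_apply (opser a g h) (blinfun_apply (opser b f g) x)"
    by (rule opser_sums[where M=M]) (use assms in auto)
  also have "(\<lambda>n. (a n * cinner (blinfun_apply (opser b f g) x) (g n)) *\<^sub>C h n) =
     (\<lambda>n. (a n * b n * cinner x (f n)) *\<^sub>C h n)"
  proof
    fix n show "(a n * cinner (blinfun_apply (opser b f g) x) (g n)) *\<^sub>C h n = (a n * b n * cinner x (f n)) *\<^sub>C h n"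
      unfolding opser_cinner_basis[OF assms(1,2,5)]
      by (cases "g n = 0"; cases "f n = 0"; cases "h n = 0") (use z[of n] in \<open>auto simp: mult.assoc\<close>)
  qed
  finally show "blinfun_apply (opser a g h o\<^sub>L opser b f g) x = blinfun_apply (opser (\<lambda>n. a n * b n) f h) x"
    using opser_sums[OF assms(1,3) M] unfolding blinfun_apply_blinfun_compose by (rule sums_unique2)
qed

text \<open>Completeness as a trivial orthogonal complement meets expansions directly: the remainder
  of a vector is orthogonal to every \<open>f n\<close>.\<close>

definition complete_system :: "(nat \<Rightarrow> 'h::complex_hilbert_space) \<Rightarrow> bool" where
  "complete_system f \<longleftrightarrow> (\<forall>z. (\<forall>n. cinner z (f n) = 0) \<longrightarrow> z = 0)"

lemma opser_one_complete:
  assumes "suborth f" "complete_system f" shows "opser (\<lambda>_. 1) f f = id_blinfun"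
proof (rule blinfun_eqI)
  fix x
  have "x - blinfun_apply (opser (\<lambda>_. 1) f f) x = 0"
  proof (rule assms(2)[unfolded complete_system_def, rule_format])
    fix n show "cinner (x - blinfun_apply (opser (\<lambda>_. 1) f f) x) (f n) = 0"
      using opser_cinner_basis[OF assms(1,1), of "\<lambda>_. 1" 1 x n] by (auto simp: cinner_diff_left)
  qed
  then show "blinfun_apply (opser (\<lambda>_. 1) f f) x = blinfun_apply id_blinfun x" by simp
qed

lemma expansion_sums:
  assumes "suborth f" "complete_system f" shows "(\<lambda>n. cinner x (f n) *\<^sub>C f n) sums x"
  using opser_sums[of f f "\<lambda>_. 1" 1 x] assms by (simp add: opser_one_complete)

lemma parseval_cinner_sums:
  assumes "suborth f" "complete_system f" shows "(\<lambda>n. cinner x (f n) * cinner (f n) y) sums cinner x y"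
  using opser_cinner_sums[of f f "\<lambda>_. 1" 1 x y] assms by (simp add: opser_one_complete)

lemma cinner_mult_commute: "cinner x y * cinner y x = of_real ((cmod (cinner x (y::'h::complex_hilbert_space)))\<^sup>2)"
  by (metis cinner_commute complex_norm_square of_real_power)

lemma parseval_sums:
  assumes "suborth f" "complete_system f" shows "(\<lambda>n. (cmod (cinner x (f n)))\<^sup>2) sums (norm x)\<^sup>2"
  using parseval_cinner_sums[OF assms, of x x]
  unfolding cinner_mult_commute cinner_self sums_of_real_iff .

section \<open>Expansions and adjoints in the fixed basis\<close>

locale onb =
  fixes e :: "nat \<Rightarrow> 'h::complex_hilbert_space"
  assumes onb: "orthonormal_basis e"
begin

lemma e_cinner: "cinner (e i) (e j) = (if i = j then 1 else 0)"
  using onb by (simp add: orthonormal_basis_def)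

lemma e_norm [simp]: "norm (e i) = 1"
  by (rule norm_eq_1I) (simp add: e_cinner)

lemma e_nonzero [simp]: "e i \<noteq> 0" using e_norm[of i] by (metis norm_zero zero_neq_one)

lemma e_suborth: "suborth e" unfolding suborth_def by (simp add: e_cinner)

lemma e_complete: "complete_system e"
  unfolding complete_system_def
proof (intro allI impI)
  fix z assume z: "\<forall>n. cinner z (e n) = 0"
  have "cvs.span (range e) \<subseteq> {y. cinner z y = 0}"
  proof
    fix y assume "y \<in> cvs.span (range e)"
    then show "y \<in> {y. cinner z y = 0}"
      by (induction rule: cvs.span_induct_alt) (use z in \<open>auto simp: cinner_add_right cinner_scaleC_right\<close>)
  qed
  moreover have "closed {y. cinner z y = 0}"
    by (intro closed_Collect_eq continuous_intros linear_continuous_on bounded_linear_cinner_right)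
  ultimately have "closure (cvs.span (range e)) \<subseteq> {y. cinner z y = 0}"
    by (rule closure_minimal)
  then have "cinner z z = 0" using onb by (auto simp: orthonormal_basis_def)
  then show "z = 0" by (simp add: cinner_self)
qed

lemmas e_sums = expansion_sums[OF e_suborth e_complete]
lemmas e_parseval_cinner = parseval_cinner_sums[OF e_suborth e_complete]
lemmas e_parseval = parseval_sums[OF e_suborth e_complete]

text \<open>\<open>adj\<close> is a definite description, so an adjoint has to be built. Its value
  at \<open>y\<close> must have the coordinates \<open>cinner y (A (e n))\<close>; the work is to
  see that these are square summable.\<close>

lemma ex_adj:
  fixes A :: "'h \<Rightarrow>\<^sub>L 'h"
  assumes A: "A \<in> B_H"
  shows "\<exists>B\<in>B_H. \<forall>x y. cinner (blinfun_apply A x) y = cinner x (blinfun_apply B y)"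
proof -
  define c where "c y n = cinner y (blinfun_apply A (e n))" for y n
  have fin: "(\<Sum>n<N. (cmod (c y n))\<^sup>2) \<le> (norm A * norm y)\<^sup>2" for y N
  proof -
    \<comment> \<open>Tested on the vector with these same coordinates, the norm bound of
      \<open>A\<close> gives \<open>S \<le> norm A * norm y * sqrt S\<close>.\<close>
    define z where "z = (\<Sum>n<N. c y n *\<^sub>C e n)"
    define S where "S = (\<Sum>n<N. (cmod (c y n))\<^sup>2)"
    have Az: "blinfun_apply A z = (\<Sum>n<N. c y n *\<^sub>C blinfun_apply A (e n))"
      by (simp add: z_def blinfun.sum_right B_H_scaleC[OF A])
    have "cinner y (blinfun_apply A z) = of_real S"
      unfolding Az S_def cinner_sum_right cinner_scaleC_right of_real_sum
      by (intro sum.cong refl) (metis c_def complex_norm_square mult.commute of_real_power)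
    then have "S \<le> cmod (cinner y (blinfun_apply A z))" by simp
    also have "\<dots> \<le> norm y * norm (blinfun_apply A z)" by (rule cinner_Cauchy_Schwarz)
    also have "\<dots> \<le> norm y * (norm A * norm z)" by (intro mult_left_mono norm_blinfun) auto
    finally have 1: "S \<le> norm A * norm y * norm z" by (simp add: mult_ac)
    have np: "(norm z)\<^sup>2 \<le> S" unfolding z_def S_def by (rule norm_sum_suborth_le[OF e_suborth]) simp
    have "S\<^sup>2 \<le> (norm A * norm y * norm z)\<^sup>2"
      by (rule power_mono[OF 1]) (simp add: S_def sum_nonneg)
    also have "\<dots> \<le> (norm A * norm y)\<^sup>2 * S" using np by (simp add: power_mult_distrib mult_left_mono)
    finally have "S * S \<le> (norm A * norm y)\<^sup>2 * S" by (simp add: power2_eq_square)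
    moreover have "0 \<le> S" by (simp add: S_def sum_nonneg)
    ultimately show ?thesis unfolding S_def[symmetric]
      by (metis mult_right_le_imp_le order_le_less zero_le_power2)
  qed
  have sm: "summable (\<lambda>n. (cmod (c y n))\<^sup>2)" for y
    by (rule summableI_nonneg_bounded[where x="(norm A * norm y)\<^sup>2"]) (use fin in auto)
  have le: "(\<Sum>n. (cmod (c y n))\<^sup>2) \<le> (norm A * norm y)\<^sup>2" for y
    by (rule suminf_le_const[OF sm]) (use fin in auto)
  define b where "b y = (\<Sum>n. c y n *\<^sub>C e n)" for y
  have bs: "(\<lambda>n. c y n *\<^sub>C e n) sums b y" for y
    unfolding b_def by (intro summable_sums summable_suborth e_suborth sm)
  have bl: "bounded_linear b"
  proof (rule bounded_linear_intro[where K="norm A"])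
    fix x y
    have "(\<lambda>n. c (x + y) n *\<^sub>C e n) sums (b x + b y)"
      using sums_add[OF bs[of x] bs[of y]] by (simp only: c_def cinner_add_left scaleC_add_left)
    with bs show "b (x + y) = b x + b y" by (rule sums_unique2)
    fix r
    have "(\<lambda>n. c (r *\<^sub>R x) n *\<^sub>C e n) sums (r *\<^sub>R b x)"
      using bounded_linear.sums[OF bounded_linear_scaleR_right[of r] bs[of x]]
      by (simp only: c_def cinner_scaleC_left scaleR_scaleC scaleC_scaleC)
    with bs show "b (r *\<^sub>R x) = r *\<^sub>R b x" by (rule sums_unique2)
    have "(norm (b x))\<^sup>2 \<le> (norm A * norm x)\<^sup>2"
      using norm_suminf_suborth_le[OF e_suborth sm] le order_trans unfolding b_def by blast
    then show "norm (b x) \<le> norm x * norm A"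
      by (metis mult.commute mult_nonneg_nonneg norm_ge_zero power2_le_imp_le)
  qed
  define B where "B = Blinfun b"
  have Bb: "blinfun_apply B y = b y" for y by (simp add: B_def bounded_linear_Blinfun_apply bl)
  have adjB: "cinner (blinfun_apply A x) y = cinner x (blinfun_apply B y)" for x y
  proof -
    have "(\<lambda>n. cinner (blinfun_apply A (cinner x (e n) *\<^sub>C e n)) y) sums cinner (blinfun_apply A x) y"
      by (intro bounded_linear.sums[OF bounded_linear_cinner_left]
          bounded_linear.sums[OF blinfun.bounded_linear_right] e_sums)
    then have 1: "(\<lambda>n. cinner x (e n) * cinner (blinfun_apply A (e n)) y) sums cinner (blinfun_apply A x) y"
      by (simp add: B_H_scaleC[OF A] cinner_scaleC_left)
    have "(\<lambda>n. cinner x (c y n *\<^sub>C e n)) sums cinner x (b y)"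
      by (rule bounded_linear.sums[OF bounded_linear_cinner_right bs])
    then have "(\<lambda>n. cinner x (e n) * cinner (blinfun_apply A (e n)) y) sums cinner x (b y)"
      by (simp add: cinner_scaleC_right c_def mult.commute cnj_cinner)
    then show ?thesis using 1 sums_unique2 Bb by metis
  qed
  have "B \<in> B_H" unfolding B_H_iff
  proof (intro allI cinner_ext_right)
    fix k y x
    show "cinner x (blinfun_apply B (k *\<^sub>C y)) = cinner x (k *\<^sub>C blinfun_apply B y)"
      by (simp add: adjB[symmetric] cinner_scaleC_right)
  qed
  then show ?thesis using adjB by blast
qed

lemma adj_in_B_H: "(A :: 'h \<Rightarrow>\<^sub>L 'h) \<in> B_H \<Longrightarrow> adj A \<in> B_H"
  and cinner_adj_right: "(A :: 'h \<Rightarrow>\<^sub>L 'h) \<in> B_H \<Longrightarrow> cinner (blinfun_apply A x) y = cinner x (blinfun_apply (adj A) y)"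
  using ex_adj adjI by metis+

lemma cinner_adj_left: "(A :: 'h \<Rightarrow>\<^sub>L 'h) \<in> B_H \<Longrightarrow> cinner (blinfun_apply (adj A) x) y = cinner x (blinfun_apply A y)"
  by (metis cinner_adj_right cinner_commute)

text \<open>For \<open>z = adj A x\<close> the square of its norm is \<open>cinner x (A z)\<close>,
  and one factor \<open>norm z\<close> cancels.\<close>

lemma norm_adj_apply: assumes A: "(A :: 'h \<Rightarrow>\<^sub>L 'h) \<in> B_H" shows "norm (blinfun_apply (adj A) x) \<le> norm A * norm x"
proof (cases "norm (blinfun_apply (adj A) x) = 0")
  case False
  let ?z = "blinfun_apply (adj A) x"
  have "complex_of_real ((norm ?z)\<^sup>2) = cinner x (blinfun_apply A ?z)"
    by (simp only: cinner_self[symmetric] cinner_adj_left[OF A])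
  then have "(norm ?z)\<^sup>2 = cmod (cinner x (blinfun_apply A ?z))"
    by (metis norm_of_real abs_power2)
  also have "\<dots> \<le> norm x * norm (blinfun_apply A ?z)" by (rule cinner_Cauchy_Schwarz)
  also have "\<dots> \<le> norm x * (norm A * norm ?z)" by (intro mult_left_mono norm_blinfun) auto
  finally have "norm ?z * norm ?z \<le> (norm A * norm x) * norm ?z" by (simp add: power2_eq_square mult_ac)
  then show ?thesis using False by (metis mult_right_le_imp_le norm_ge_zero order_le_less)
qed simp

end

section \<open>Compact operators\<close>

definition outer :: "'h \<Rightarrow> 'h \<Rightarrow> ('h::complex_hilbert_space \<Rightarrow>\<^sub>L 'h)" where
  "outer k h = Blinfun (\<lambda>x. cinner x h *\<^sub>C k)"

lemma outer_apply [simp]: "blinfun_apply (outer k h) x = cinner x h *\<^sub>C k"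
  unfolding outer_def
  by (rule bounded_linear_Blinfun_apply[THEN fun_cong])
     (rule bounded_linear_compose[OF bounded_linear_scaleC_left bounded_linear_cinner_left])

lemma outer_in_B_H: "outer k h \<in> B_H"
  by (simp add: B_H_iff cinner_scaleC_left scaleC_scaleC)

lemma compact_closure_subset:
  fixes K :: "'a::metric_space set"
  assumes "compact K" "S \<subseteq> K" shows "compact (closure S)"
proof -
  have "closure S \<subseteq> K" by (intro closure_minimal assms compact_imp_closed)
  then show ?thesis using compact_Int_closed[OF assms(1) closed_closure, of S] by (simp add: Int_absorb1)
qed

lemma compact_ops_iff: "A \<in> compact_ops \<longleftrightarrow> A \<in> B_H \<and> (\<exists>K. compact K \<and> blinfun_apply A ` cball 0 1 \<subseteq> K)"
proof -
  have "compact (closure (blinfun_apply A ` cball 0 1)) \<longleftrightarrow> (\<exists>K. compact K \<and> blinfun_apply A ` cball 0 1 \<subseteq> K)"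
    (is "?L \<longleftrightarrow> ?R")
  proof
    assume ?L then show ?R using closure_subset[of "blinfun_apply A ` cball 0 1"] by (intro exI[of _ "closure (blinfun_apply A ` cball 0 1)"] conjI)
  next
    assume ?R then show ?L by (elim exE conjE) (rule compact_closure_subset)
  qed
  then show ?thesis by (simp add: compact_ops_def)
qed

lemma compact_opsI: "A \<in> B_H \<Longrightarrow> compact K \<Longrightarrow> (\<And>x. norm x \<le> 1 \<Longrightarrow> blinfun_apply A x \<in> K) \<Longrightarrow> A \<in> compact_ops"
  unfolding compact_ops_iff by auto

lemma compact_ops_B_H: "A \<in> compact_ops \<Longrightarrow> A \<in> B_H" by (simp add: compact_ops_def)

lemma compact_opsE:
  assumes "A \<in> compact_ops"
  obtains K where "compact K" "\<And>x. norm x \<le> 1 \<Longrightarrow> blinfun_apply A x \<in> K"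
proof -
  from assms obtain K where K: "compact K" "blinfun_apply A ` cball 0 1 \<subseteq> K"
    by (auto simp: compact_ops_iff)
  have "blinfun_apply A x \<in> K" if "norm x \<le> 1" for x using that K(2) by auto
  with K(1) show ?thesis by (rule that)
qed

lemma compact_ops_outer: "outer k h \<in> compact_ops"
proof (rule compact_opsI[OF outer_in_B_H])
  show "compact ((\<lambda>c. c *\<^sub>C k) ` cball 0 (norm h))"
    by (intro compact_continuous_image linear_continuous_on bounded_linear_scaleC_left) simp
  fix x :: 'a assume "norm x \<le> 1"
  then have "norm x * norm h \<le> norm h" by (simp add: mult_left_le_one_le)
  then have "cinner x h \<in> cball 0 (norm h)" using cinner_Cauchy_Schwarz[of x h] by simp
  then show "blinfun_apply (outer k h) x \<in> (\<lambda>c. c *\<^sub>C k) ` cball 0 (norm h)"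
    unfolding outer_apply by (rule imageI)
qed

lemma compact_ops_add:
  assumes "A \<in> compact_ops" "B \<in> compact_ops" shows "A + B \<in> compact_ops"
proof -
  obtain K where K: "compact K" "\<And>x. norm x \<le> 1 \<Longrightarrow> blinfun_apply A x \<in> K"
    using assms(1) compact_opsE by blast
  obtain L where L: "compact L" "\<And>x. norm x \<le> 1 \<Longrightarrow> blinfun_apply B x \<in> L"
    using assms(2) compact_opsE by blast
  show ?thesis
    by (rule compact_opsI[OF B_H_add compact_sums[OF K(1) L(1)]])
       (use assms K L in \<open>auto simp: compact_ops_B_H blinfun.add_left\<close>)
qed

lemma compact_ops_compose_left:
  assumes "A \<in> B_H" "B \<in> compact_ops" shows "A o\<^sub>L B \<in> compact_ops"
proof -
  obtain K where K: "compact K" "\<And>x. norm x \<le> 1 \<Longrightarrow> blinfun_apply B x \<in> K"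
    using assms(2) compact_opsE by blast
  have "compact (blinfun_apply A ` K)"
    by (intro compact_continuous_image K linear_continuous_on blinfun.bounded_linear_right)
  from compact_opsI[OF B_H_compose this] show ?thesis
    using assms K by (auto simp: compact_ops_B_H)
qed

lemma compact_ops_zero: "0 \<in> compact_ops"
  by (rule compact_opsI[of _ "{0}"]) (auto simp: B_H_zero)

lemma compact_ops_sum: "(\<And>i. i \<in> F \<Longrightarrow> A i \<in> compact_ops) \<Longrightarrow> sum A F \<in> compact_ops"
  by (induction F rule: infinite_finite_induct) (auto simp: compact_ops_zero compact_ops_add)

lemma compact_ops_diff:
  assumes "A \<in> compact_ops" "B \<in> compact_ops" shows "A - B \<in> compact_ops"
proof -
  have "- id_blinfun \<in> B_H" by (simp add: B_H_iff blinfun.minus_left)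
  then have "A + ((- id_blinfun) o\<^sub>L B) \<in> compact_ops"
    by (intro compact_ops_add compact_ops_compose_left assms)
  moreover have "A + ((- id_blinfun) o\<^sub>L B) = A - B"
    by (rule blinfun_eqI) (simp add: blinfun.minus_left blinfun.add_left blinfun.diff_left)
  ultimately show ?thesis by simp
qed

text \<open>Total boundedness passes to norm limits: a finite net of radius \<open>r / 4\<close> for
  the image of the ball under a close compact operator is a net of radius \<open>r / 2\<close> for
  its image under \<open>A\<close>.\<close>

lemma compact_ops_limit:
  assumes A: "A \<in> B_H" and lim: "\<And>r. r > 0 \<Longrightarrow> \<exists>K\<in>compact_ops. norm (A - K) \<le> r"
  shows "A \<in> compact_ops"
proof -
  let ?S = "blinfun_apply A ` cball 0 1"
  have "compact (closure ?S)"
    unfolding compact_eq_totally_bounded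
  proof (intro conjI allI impI)
    show "complete (closure ?S)" by (simp add: complete_eq_closed)
    fix r :: real assume r: "r > 0"
    then obtain C where C: "C \<in> compact_ops" "norm (A - C) \<le> r / 4" using lim[of "r / 4"] by auto
    obtain K where K: "compact K" "\<And>x. norm x \<le> 1 \<Longrightarrow> blinfun_apply C x \<in> K"
      using C(1) compact_opsE by blast
    obtain k where k: "finite k" "K \<subseteq> (\<Union>x\<in>k. ball x (r / 4))"
      using K(1) r unfolding compact_eq_totally_bounded by (meson zero_less_divide_iff zero_less_numeral)
    \<comment> \<open>Closed balls of half the radius: their finite union is closed, so it also
      covers the closure.\<close>
    have "?S \<subseteq> (\<Union>x\<in>k. cball x (r / 2))"
    proof (rule image_subsetI)
      fix x :: 'a assume "x \<in> cball 0 1"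
      then have x: "norm x \<le> 1" by simp
      then obtain y where y: "y \<in> k" "dist y (blinfun_apply C x) < r / 4" using K(2) k(2) by fastforce
      have "dist (blinfun_apply C x) (blinfun_apply A x) = norm (blinfun_apply (A - C) x)"
        by (simp add: dist_norm norm_minus_commute blinfun.diff_left)
      also have "\<dots> \<le> norm (A - C) * norm x" by (rule norm_blinfun)
      also have "\<dots> \<le> r / 4" using C(2) x mult_left_le[of "norm x" "norm (A - C)"] by simp
      finally have "dist y (blinfun_apply A x) \<le> r / 2"
        using y(2) dist_triangle[of y "blinfun_apply A x" "blinfun_apply C x"] by simp
      then show "blinfun_apply A x \<in> (\<Union>x\<in>k. cball x (r / 2))" using y(1) by auto
    qed
    moreover have "closed (\<Union>x\<in>k. cball x (r / 2))" using k(1) by auto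
    ultimately have "closure ?S \<subseteq> (\<Union>x\<in>k. cball x (r / 2))" by (rule closure_minimal)
    also have "\<dots> \<subseteq> (\<Union>x\<in>k. ball x r)" using r by fastforce
    finally show "\<exists>k. finite k \<and> closure ?S \<subseteq> (\<Union>x\<in>k. ball x r)" using k(1) by blast
  qed
  then show ?thesis using A by (simp add: compact_ops_def)
qed

lemma compact_ops_subseq:
  fixes x :: "nat \<Rightarrow> 'h::complex_hilbert_space"
  assumes "A \<in> compact_ops" "\<And>n. norm (x n) \<le> 1"
  obtains l r where "strict_mono r" "(\<lambda>n. blinfun_apply A (x (r n))) \<longlonglongrightarrow> l"
proof -
  obtain K where K: "compact K" "\<And>x. norm x \<le> 1 \<Longrightarrow> blinfun_apply A x \<in> K"
    using assms(1) compact_opsE by blast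
  have "\<forall>n. blinfun_apply A (x n) \<in> K" using K(2) assms(2) by blast
  then obtain l and r :: "nat \<Rightarrow> nat" where "strict_mono r" "((\<lambda>n. blinfun_apply A (x n)) \<circ> r) \<longlonglongrightarrow> l"
    using K(1)[unfolded compact_eq_seq_compact_metric seq_compact_def] by meson
  then show ?thesis using that by (simp add: o_def)
qed

text \<open>The truncation where the coefficients drop below \<open>r\<close> has finite rank, and
  the rest is an operator of the same form with coefficients at most \<open>r\<close>.\<close>

lemma opser_compact:
  assumes f: "suborth f" and g: "suborth g" and a: "a \<longlonglongrightarrow> 0"
  shows "opser a f g \<in> compact_ops"
proof -
  have "Bseq a" using a convergentI convergent_imp_Bseq by blast
  then obtain M where M: "\<And>n. cmod (a n) \<le> M" unfolding Bseq_def by blast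
  show ?thesis
  proof (rule compact_ops_limit)
    show "opser a f g \<in> B_H" by (rule opser_in_B_H[OF f g M])
    fix r :: real assume r: "r > 0"
    then obtain N where N: "\<And>n. n \<ge> N \<Longrightarrow> cmod (a n) < r" using a unfolding LIMSEQ_iff by auto
    define K where "K = (\<Sum>n<N. outer (a n *\<^sub>C g n) (f n))"
    have K: "K \<in> compact_ops" unfolding K_def by (intro compact_ops_sum compact_ops_outer)
    let ?b = "\<lambda>n. if n < N then 0 else a n"
    have b: "cmod (?b n) \<le> r" for n using N[of n] r by auto
    have "opser a f g - K = opser ?b f g"
    proof (rule blinfun_eqI)
      fix x
      let ?t = "\<lambda>n. (a n * cinner x (f n)) *\<^sub>C g n"
      have "(\<lambda>n. ?t n - (if n \<in> {..<N} then ?t n else 0)) sums (blinfun_apply (opser a f g) x - (\<Sum>n<N. ?t n))"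
        by (intro sums_diff opser_sums[OF f g M] sums_If_finite_set) simp
      moreover have "(\<lambda>n. ?t n - (if n \<in> {..<N} then ?t n else 0)) = (\<lambda>n. (?b n * cinner x (f n)) *\<^sub>C g n)"
        by auto
      moreover have "blinfun_apply K x = (\<Sum>n<N. ?t n)"
        unfolding K_def blinfun.sum_left by (intro sum.cong refl) (simp add: scaleC_scaleC mult.commute)
      ultimately have "(\<lambda>n. (?b n * cinner x (f n)) *\<^sub>C g n) sums blinfun_apply (opser a f g - K) x"
        by (simp add: blinfun.diff_left)
      then show "blinfun_apply (opser a f g - K) x = blinfun_apply (opser ?b f g) x"
        using opser_sums[OF f g b] by (rule sums_unique2)
    qed
    then have "norm (opser a f g - K) \<le> r" using norm_opser_le[OF f g b] by simp
    with K show "\<exists>K\<in>compact_ops. norm (opser a f g - K) \<le> r" by blast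
  qed
qed

section \<open>The singular value decomposition\<close>

lemma blinfun_norm_lower:
  assumes "b < norm (A :: 'a::real_normed_vector \<Rightarrow>\<^sub>L 'b::real_normed_vector)" "0 \<le> b"
  obtains x where "norm (blinfun_apply A x) > b * norm x"
  using assms norm_blinfun_bound[of b A] by (meson not_le)

lemma norm_remove_component:
  assumes "f = 0 \<or> norm f = 1"
  shows "norm (x - cinner x f *\<^sub>C f) \<le> norm (x :: 'h::complex_hilbert_space)"
proof -
  let ?p = "cinner x f *\<^sub>C f"
  have "cinner (x - ?p) ?p = 0"
    using assms by (auto simp: cinner_linear cinner_self)
  then have "(norm ((x - ?p) + ?p))\<^sup>2 = (norm (x - ?p))\<^sup>2 + (norm ?p)\<^sup>2" by (rule norm_add_orthogonal)
  then have "(norm (x - ?p))\<^sup>2 \<le> (norm x)\<^sup>2" by simp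
  then show ?thesis by (rule power2_le_imp_le) simp
qed

text \<open>A vector that attains the norm and is an eigenvector of
  \<open>adj X o\<^sub>L X\<close>. The value 0 at \<open>X = 0\<close> makes the deflation produce
  zero vectors exactly where the singular numbers vanish.\<close>

definition top_vector :: "('h::complex_hilbert_space \<Rightarrow>\<^sub>L 'h) \<Rightarrow> 'h" where
  "top_vector X = (if X = 0 then 0 else SOME f. norm f = 1 \<and> norm (blinfun_apply X f) = norm X \<and>
      blinfun_apply (adj X) (blinfun_apply X f) = (norm X)\<^sup>2 *\<^sub>R f)"

text \<open>Each step precedes the current operator by the projection off its top vector; the norms
  along the way are the singular numbers.\<close>

primrec deflate :: "('h::complex_hilbert_space \<Rightarrow>\<^sub>L 'h) \<Rightarrow> nat \<Rightarrow> ('h \<Rightarrow>\<^sub>L 'h)" where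
  "deflate X 0 = X"
| "deflate X (Suc n) = deflate X n -
     outer (blinfun_apply (deflate X n) (top_vector (deflate X n))) (top_vector (deflate X n))"

context onb
begin

text \<open>On a maximizing sequence \<open>adj X (X f)\<close> approaches
  \<open>(norm X)\<^sup>2 *\<^sub>R f\<close>. Compactness makes the images converge along a
  subsequence, and this relation transfers the convergence to the vectors themselves.\<close>

lemma norm_attained:
  fixes X :: "'h \<Rightarrow>\<^sub>L 'h"
  assumes X: "X \<in> compact_ops" and "X \<noteq> 0"
  shows "\<exists>f. norm f = 1 \<and> norm (blinfun_apply X f) = norm X \<and>
      blinfun_apply (adj X) (blinfun_apply X f) = (norm X)\<^sup>2 *\<^sub>R f"
proof -
  note XB = compact_ops_B_H[OF X]
  define s where "s = norm X"
  have s: "s > 0" using assms by (simp add: s_def)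
  \<comment> \<open>The square is expanded and \<open>norm (adj X y) \<le> s * norm y\<close>
    inserted: a unit vector that almost attains the norm is almost an eigenvector.\<close>
  have key: "(norm (blinfun_apply (adj X) (blinfun_apply X f) - s\<^sup>2 *\<^sub>R f))\<^sup>2
      \<le> s\<^sup>2 * (s\<^sup>2 - (norm (blinfun_apply X f))\<^sup>2)" if f: "norm f = 1" for f
  proof -
    let ?T = "blinfun_apply (adj X) (blinfun_apply X f)"
    have "inner ?T f = (norm (blinfun_apply X f))\<^sup>2"
      unfolding inner_eq_Re_cinner cinner_adj_left[OF XB] cinner_self by simp
    then have "(norm (?T - s\<^sup>2 *\<^sub>R f))\<^sup>2 = (norm ?T)\<^sup>2 - 2 * s\<^sup>2 * (norm (blinfun_apply X f))\<^sup>2 + s\<^sup>2 * s\<^sup>2"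
      using f unfolding power2_norm_eq_inner
      by (simp add: inner_diff_left inner_diff_right inner_commute norm_eq_1)
    moreover have "(norm ?T)\<^sup>2 \<le> (s * norm (blinfun_apply X f))\<^sup>2"
      unfolding s_def by (intro power_mono norm_adj_apply XB) simp
    ultimately show ?thesis by (simp add: power_mult_distrib algebra_simps)
  qed
  have "\<exists>f. norm f = 1 \<and> s - 1 / real (Suc k) < norm (blinfun_apply X f)" for k
  proof -
    \<comment> \<open>The maximum with 0 is there because the lower bound on norms is available for
      nonnegative \<open>b\<close> only.\<close>
    define b where "b = max 0 (s - 1 / real (Suc k))"
    have "b < norm X" using s by (simp add: b_def s_def)
    then obtain x where x: "norm (blinfun_apply X x) > b * norm x"
      using blinfun_norm_lower[of b X] by (auto simp: b_def)
    then have "x \<noteq> 0" by auto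
    then have "norm ((1 / norm x) *\<^sub>R x) = 1" "b < norm (blinfun_apply X ((1 / norm x) *\<^sub>R x))"
      using x by (simp_all add: blinfun.scaleR_right field_simps)
    then show ?thesis unfolding b_def by (metis max_less_iff_conj)
  qed
  then obtain f where f: "\<And>k. norm (f k) = 1" "\<And>k. s - 1 / real (Suc k) < norm (blinfun_apply X (f k))"
    by metis
  have up: "norm (blinfun_apply X (f k)) \<le> s" for k
    using norm_blinfun[of X "f k"] f(1) by (simp add: s_def)
  have lims: "(\<lambda>k. norm (blinfun_apply X (f k))) \<longlonglongrightarrow> s"
  proof (rule tendsto_sandwich[of "\<lambda>k. s - 1 / real (Suc k)" _ _ "\<lambda>_. s"])
    have "(\<lambda>k. s - 1 / real (Suc k)) \<longlonglongrightarrow> s - 0"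
      using LIMSEQ_inverse_real_of_nat by (intro tendsto_diff tendsto_const) (simp add: inverse_eq_divide)
    then show "(\<lambda>k. s - 1 / real (Suc k)) \<longlonglongrightarrow> s" by simp
  qed (use f(2) up in \<open>auto intro!: always_eventually less_imp_le simp del: of_nat_Suc\<close>)
  have "(\<lambda>k. s\<^sup>2 * (s\<^sup>2 - (norm (blinfun_apply X (f k)))\<^sup>2)) \<longlonglongrightarrow> s\<^sup>2 * (s\<^sup>2 - s\<^sup>2)"
    by (intro tendsto_intros lims)
  then have "(\<lambda>k. s\<^sup>2 * (s\<^sup>2 - (norm (blinfun_apply X (f k)))\<^sup>2)) \<longlonglongrightarrow> 0" by simp
  then have "(\<lambda>k. (norm (blinfun_apply (adj X) (blinfun_apply X (f k)) - s\<^sup>2 *\<^sub>R f k))\<^sup>2) \<longlonglongrightarrow> 0"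
    by (rule tendsto_sandwich[OF always_eventually always_eventually tendsto_const, rotated 2]) (use key f in auto)
  then have "(\<lambda>k. sqrt ((norm (blinfun_apply (adj X) (blinfun_apply X (f k)) - s\<^sup>2 *\<^sub>R f k))\<^sup>2)) \<longlonglongrightarrow> sqrt 0"
    by (rule tendsto_real_sqrt)
  then have d0: "(\<lambda>k. blinfun_apply (adj X) (blinfun_apply X (f k)) - s\<^sup>2 *\<^sub>R f k) \<longlonglongrightarrow> 0"
    by (simp add: tendsto_norm_zero_iff)
  obtain l r where r: "strict_mono r" and l: "(\<lambda>n. blinfun_apply X (f (r n))) \<longlonglongrightarrow> l"
    by (rule compact_ops_subseq[OF X eq_refl[OF f(1)]])
  \<comment> \<open>Since \<open>s\<^sup>2 *\<^sub>R f (r n)\<close> and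
    \<open>adj X (X (f (r n)))\<close> have the same limit \<open>adj X l\<close>, division by
    \<open>s\<^sup>2\<close> gives the limit of the vectors.\<close>
  define f0 where "f0 = (1 / s\<^sup>2) *\<^sub>R blinfun_apply (adj X) l"
  have "(\<lambda>n. blinfun_apply (adj X) (blinfun_apply X (f (r n)))) \<longlonglongrightarrow> blinfun_apply (adj X) l"
    by (intro bounded_linear.tendsto[OF blinfun.bounded_linear_right] l)
  from tendsto_diff[OF this LIMSEQ_subseq_LIMSEQ[OF d0 r, unfolded o_def]]
  have "(\<lambda>n. s\<^sup>2 *\<^sub>R f (r n)) \<longlonglongrightarrow> blinfun_apply (adj X) l" by simp
  from tendsto_scaleR[OF tendsto_const[of "1 / s\<^sup>2"] this]
  have fl: "(\<lambda>n. f (r n)) \<longlonglongrightarrow> f0" using s by (simp add: f0_def)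
  have 1: "norm f0 = 1" using tendsto_norm[OF fl] f(1) by (simp add: LIMSEQ_const_iff)
  have "(\<lambda>n. norm (blinfun_apply X (f (r n)))) \<longlonglongrightarrow> norm (blinfun_apply X f0)"
    by (intro tendsto_norm bounded_linear.tendsto[OF blinfun.bounded_linear_right] fl)
  with LIMSEQ_subseq_LIMSEQ[OF lims r, unfolded o_def]
  have 2: "norm (blinfun_apply X f0) = s" using LIMSEQ_unique by blast
  have "blinfun_apply (adj X) (blinfun_apply X f0) = s\<^sup>2 *\<^sub>R f0" using key[OF 1] 2 by simp
  with 1 2 show ?thesis unfolding s_def by blast
qed

context
  fixes X :: "'h \<Rightarrow>\<^sub>L 'h"
  assumes X: "X \<in> compact_ops"
begin

private definition "Y n = deflate X n"
private definition "f n = top_vector (Y n)"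
private definition "s n = norm (Y n)"
private definition "g n = (1 / s n) *\<^sub>R blinfun_apply (Y n) (f n)"

private lemma Y_Suc: "Y (Suc n) = Y n - outer (blinfun_apply (Y n) (f n)) (f n)"
  by (simp add: Y_def f_def)

private lemma Y_compact: "Y n \<in> compact_ops"
proof (induction n)
  case 0 show ?case using X by (simp add: Y_def)
next
  case (Suc n) then show ?case unfolding Y_Suc by (intro compact_ops_diff compact_ops_outer)
qed

private lemma Y_Suc_apply: "blinfun_apply (Y (Suc n)) x = blinfun_apply (Y n) (x - cinner x (f n) *\<^sub>C f n)"
  by (simp add: Y_Suc blinfun.diff_left blinfun.diff_right B_H_scaleC[OF compact_ops_B_H[OF Y_compact]])

private lemma f_zero: "s n = 0 \<Longrightarrow> f n = 0"
  by (simp add: s_def f_def top_vector_def)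

private lemma f_norm: "s n \<noteq> 0 \<Longrightarrow> norm (f n) = 1"
  and Yf_norm: "norm (blinfun_apply (Y n) (f n)) = s n"
  and Tf: "blinfun_apply (adj (Y n)) (blinfun_apply (Y n) (f n)) = (s n)\<^sup>2 *\<^sub>R f n"
proof -
  have "norm (f n) = 1 \<and> norm (blinfun_apply (Y n) (f n)) = norm (Y n) \<and>
      blinfun_apply (adj (Y n)) (blinfun_apply (Y n) (f n)) = (norm (Y n))\<^sup>2 *\<^sub>R f n" if "Y n \<noteq> 0"
    using someI_ex[OF norm_attained[OF Y_compact that]] that unfolding f_def top_vector_def by simp
  then show "s n \<noteq> 0 \<Longrightarrow> norm (f n) = 1" "norm (blinfun_apply (Y n) (f n)) = s n"
    "blinfun_apply (adj (Y n)) (blinfun_apply (Y n) (f n)) = (s n)\<^sup>2 *\<^sub>R f n"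
    using f_zero[of n] by (cases "Y n = 0"; simp add: s_def)+
qed

private lemma f_01: "f n = 0 \<or> norm (f n) = 1" using f_norm f_zero by blast

private lemma cinner_Yf: "cinner (blinfun_apply (Y n) (f n)) (blinfun_apply (Y n) x) = of_real ((s n)\<^sup>2) * cinner (f n) x"
  using cinner_adj_left[OF compact_ops_B_H[OF Y_compact], of n "blinfun_apply (Y n) (f n)" x]
  by (simp add: Tf cinner_scaleR_left)

text \<open>An eigenvector of \<open>adj (Y n) o\<^sub>L Y n\<close> with nonzero eigenvalue is
  orthogonal to the kernel of \<open>Y n\<close>, and this kernel contains all top vectors removed
  before; for \<open>s n = 0\<close> the vector itself is 0.\<close>

private lemma f_orth: "i < n \<Longrightarrow> cinner (f n) (f i) = 0"
proof -
  have orth: "cinner (f n) (f i) = 0" if "blinfun_apply (Y n) (f i) = 0" for n i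
    using cinner_Yf[of n "f i"] that f_zero[of n] by auto
  have "\<forall>i<n. blinfun_apply (Y n) (f i) = 0" for n
  proof (induction n)
    case (Suc n)
    show ?case
    proof (intro allI impI)
      fix i assume "i < Suc n"
      then consider "i < n" | "i = n" by linarith
      then show "blinfun_apply (Y (Suc n)) (f i) = 0"
      proof cases
        case 1
        then have "blinfun_apply (Y n) (f i) = 0" using Suc by blast
        moreover from this have "cinner (f i) (f n) = 0" using orth cinner_eq_zero_commute by blast
        ultimately show ?thesis by (simp add: Y_Suc blinfun.diff_left)
      next
        case 2
        then show ?thesis using f_01[of n] by (auto simp: Y_Suc_apply cinner_self scaleC_one)
      qed
    qed
  qed simp
  then show "i < n \<Longrightarrow> cinner (f n) (f i) = 0" by (intro orth) blast
qed

private lemma Y_f: "i \<le> m \<Longrightarrow> blinfun_apply (Y i) (f m) = blinfun_apply X (f m)"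
proof (induction i)
  case 0 show ?case by (simp add: Y_def)
next
  case (Suc i) then show ?case using f_orth[of i m] by (simp add: Y_Suc blinfun.diff_left)
qed

private lemma Yf_eq: "blinfun_apply (Y n) (f n) = s n *\<^sub>R g n"
  using Yf_norm[of n] by (cases "s n = 0") (simp_all add: g_def)

private lemma f_suborth: "suborth f"
  using f_orth f_01 by (auto intro!: suborthI simp: cinner_eq_zero_commute)

text \<open>Both images can be computed with \<open>Y i\<close>, where the eigenvector equation
  reduces their product to that of \<open>f i\<close> and \<open>f m\<close>.\<close>

private lemma Xf_orth: "i < m \<Longrightarrow> cinner (blinfun_apply X (f m)) (blinfun_apply X (f i)) = 0"
  using cinner_Yf[of i "f m"] f_orth[of i m] Y_f[of i m] Y_f[of i i]
  by (metis cinner_eq_zero_commute mult_zero_right less_imp_le order_refl)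

private lemma g_suborth: "suborth g"
proof (rule suborthI)
  fix i j :: nat assume "i < j"
  then show "cinner (g i) (g j) = 0"
    using Xf_orth[of i j] by (simp add: g_def cinner_scaleR_left cinner_scaleR_right Y_f cinner_eq_zero_commute)
next
  fix i show "g i = 0 \<or> norm (g i) = 1" using Yf_norm[of i] norm_ge_zero[of "Y i"]
    by (cases "s i = 0") (simp_all add: g_def s_def)
qed

private lemma s_decseq: "decseq s"
proof (rule decseq_SucI)
  fix n
  have "norm (blinfun_apply (Y (Suc n)) x) \<le> norm (Y n) * norm x" for x
    unfolding Y_Suc_apply
    by (rule order_trans[OF norm_blinfun mult_left_mono[OF norm_remove_component[OF f_01] norm_ge_zero]])
  then show "s (Suc n) \<le> s n" unfolding s_def by (intro norm_blinfun_bound) auto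
qed

text \<open>A positive limit \<open>L\<close> would leave the orthogonal vectors
  \<open>X (f n)\<close> at mutual distance at least \<open>L\<close>, against compactness.\<close>

private lemma s_lim: "s \<longlonglongrightarrow> 0"
proof -
  obtain L where L: "s \<longlonglongrightarrow> L" "\<And>n. L \<le> s n"
    using decseq_convergent[OF s_decseq, of 0] by (auto simp: s_def)
  have L0: "L \<ge> 0" using L(1) by (rule LIMSEQ_le_const) (auto simp: s_def)
  have "L \<le> 0"
  proof (rule ccontr)
    assume "\<not> L \<le> 0"
    then have Lp: "L > 0" by simp
    obtain l r where r: "strict_mono r" and l: "(\<lambda>n. blinfun_apply X (f (r n))) \<longlonglongrightarrow> l"
      by (rule compact_ops_subseq[OF X suborth_norm_le[OF f_suborth]])
    then have "Cauchy (\<lambda>n. blinfun_apply X (f (r n)))" using LIMSEQ_imp_Cauchy by blast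
    then obtain N where N: "\<And>m n. m \<ge> N \<Longrightarrow> n \<ge> N \<Longrightarrow> dist (blinfun_apply X (f (r m))) (blinfun_apply X (f (r n))) < L"
      using Lp unfolding Cauchy_def by blast
    have "r N < r (Suc N)" using r by (simp add: strict_mono_def)
    then have "(norm (blinfun_apply X (f (r (Suc N))) - blinfun_apply X (f (r N))))\<^sup>2 = (s (r (Suc N)))\<^sup>2 + (s (r N))\<^sup>2"
      using norm_diff_orthogonal[OF Xf_orth] Yf_norm Y_f by (metis order_refl)
    also have "\<dots> \<ge> L\<^sup>2 + L\<^sup>2" using L(2) L0 by (intro add_mono power_mono) auto
    finally have "L\<^sup>2 \<le> (norm (blinfun_apply X (f (r (Suc N))) - blinfun_apply X (f (r N))))\<^sup>2"
      by (smt (verit) zero_le_power2)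
    then have "L \<le> norm (blinfun_apply X (f (r (Suc N))) - blinfun_apply X (f (r N)))"
      by (rule power2_le_imp_le) simp
    then show False using N[of "Suc N" N] by (simp add: dist_norm)
  qed
  with L0 L(1) show ?thesis by simp
qed

private lemma X_expand: "blinfun_apply X x = (\<Sum>i<n. (of_real (s i) * cinner x (f i)) *\<^sub>C g i) + blinfun_apply (Y n) x"
proof (induction n)
  case 0 show ?case by (simp add: Y_def)
next
  case (Suc n)
  have "blinfun_apply (Y n) x = (of_real (s n) * cinner x (f n)) *\<^sub>C g n + blinfun_apply (Y (Suc n)) x"
    by (simp add: Y_Suc blinfun.diff_left Yf_eq scaleR_scaleC scaleC_scaleC mult.commute)
  then show ?case using Suc by simp
qed

text \<open>Zero vectors exactly where \<open>s\<close> vanishes: this is the normalization that the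
  rules for products and moduli ask for.\<close>

lemma svd:
  obtains s f g where "s \<in> c0_star" "suborth f" "suborth g" "\<And>n. f n = 0 \<longleftrightarrow> s n = 0"
    "\<And>n. g n = 0 \<longleftrightarrow> s n = 0" "X = opser (\<lambda>n. complex_of_real (s n)) f g"
proof (rule that)
  show "s \<in> c0_star" using s_decseq s_lim by (simp add: c0_star_def s_def)
  show "suborth f" "suborth g" by (rule f_suborth g_suborth)+
  show "f n = 0 \<longleftrightarrow> s n = 0" for n using f_zero f_norm by (metis norm_zero zero_neq_one)
  show "g n = 0 \<longleftrightarrow> s n = 0" for n using Yf_norm[of n] by (auto simp: g_def)
  have b: "cmod (complex_of_real (s n)) \<le> s 0" for n
    using s_decseq by (simp add: decseq_def s_def)
  show "X = opser (\<lambda>n. complex_of_real (s n)) f g"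
  proof (rule blinfun_eqI)
    fix x
    have "(\<lambda>n. blinfun_apply (Y n) x) \<longlonglongrightarrow> 0"
    proof (rule Lim_null_comparison)
      show "\<forall>\<^sub>F n in sequentially. norm (blinfun_apply (Y n) x) \<le> s n * norm x"
        by (simp add: s_def norm_blinfun)
      show "(\<lambda>n. s n * norm x) \<longlonglongrightarrow> 0" using tendsto_mult_left_zero[OF s_lim] .
    qed
    then have "(\<lambda>n. blinfun_apply X x - blinfun_apply (Y n) x) \<longlonglongrightarrow> blinfun_apply X x - 0"
      by (intro tendsto_intros)
    moreover have "blinfun_apply X x - blinfun_apply (Y n) x = (\<Sum>i<n. (of_real (s i) * cinner x (f i)) *\<^sub>C g i)" for n
      using X_expand[of x n] by simp
    ultimately have "(\<lambda>i. (of_real (s i) * cinner x (f i)) *\<^sub>C g i) sums blinfun_apply X x"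
      by (simp add: sums_def)
    then show "blinfun_apply X x = blinfun_apply (opser (\<lambda>n. complex_of_real (s n)) f g) x"
      using opser_sums[OF f_suborth g_suborth b] by (rule sums_unique2)
  qed
qed

end

end

section \<open>Singular numbers\<close>

lemma c0_star_nonneg: "s \<in> c0_star \<Longrightarrow> 0 \<le> s n"
  and c0_star_decseq: "s \<in> c0_star \<Longrightarrow> decseq s"
  and c0_star_lim: "s \<in> c0_star \<Longrightarrow> s \<longlonglongrightarrow> 0"
  by (simp_all add: c0_star_def)

lemma c0_star_antimono: "s \<in> c0_star \<Longrightarrow> m \<le> n \<Longrightarrow> s n \<le> s m"
  by (simp add: c0_star_def decseq_def)

lemma c0_star_cmod_le: "s \<in> c0_star \<Longrightarrow> cmod (complex_of_real (s n)) \<le> s 0"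
  using c0_star_antimono[of s 0 n] by (simp add: c0_star_nonneg)

lemma c0_star_finite_ge:
  assumes "s \<in> c0_star" "t > 0" shows "finite {n. t \<le> s n}"
proof -
  obtain N where N: "\<And>n. n \<ge> N \<Longrightarrow> s n < t"
    using order_tendstoD(2)[OF c0_star_lim[OF assms(1)] assms(2)] by (auto simp: eventually_sequentially)
  have "{n. t \<le> s n} \<subseteq> {..<N}" using N by (auto simp: not_le[symmetric])
  then show ?thesis using finite_subset by blast
qed

text \<open>A nonincreasing null sequence is determined by the sizes of the initial segments
  \<open>{n. t \<le> s n}\<close> for \<open>t > 0\<close>, and each size is a finite sum of
  multiplicities of values at least \<open>t\<close>.\<close>

lemma c0_star_eq_iff_multiplicities:
  assumes s: "s \<in> c0_star" and s': "s' \<in> c0_star"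
    and eq: "\<And>t. t > 0 \<Longrightarrow> card {n. s n = t} = card {n. s' n = t}"
  shows "s = s'"
proof -
  have level: "{n. t \<le> r n} = {..<card {n. t \<le> r n}}" if r: "r \<in> c0_star" and t: "t > 0" for r t
  proof -
    have dc: "m \<in> {n. t \<le> r n}" if "n \<in> {n. t \<le> r n}" "m \<le> n" for m n
      using that c0_star_antimono[OF r, of m n] by auto
    obtain N where N: "{n. t \<le> r n} = {..<N}"
    proof -
      define N where "N = (LEAST n. r n < t)"
      have ex: "\<exists>n. r n < t"
        using order_tendstoD(2)[OF c0_star_lim[OF r] t] by (auto simp: eventually_sequentially)
      have "r N < t" unfolding N_def using ex by (rule LeastI_ex)
      then have "{n. t \<le> r n} = {..<N}"
        using dc[of _ N] not_less_Least[of _ "\<lambda>n. r n < t"] by (force simp: N_def[symmetric] not_less)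
      then show ?thesis by (rule that)
    qed
    then show ?thesis by simp
  qed
  have count: "card {n. t \<le> r n} = (\<Sum>u\<in>V. card {n. r n = u})"
    if r: "r \<in> c0_star" and t: "t > 0" and V: "finite V" "r ` {n. t \<le> r n} \<subseteq> V" "\<And>u. u \<in> V \<Longrightarrow> t \<le> u" for r t V
  proof -
    have "{n. t \<le> r n} = (\<Union>u\<in>V. {n. r n = u})" using V by auto
    also have "card \<dots> = (\<Sum>u\<in>V. card {n. r n = u})"
    proof (rule card_UN_disjoint[OF V(1)])
      show "\<forall>u\<in>V. finite {n. r n = u}"
        using V(3) by (auto intro!: finite_subset[OF _ c0_star_finite_ge[OF r t]])
    qed auto
    finally show ?thesis .
  qed
  have same: "t \<le> s n \<longleftrightarrow> t \<le> s' n" if t: "t > 0" for t n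
  proof -
    \<comment> \<open>Values of both sequences together, so that the two counts run over the same
      finite set and agree term by term.\<close>
    define V where "V = s ` {n. t \<le> s n} \<union> s' ` {n. t \<le> s' n}"
    have V: "finite V" "\<And>u. u \<in> V \<Longrightarrow> t \<le> u"
      using c0_star_finite_ge[OF s t] c0_star_finite_ge[OF s' t] by (auto simp: V_def)
    have "card {n. t \<le> s n} = (\<Sum>u\<in>V. card {n. s n = u})"
      by (rule count[OF s t V(1) _ V(2)]) (auto simp: V_def)
    also have "\<dots> = (\<Sum>u\<in>V. card {n. s' n = u})"
      using V(2) t by (intro sum.cong refl eq) force
    also have "\<dots> = card {n. t \<le> s' n}"
      by (rule count[OF s' t V(1) _ V(2), symmetric]) (auto simp: V_def)
    finally have "{n. t \<le> s n} = {n. t \<le> s' n}" using level[OF s t] level[OF s' t] by simp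
    then show ?thesis by auto
  qed
  show ?thesis
  proof
    fix n
    show "s n = s' n"
      using same[of "s n" n] same[of "s' n" n] c0_star_nonneg[OF s, of n] c0_star_nonneg[OF s', of n]
      by (cases "s n > 0"; cases "s' n > 0") auto
  qed
qed

context
  fixes s :: "nat \<Rightarrow> real" and f g :: "nat \<Rightarrow> 'h::complex_hilbert_space"
  assumes s: "s \<in> c0_star" and f: "suborth f" and g: "suborth g"
    and f0: "\<And>n. f n = 0 \<longleftrightarrow> s n = 0" and g0: "\<And>n. g n = 0 \<longleftrightarrow> s n = 0"
begin

private abbreviation (input) "c \<equiv> \<lambda>n. complex_of_real (s n)"
private lemmas sb = c0_star_cmod_le[OF s]

private lemma cinner_c_nonneg: "cinner (blinfun_apply (opser c f f) x) x \<in> \<real>\<^sub>\<ge>\<^sub>0"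
proof -
  have "(\<lambda>n. complex_of_real (s n * (cmod (cinner x (f n)))\<^sup>2)) sums cinner (blinfun_apply (opser c f f) x) x"
    using opser_cinner_sums[OF f f, of c "s 0" x x, OF sb]
    unfolding mult.assoc cinner_mult_commute of_real_mult .
  then have "(\<lambda>n. s n * (cmod (cinner x (f n)))\<^sup>2) sums Re (cinner (blinfun_apply (opser c f f) x) x)"
    "(\<lambda>n. 0) sums Im (cinner (blinfun_apply (opser c f f) x) x)"
    by (auto simp: sums_complex_iff)
  then have "0 \<le> Re (cinner (blinfun_apply (opser c f f) x) x)" "Im (cinner (blinfun_apply (opser c f f) x) x) = 0"
    using sums_le[of "\<lambda>_. 0" "\<lambda>n. s n * (cmod (cinner x (f n)))\<^sup>2" 0] c0_star_nonneg[OF s] sums_zero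
    by (auto dest: sums_unique2)
  then show ?thesis by (simp add: complex_nonneg_Reals_iff)
qed

private lemma abs_square: "opser c f f o\<^sub>L opser c f f = adj (opser c f g) o\<^sub>L opser c f g"
proof -
  have "adj (opser c f g) = opser c g f"
    using adj_opser[OF f g sb] by simp
  moreover have "opser c g f o\<^sub>L opser c f g = opser (\<lambda>n. c n * c n) f f"
    by (rule opser_compose[OF f g f sb sb]) (simp add: g0)
  moreover have "opser c f f o\<^sub>L opser c f f = opser (\<lambda>n. c n * c n) f f"
    by (rule opser_compose[OF f f f sb sb]) (simp add: f0)
  ultimately show ?thesis by simp
qed

text \<open>Polarization: the quadratic form is real at \<open>x + y\<close> and at
  \<open>x + \<i> *\<^sub>C y\<close>, which gives the imaginary and the real part of the
  symmetry.\<close>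

lemma positive_op_adjoint:
  assumes "positive_op (B :: 'h \<Rightarrow>\<^sub>L 'h)"
  shows "cinner (blinfun_apply B x) y = cinner x (blinfun_apply B y)"
proof -
  have B: "B \<in> B_H" and im: "Im (cinner (blinfun_apply B z) z) = 0" for z
    using assms by (auto simp: positive_op_def complex_nonneg_Reals_iff)
  have "Im (cinner (blinfun_apply B x) y + cinner (blinfun_apply B y) x) = 0"
    using im[of "x + y"] im[of x] im[of y] by (simp add: blinfun.add_right cinner_linear)
  moreover have "Re (cinner (blinfun_apply B y) x - cinner (blinfun_apply B x) y) = 0"
    using im[of "x + \<i> *\<^sub>C y"] im[of x] im[of y]
    by (simp add: blinfun.add_right cinner_linear B_H_scaleC[OF B])
  ultimately have "cinner (blinfun_apply B x) y = cnj (cinner (blinfun_apply B y) x)"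
    by (simp add: complex_eq_iff)
  then show ?thesis by (simp add: cnj_cinner)
qed

text \<open>Off the kernel of the square, \<open>B\<^sup>2 - s\<^sup>2 = (B + s) (B - s)\<close> with \<open>B + s\<close> injective forces
  the eigenvalues of a positive square root \<open>B\<close>.\<close>

private lemma positive_root_unique:
  assumes B: "positive_op B" and sq: "B o\<^sub>L B = opser (\<lambda>n. c n * c n) f f"
  shows "B = opser c f f"
proof (rule blinfun_eqI)
  fix x
  have BH: "B \<in> B_H" and pos: "0 \<le> Re (cinner (blinfun_apply B z) z)" for z
    using B by (auto simp: positive_op_def complex_nonneg_Reals_iff)
  have sb2: "cmod (c n * c n) \<le> s 0 * s 0" for n
    unfolding norm_mult by (intro mult_mono sb) (auto simp: c0_star_nonneg[OF s])
  have Bf: "blinfun_apply B (f n) = c n *\<^sub>C f n" for n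
  proof (cases "s n = 0")
    case False
    then have sn: "s n > 0" using c0_star_nonneg[OF s, of n] by simp
    define w where "w = blinfun_apply B (f n) - c n *\<^sub>C f n"
    have "blinfun_apply B (blinfun_apply B (f n)) = (c n * c n) *\<^sub>C f n"
      using opser_apply_basis[OF f f, of "\<lambda>n. c n * c n" "s 0 * s 0" n, OF sb2] False f0 sq
      by (metis blinfun_apply_blinfun_compose)
    then have "blinfun_apply B w = - c n *\<^sub>C w"
      by (simp add: w_def blinfun.diff_right B_H_scaleC[OF BH] cvs.scale_right_diff_distrib scaleC_scaleC)
    then have "Re (cinner (blinfun_apply B w) w) = - (s n * (norm w)\<^sup>2)"
      by (simp add: cinner_linear cinner_self del: of_real_power)
    then have "w = 0" using pos[of w] sn by (simp add: mult_le_0_iff)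
    then show ?thesis by (simp add: w_def)
  qed (simp add: f0[THEN iffD2])
  \<comment> \<open>\<open>p\<close> is the projection of \<open>x\<close> to the closed span of
    \<open>f\<close>. On the remainder the square of \<open>B\<close> vanishes, hence
    \<open>B\<close> does, because \<open>B\<close> is symmetric.\<close>
  define p where "p = blinfun_apply (opser (\<lambda>_. 1) f f) x"
  have ps: "(\<lambda>n. (1 * cinner x (f n)) *\<^sub>C f n) sums p"
    unfolding p_def by (rule opser_sums[OF f f, where M=1]) simp
  have "cinner (x - p) (f n) = 0" for n
    using opser_cinner_basis[OF f f, of "\<lambda>_. 1" 1 x n] by (auto simp: p_def cinner_diff_left)
  then have "(\<lambda>n. 0) sums blinfun_apply (opser (\<lambda>n. c n * c n) f f) (x - p)"
    using opser_sums[OF f f, of "\<lambda>n. c n * c n" "s 0 * s 0" "x - p", OF sb2] by simp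
  then have "blinfun_apply B (blinfun_apply B (x - p)) = 0"
    using sq sums_unique2[OF _ sums_zero] by (metis blinfun_apply_blinfun_compose)
  then have "cinner (blinfun_apply B (x - p)) (blinfun_apply B (x - p)) = 0"
    by (simp add: positive_op_adjoint[OF B])
  then have "blinfun_apply B x = blinfun_apply B p" by (simp add: cinner_self blinfun.diff_right)
  moreover have "(\<lambda>n. blinfun_apply B ((1 * cinner x (f n)) *\<^sub>C f n)) sums blinfun_apply B p"
    by (rule bounded_linear.sums[OF blinfun.bounded_linear_right ps])
  then have "(\<lambda>n. (c n * cinner x (f n)) *\<^sub>C f n) sums blinfun_apply B p"
    by (simp add: B_H_scaleC[OF BH] Bf scaleC_scaleC mult.commute)
  then have "blinfun_apply B p = blinfun_apply (opser c f f) x"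
    using opser_sums[OF f f, of c "s 0" x, OF sb] by (rule sums_unique2)
  ultimately show "blinfun_apply B x = blinfun_apply (opser c f f) x" by simp
qed

lemma abs_op_opser: "abs_op (opser c f g) = opser c f f"
  unfolding abs_op_def
proof (rule the_equality)
  show "positive_op (opser c f f) \<and> opser c f f o\<^sub>L opser c f f = adj (opser c f g) o\<^sub>L opser c f g"
    using cinner_c_nonneg abs_square opser_in_B_H[OF f f sb] by (auto simp: positive_op_def)
  have "opser c f f o\<^sub>L opser c f f = opser (\<lambda>n. c n * c n) f f"
    by (rule opser_compose[OF f f f sb sb]) (simp add: f0)
  then show "B = opser c f f" if "positive_op B \<and> B o\<^sub>L B = adj (opser c f g) o\<^sub>L opser c f g" for B
    using that positive_root_unique by (simp add: abs_square)
qed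

text \<open>Pairing an eigenvector with \<open>f n\<close> kills every coefficient with
  \<open>s n \<noteq> t\<close>; as \<open>t > 0\<close>, only finitely many indices remain, so the
  span needs no closure.\<close>

private lemma eigenspace:
  assumes t: "t > 0"
  shows "{x. blinfun_apply (opser c f f) x = complex_of_real t *\<^sub>C x} = cvs.span (f ` {n. s n = t})"
proof (intro equalityI subsetI)
  fix x assume "x \<in> {x. blinfun_apply (opser c f f) x = complex_of_real t *\<^sub>C x}"
  then have x: "blinfun_apply (opser c f f) x = complex_of_real t *\<^sub>C x" by simp
  have fin: "finite {n. s n = t}"
    by (rule finite_subset[OF _ c0_star_finite_ge[OF s t]]) auto
  have z: "cinner x (f n) = 0" if "s n \<noteq> t" for n
  proof -
    have "of_real t * cinner x (f n) = (if f n = 0 then 0 else c n * cinner x (f n))"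
      using opser_cinner_basis[OF f f, of c "s 0" x n, OF sb] by (simp add: x cinner_scaleC_left)
    then show ?thesis using that by (cases "f n = 0") auto
  qed
  have "(\<lambda>n. (c n * cinner x (f n)) *\<^sub>C f n) =
      (\<lambda>n. if n \<in> {n. s n = t} then (c n * cinner x (f n)) *\<^sub>C f n else 0)"
    using z by auto
  then have "(\<lambda>n. if n \<in> {n. s n = t} then (c n * cinner x (f n)) *\<^sub>C f n else 0) sums (complex_of_real t *\<^sub>C x)"
    using opser_sums[OF f f, of c "s 0" x, OF sb] by (simp only: x)
  from sums_unique2[OF this sums_If_finite_set[OF fin]]
  have tx: "complex_of_real t *\<^sub>C x = (\<Sum>n\<in>{n. s n = t}. (c n * cinner x (f n)) *\<^sub>C f n)" .
  have "x = (1 / complex_of_real t) *\<^sub>C (complex_of_real t *\<^sub>C x)"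
    using t by (simp add: scaleC_scaleC scaleC_one)
  also have "\<dots> = (1 / complex_of_real t) *\<^sub>C (\<Sum>n\<in>{n. s n = t}. (c n * cinner x (f n)) *\<^sub>C f n)"
    unfolding tx ..
  also have "\<dots> \<in> cvs.span (f ` {n. s n = t})"
    by (intro cvs.span_scale cvs.span_sum cvs.span_base imageI) auto
  finally show "x \<in> cvs.span (f ` {n. s n = t})" .
next
  fix x assume "x \<in> cvs.span (f ` {n. s n = t})"
  then show "x \<in> {x. blinfun_apply (opser c f f) x = complex_of_real t *\<^sub>C x}"
  proof (induction rule: cvs.span_induct_alt)
    case (step k x y)
    from step(1) obtain n where n: "x = f n" "s n = t" by auto
    have "blinfun_apply (opser c f f) x = complex_of_real t *\<^sub>C x"
      using n t opser_apply_basis[OF f f, of c "s 0" n, OF sb] by (simp add: f0)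
    then show ?case using step(2)
      by (simp add: blinfun.add_right B_H_scaleC[OF opser_in_B_H[OF f f sb]] scaleC_scaleC scaleC_add_right mult.commute)
  qed (simp add: blinfun.zero_right)
qed

private lemma dim_eigenspace:
  assumes t: "t > 0"
  shows "cvs.dim {x. blinfun_apply (opser c f f) x = complex_of_real t *\<^sub>C x} = card {n. s n = t}"
proof -
  let ?N = "{n. s n = t}"
  have fin: "finite ?N" by (rule finite_subset[OF _ c0_star_finite_ge[OF s t]]) auto
  have nz: "f n \<noteq> 0" if "n \<in> ?N" for n using that t by (auto simp: f0)
  have inj: "inj_on f ?N"
  proof (rule inj_onI, rule ccontr)
    fix i j assume "i \<in> ?N" "j \<in> ?N" "f i = f j" "i \<noteq> j"
    then show False using suborthD0[OF f, of i j] nz[of j] by (simp add: cinner_self)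
  qed
  have "cvs.independent (f ` ?N)"
    unfolding cvs.independent_explicit_finite_subsets
  proof (intro allI impI ballI)
    fix S u v assume S: "S \<subseteq> f ` ?N" "finite S" "(\<Sum>v\<in>S. u v *\<^sub>C v) = 0" and v: "v \<in> S"
    have "cinner (\<Sum>v\<in>S. u v *\<^sub>C v) v = (\<Sum>w\<in>S. if w = v then u v else 0)"
      unfolding cinner_sum_left
    proof (intro sum.cong refl)
      fix w assume "w \<in> S"
      then obtain i j where "w = f i" "v = f j" "i \<in> ?N" "j \<in> ?N" using S v by blast
      then show "cinner (u w *\<^sub>C w) v = (if w = v then u v else 0)"
        using suborth_cinner[OF f, of i j] nz[of i] by (cases "i = j") (auto simp: cinner_scaleC_left cinner_self suborth_norm[OF f])
    qed
    also have "\<dots> = u v" using S v by simp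
    finally show "u v = 0" using S by simp
  qed
  then have "cvs.dim (cvs.span (f ` ?N)) = card (f ` ?N)" by (rule cvs.dim_span_eq_card_independent)
  then show ?thesis unfolding eigenspace[OF t] by (simp add: card_image[OF inj])
qed

lemma singular_numbers_opser: "singular_numbers (opser c f g) = s"
  unfolding singular_numbers_def abs_op_opser
proof (rule the_equality)
  show "s \<in> c0_star \<and> (\<forall>t>0. card {n. s n = t} =
      cvs.dim {x. blinfun_apply (opser c f f) x = complex_of_real t *\<^sub>C x})"
    using s dim_eigenspace by simp
  show "s' = s" if "s' \<in> c0_star \<and> (\<forall>t>0. card {n. s' n = t} =
      cvs.dim {x. blinfun_apply (opser c f f) x = complex_of_real t *\<^sub>C x})" for s'
    using that s dim_eigenspace by (intro c0_star_eq_iff_multiplicities) auto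
qed

end

section \<open>Diagonal operators and the trace class\<close>

context onb
begin

lemma diag_real_compact: "\<eta> \<longlonglongrightarrow> 0 \<Longrightarrow> diag_real e \<eta> \<in> compact_ops"
  unfolding diag_eq_opser
  by (intro opser_compact e_suborth) (metis of_real_0 tendsto_of_real)

lemma singular_numbers_diag:
  assumes s: "s \<in> c0_star" shows "singular_numbers (diag_real e s) = s"
proof -
  \<comment> \<open>The vectors are cancelled where \<open>s\<close> vanishes, to meet the
    normalization of the singular value decomposition.\<close>
  define f where "f n = (if s n = 0 then 0 else e n)" for n
  have f: "suborth f" using e_suborth by (auto simp: suborth_def f_def)
  have "(\<lambda>x. \<Sum>n. (complex_of_real (s n) * cinner x (e n)) *\<^sub>C e n) =
        (\<lambda>x. \<Sum>n. (complex_of_real (s n) * cinner x (f n)) *\<^sub>C f n)"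
    by (intro ext arg_cong[where f=suminf]) (auto simp: f_def)
  then have "diag_real e s = opser (\<lambda>n. complex_of_real (s n)) f f"
    by (simp add: diag_eq_opser opser_def)
  then show ?thesis using singular_numbers_opser[OF s f f] by (simp add: f_def)
qed

lemma singular_numbers_c0_star:
  "X \<in> compact_ops \<Longrightarrow> singular_numbers (X :: 'h \<Rightarrow>\<^sub>L 'h) \<in> c0_star"
  by (erule svd) (simp add: singular_numbers_opser)

lemma char_set_ideal_of_char_set:
  "char_set (ideal_of_char_set S :: ('h \<Rightarrow>\<^sub>L 'h) set) = S \<inter> c0_star"
proof (intro equalityI subsetI)
  fix s assume "s \<in> char_set (ideal_of_char_set S :: ('h \<Rightarrow>\<^sub>L 'h) set)"
  then show "s \<in> S \<inter> c0_star"
    using singular_numbers_c0_star by (auto simp: char_set_def ideal_of_char_set_def)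
next
  fix s assume s: "s \<in> S \<inter> c0_star"
  then have "diag_real e s \<in> ideal_of_char_set S"
    by (auto simp: ideal_of_char_set_def singular_numbers_diag intro!: diag_real_compact c0_star_lim)
  then show "s \<in> char_set (ideal_of_char_set S :: ('h \<Rightarrow>\<^sub>L 'h) set)"
    unfolding char_set_def using singular_numbers_diag s by (metis IntD2 imageI)
qed

text \<open>\<omega> need not be monotone, so it is not its own sequence of singular numbers. These
  are the products \<open>cinner (D (f n)) (g n)\<close> with \<open>D\<close> the diagonal
  operator, and Bessel's inequality for \<open>f\<close> and for \<open>g\<close> bounds their sum
  by that of \<omega>.\<close>

lemma diag_summable_trace_class:
  assumes nn: "\<And>n. 0 \<le> \<omega> n" and sm: "summable \<omega>"
  shows "diag_real e \<omega> \<in> trace_class"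
proof -
  have comp: "diag_real e \<omega> \<in> compact_ops" by (intro diag_real_compact summable_LIMSEQ_zero sm)
  obtain s f g where svd: "s \<in> c0_star" "suborth f" "suborth g" "\<And>n. f n = 0 \<longleftrightarrow> s n = 0"
    "\<And>n. g n = 0 \<longleftrightarrow> s n = 0" "diag_real e \<omega> = opser (\<lambda>n. complex_of_real (s n)) f g"
    by (rule svd[OF comp], rule that)
  have "bounded (range \<omega>)" using sm convergent_imp_bounded summable_LIMSEQ_zero by blast
  then obtain M where M: "\<And>n. cmod (complex_of_real (\<omega> n)) \<le> M" unfolding bounded_iff by auto
  \<comment> \<open>The product of the coordinates of \<open>f n\<close> and \<open>g n\<close> is
    bounded by the mean of their squares, which leaves two Bessel sums.\<close>
  let ?b = "\<lambda>n j. \<omega> j * ((cmod (cinner (e j) (f n)))\<^sup>2 / 2 + (cmod (cinner (e j) (g n)))\<^sup>2 / 2)"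
  have le: "\<omega> j * r \<le> \<omega> j" if "r \<le> 1" for j r using mult_left_le[OF that nn] .
  have b1: "(cmod (cinner (e j) (f n)))\<^sup>2 \<le> 1" "(cmod (cinner (e j) (g n)))\<^sup>2 \<le> 1" for j n
    using bessel_finite[OF svd(2), of "{n}" "e j"] bessel_finite[OF svd(3), of "{n}" "e j"] by auto
  have b2: "(cmod (cinner (e j) (f n)))\<^sup>2 / 2 + (cmod (cinner (e j) (g n)))\<^sup>2 / 2 \<le> 1" for j n
    using b1[of j n] by simp
  have bs: "summable (?b n)" for n
    by (rule summable_comparison_test'[OF sm, of 0]) (use nn le[OF b2] in auto)
  have sn: "s n \<le> (\<Sum>j. ?b n j)" for n
  proof -
    have "cinner (blinfun_apply (diag_real e \<omega>) (f n)) (g n) = of_real (s n)"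
      unfolding svd(6) using opser_apply_basis[OF svd(2,3), of "\<lambda>n. complex_of_real (s n)" "s 0" n, OF c0_star_cmod_le[OF svd(1)]] svd(4,5)[of n]
        suborth_cinner[OF svd(3), of n n] by (auto simp: cinner_scaleC_left)
    moreover have "(\<lambda>j. Re (of_real (\<omega> j) * cinner (f n) (e j) * cinner (e j) (g n))) sums
        Re (cinner (blinfun_apply (diag_real e \<omega>) (f n)) (g n))"
      unfolding diag_eq_opser
      by (intro bounded_linear.sums[OF bounded_linear_Re] opser_cinner_sums[OF e_suborth e_suborth M])
    ultimately have "(\<lambda>j. Re (of_real (\<omega> j) * cinner (f n) (e j) * cinner (e j) (g n))) sums s n" by simp
    moreover have "Re (of_real (\<omega> j) * cinner (f n) (e j) * cinner (e j) (g n)) \<le> ?b n j" for j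
    proof -
      have "Re (cinner (f n) (e j) * cinner (e j) (g n)) \<le> cmod (cinner (e j) (f n)) * cmod (cinner (e j) (g n))"
        using complex_Re_le_cmod[of "cinner (f n) (e j) * cinner (e j) (g n)"]
        by (metis cnj_cinner complex_mod_cnj norm_mult)
      also have "\<dots> \<le> (cmod (cinner (e j) (f n)))\<^sup>2 / 2 + (cmod (cinner (e j) (g n)))\<^sup>2 / 2"
        using sum_squares_bound[of "cmod (cinner (e j) (f n))" "cmod (cinner (e j) (g n))"] by simp
      finally have "\<omega> j * Re (cinner (f n) (e j) * cinner (e j) (g n)) \<le> ?b n j"
        by (intro mult_left_mono nn)
      then show ?thesis by (simp add: mult.assoc)
    qed
    ultimately show ?thesis by (rule sums_le[rotated, OF _ summable_sums[OF bs]])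
  qed
  have "summable s"
  proof (rule summableI_nonneg_bounded)
    fix N
    have "(\<Sum>n<N. s n) \<le> (\<Sum>n<N. \<Sum>j. ?b n j)" by (intro sum_mono sn)
    also have "\<dots> = (\<Sum>j. \<Sum>n<N. ?b n j)" by (intro suminf_sum[symmetric] bs)
    also have "\<dots> \<le> (\<Sum>j. \<omega> j)"
    proof (rule suminf_le[OF _ summable_sum sm])
      fix j
      have "(\<Sum>n<N. (cmod (cinner (e j) (f n)))\<^sup>2 / 2 + (cmod (cinner (e j) (g n)))\<^sup>2 / 2) \<le> 1"
        using bessel_finite[OF svd(2), of "{..<N}" "e j"] bessel_finite[OF svd(3), of "{..<N}" "e j"]
        by (simp add: sum.distrib flip: sum_divide_distrib)
      then show "(\<Sum>n<N. ?b n j) \<le> \<omega> j" using le by (simp flip: sum_distrib_left)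
    qed (rule bs)
    finally show "(\<Sum>n<N. s n) \<le> (\<Sum>j. \<omega> j)" .
  qed (rule c0_star_nonneg[OF svd(1)])
  moreover have "singular_numbers (diag_real e \<omega>) = s"
    unfolding svd(6) by (rule singular_numbers_opser[OF svd(1-5)])
  ultimately show ?thesis using comp by (simp add: trace_class_def)
qed

end

section \<open>Proper ideals and their characteristic sets\<close>

context
  fixes I :: "('h::complex_hilbert_space \<Rightarrow>\<^sub>L 'h) set"
  assumes I: "proper_ideal I"
begin

private lemma ideal_I: "ideal I B_H_ring" using I by (simp add: proper_ideal_def)

lemma proper_ideal_subset: "X \<in> I \<Longrightarrow> X \<in> B_H"
  using additive_subgroup.a_subset[OF ideal.axioms(1)[OF ideal_I]] by (auto simp: B_H_ring_def)

lemma proper_ideal_compose_left: "X \<in> I \<Longrightarrow> A \<in> B_H \<Longrightarrow> A o\<^sub>L X \<in> I"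
  using ideal.I_l_closed[OF ideal_I] by (simp add: B_H_ring_def)

lemma proper_ideal_compose_right: "X \<in> I \<Longrightarrow> A \<in> B_H \<Longrightarrow> X o\<^sub>L A \<in> I"
  using ideal.I_r_closed[OF ideal_I] by (simp add: B_H_ring_def)

lemma proper_ideal_add: "X \<in> I \<Longrightarrow> Y \<in> I \<Longrightarrow> X + Y \<in> I"
  using additive_subgroup.a_closed[OF ideal.axioms(1)[OF ideal_I]] by (simp add: B_H_ring_def)

lemma proper_ideal_id: "id_blinfun \<notin> I"
proof
  assume id: "id_blinfun \<in> I"
  have "A \<in> I" if "A \<in> B_H" for A
    proof -
    have "A o\<^sub>L id_blinfun = A" by (rule blinfun_eqI) simp
    then show ?thesis using proper_ideal_compose_left[OF id that] by simp
  qed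
  then have "I = B_H" using proper_ideal_subset by blast
  then show False using I by (simp add: proper_ideal_def)
qed

end

text \<open>One Gram-Schmidt step for each vector of \<open>S\<close>.\<close>

lemma finite_projection:
  fixes S :: "'h::complex_hilbert_space set"
  assumes "finite S"
  shows "\<exists>P\<in>compact_ops. (\<forall>y\<in>S. blinfun_apply P y = y) \<and> P o\<^sub>L P = P \<and>
      (\<forall>x y. cinner (blinfun_apply P x) y = cinner x (blinfun_apply P y))"
  using assms
proof (induction S)
  case empty
  show ?case by (intro bexI[of _ 0] compact_ops_zero) (simp add: blinfun_eqI)
next
  case (insert y S)
  then obtain P where P: "P \<in> compact_ops" "\<And>y. y \<in> S \<Longrightarrow> blinfun_apply P y = y"
    and PP: "\<And>x. blinfun_apply P (blinfun_apply P x) = blinfun_apply P x"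
    and sa: "\<And>x y. cinner (blinfun_apply P x) y = cinner x (blinfun_apply P y)"
    by (metis blinfun_apply_blinfun_compose)
  note PB = B_H_scaleC[OF compact_ops_B_H[OF P(1)]]
  define z where "z = y - blinfun_apply P y"
  \<comment> \<open>If \<open>P\<close> fixes \<open>y\<close> already, then \<open>z = 0\<close>
    and division by zero gives \<open>h = 0\<close>, so that \<open>Q = P\<close>.\<close>
  define h where "h = (1 / norm z) *\<^sub>R z"
  have Pz: "blinfun_apply P z = 0" by (simp add: z_def blinfun.diff_right PP)
  then have Ph: "blinfun_apply P h = 0" by (simp add: h_def blinfun.scaleR_right)
  have Pzh: "cinner (blinfun_apply P x) h = 0" for x by (simp add: sa Ph)
  have hh: "cinner h h *\<^sub>C h = h"
    by (cases "z = 0") (simp_all add: h_def cinner_self scaleC_one)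
  have "cinner y h = cinner z h" using Pzh[of y] by (simp add: z_def cinner_diff_left)
  also have "\<dots> = complex_of_real (norm z)"
    by (cases "z = 0") (simp_all add: h_def cinner_scaleR_right cinner_self power2_eq_square)
  finally have yh: "cinner y h *\<^sub>C h = z"
    by (cases "z = 0") (simp_all add: h_def flip: scaleR_scaleC)
  define Q where "Q = P + outer h h"
  have Q: "blinfun_apply Q x = blinfun_apply P x + cinner x h *\<^sub>C h" for x
    by (simp add: Q_def blinfun.add_left)
  show ?case
  proof (intro bexI[of _ Q] conjI ballI allI)
    show "Q \<in> compact_ops" unfolding Q_def by (intro compact_ops_add P compact_ops_outer)
    fix w assume "w \<in> insert y S"
    then show "blinfun_apply Q w = w"
    proof
      assume "w = y" then show ?thesis by (simp add: Q yh) (simp add: z_def)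
    next
      assume "w \<in> S" then show ?thesis using P(2) Pzh[of w] by (simp add: Q)
    qed
  next
    show "Q o\<^sub>L Q = Q"
      by (rule blinfun_eqI)
        (simp add: Q blinfun.add_right PP PB Ph Pzh cinner_add_left cinner_scaleC_left hh flip: scaleC_scaleC)
    show "cinner (blinfun_apply Q x) y = cinner x (blinfun_apply Q y)" for x y
      by (simp add: Q cinner_linear sa cnj_cinner)
  qed
qed

context onb
begin

lemma blinfun_eq_on_basis:
  fixes A B :: "'h \<Rightarrow>\<^sub>L 'h"
  assumes "A \<in> B_H" "B \<in> B_H" "\<And>n. blinfun_apply A (e n) = blinfun_apply B (e n)"
  shows "A = B"
proof (rule blinfun_eqI)
  fix x
  have "(\<lambda>n. blinfun_apply A (cinner x (e n) *\<^sub>C e n)) sums blinfun_apply A x"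
    "(\<lambda>n. blinfun_apply B (cinner x (e n) *\<^sub>C e n)) sums blinfun_apply B x"
    by (intro bounded_linear.sums[OF blinfun.bounded_linear_right] e_sums)+
  then show "blinfun_apply A x = blinfun_apply B x"
    unfolding B_H_scaleC[OF assms(1)] B_H_scaleC[OF assms(2)] assms(3) by (rule sums_unique2)
qed

text \<open>A noncompact operator is bounded below on an orthonormal sequence with orthogonal images;
  compressing it to this sequence yields an invertible diagonal operator.\<close>

lemma noncompact_ex_unit:
  fixes X :: "'h \<Rightarrow>\<^sub>L 'h"
  assumes X: "X \<in> B_H" "X \<notin> compact_ops"
  obtains r where "r > 0"
    "\<And>S. finite S \<Longrightarrow> \<exists>z. norm z = 1 \<and> r \<le> norm (blinfun_apply X z) \<and> (\<forall>y\<in>S. cinner z y = 0)"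
proof -
  obtain r where r: "r > 0" "\<And>K. K \<in> compact_ops \<Longrightarrow> r < norm (X - K)"
    using compact_ops_limit[OF X(1)] X(2) by (meson not_le)
  have "\<exists>z. norm z = 1 \<and> r \<le> norm (blinfun_apply X z) \<and> (\<forall>y\<in>S. cinner z y = 0)" if fin: "finite S" for S
  proof -
    obtain P where P: "P \<in> compact_ops" "\<And>y. y \<in> S \<Longrightarrow> blinfun_apply P y = y"
      and PP: "\<And>x. blinfun_apply P (blinfun_apply P x) = blinfun_apply P x"
      and sa: "\<And>x y. cinner (blinfun_apply P x) y = cinner x (blinfun_apply P y)"
      using finite_projection[OF fin] by (metis blinfun_apply_blinfun_compose)
    \<comment> \<open>Were \<open>X\<close> small off the range of \<open>P\<close>, the compact
      operator \<open>X o\<^sub>L P\<close> would approximate it.\<close>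
    have "r < norm (X - (X o\<^sub>L P))" by (intro r compact_ops_compose_left X P)
    then obtain x where x: "norm (blinfun_apply (X - (X o\<^sub>L P)) x) > r * norm x"
      using blinfun_norm_lower r(1) less_imp_le by metis
    define z where "z = x - blinfun_apply P x"
    have Xz: "norm (blinfun_apply X z) > r * norm x"
      using x by (simp add: z_def blinfun.diff_left blinfun.diff_right)
    have "cinner z (blinfun_apply P x) = 0" by (simp add: z_def cinner_diff_left sa PP)
    then have "(norm (z + blinfun_apply P x))\<^sup>2 = (norm z)\<^sup>2 + (norm (blinfun_apply P x))\<^sup>2"
      by (rule norm_add_orthogonal)
    then have "(norm z)\<^sup>2 \<le> (norm x)\<^sup>2" by (simp add: z_def)
    then have "norm z \<le> norm x" by (rule power2_le_imp_le) simp
    then have "r * norm z \<le> r * norm x" using r(1) by simp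
    with Xz have Xz: "norm (blinfun_apply X z) > r * norm z" by linarith
    then have z0: "z \<noteq> 0" by auto
    show ?thesis
    proof (intro exI conjI ballI)
      show "norm ((1 / norm z) *\<^sub>R z) = 1" using z0 by simp
      show "r \<le> norm (blinfun_apply X ((1 / norm z) *\<^sub>R z))"
        using Xz z0 by (simp add: blinfun.scaleR_right field_simps)
      fix y assume "y \<in> S"
      then show "cinner ((1 / norm z) *\<^sub>R z) y = 0"
        by (simp add: cinner_scaleR_left z_def cinner_diff_left sa P(2))
    qed
  qed
  with r(1) show ?thesis by (rule that)
qed

lemma proper_ideal_compact:
  fixes I :: "('h \<Rightarrow>\<^sub>L 'h) set"
  assumes I: "proper_ideal I" and XI: "X \<in> I"
  shows "X \<in> compact_ops"
proof (rule ccontr)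
  assume nc: "X \<notin> compact_ops"
  have X: "X \<in> B_H" by (rule proper_ideal_subset[OF I XI])
  obtain r where r: "r > 0"
    "\<And>S. finite S \<Longrightarrow> \<exists>z. norm z = 1 \<and> r \<le> norm (blinfun_apply X z) \<and> (\<forall>y\<in>S. cinner z y = 0)"
    using noncompact_ex_unit[OF X nc] by blast
  \<comment> \<open>Orthogonality to the second family makes the images orthogonal, since
    \<open>cinner (f n) (adj X (X (f i)))\<close> equals
    \<open>cinner (X (f n)) (X (f i))\<close>.\<close>
  define S where "S f n = f ` {..<n} \<union> (\<lambda>i. blinfun_apply (adj X) (blinfun_apply X (f i))) ` {..<n}"
    for f :: "nat \<Rightarrow> 'h" and n
  have "\<exists>f. \<forall>n. norm (f n) = 1 \<and> r \<le> norm (blinfun_apply X (f n)) \<and> (\<forall>y\<in>S f n. cinner (f n) y = 0)"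
  proof (rule dependent_wellorder_choice[where P="\<lambda>f n z. norm z = 1 \<and> r \<le> norm (blinfun_apply X z) \<and> (\<forall>y\<in>S f n. cinner z y = 0)"])
    fix z :: 'h and f g :: "nat \<Rightarrow> 'h" and n :: nat
    assume "\<And>m. m < n \<Longrightarrow> f m = g m"
    then have "S f n = S g n" by (auto simp: S_def image_iff)
    then show "(norm z = 1 \<and> r \<le> norm (blinfun_apply X z) \<and> (\<forall>y\<in>S f n. cinner z y = 0)) =
      (norm z = 1 \<and> r \<le> norm (blinfun_apply X z) \<and> (\<forall>y\<in>S g n. cinner z y = 0))" by simp
  next
    fix n :: nat and f :: "nat \<Rightarrow> 'h"
    show "\<exists>z. norm z = 1 \<and> r \<le> norm (blinfun_apply X z) \<and> (\<forall>y\<in>S f n. cinner z y = 0)"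
      by (rule r(2)) (simp add: S_def)
  qed
  then obtain f where f1: "\<And>n. norm (f n) = 1" and Xf: "\<And>n. r \<le> norm (blinfun_apply X (f n))"
    and orth: "\<And>n y. y \<in> S f n \<Longrightarrow> cinner (f n) y = 0" by blast
  define g where "g n = (1 / norm (blinfun_apply X (f n))) *\<^sub>R blinfun_apply X (f n)" for n
  have Xf0: "norm (blinfun_apply X (f n)) > 0" for n using Xf[of n] r(1) by linarith
  have f: "suborth f"
  proof (rule suborthI)
    fix i j :: nat assume "i < j"
    then have "cinner (f j) (f i) = 0" by (intro orth) (auto simp: S_def)
    then show "cinner (f i) (f j) = 0" by (simp add: cinner_eq_zero_commute)
  qed (simp add: f1)
  have g1: "norm (g n) = 1" for n using Xf0[of n] by (simp add: g_def)
  have g: "suborth g"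
  proof (rule suborthI)
    fix i j :: nat assume "i < j"
    then have "cinner (f j) (blinfun_apply (adj X) (blinfun_apply X (f i))) = 0" by (intro orth) (auto simp: S_def)
    then have "cinner (blinfun_apply X (f j)) (blinfun_apply X (f i)) = 0" by (simp add: cinner_adj_right[OF X])
    then show "cinner (g i) (g j) = 0"
      by (simp add: g_def cinner_scaleR_left cinner_scaleR_right cinner_eq_zero_commute)
  qed (simp add: g1)
  define a where "a n = complex_of_real (1 / norm (blinfun_apply X (f n)))" for n
  have a: "cmod (a n) \<le> 1 / r" for n
    using Xf[of n] r(1) Xf0[of n] by (simp add: a_def norm_divide divide_simps)
  have one: "cmod ((\<lambda>_. 1) n) \<le> (1::real)" for n :: nat by simp
  let ?W = "opser a g e" and ?V = "opser (\<lambda>_. 1) e f"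
  have W: "?W \<in> B_H" by (rule opser_in_B_H[OF g e_suborth a])
  have V: "?V \<in> B_H" by (rule opser_in_B_H[OF e_suborth f one])
  \<comment> \<open>\<open>?V\<close> sends the basis to \<open>f\<close>, and \<open>?W\<close>
    undoes the scaling of the images; the factors stay bounded because the images have norm at least
    \<open>r\<close>.\<close>
  have "?W o\<^sub>L (X o\<^sub>L ?V) = id_blinfun"
  proof (rule blinfun_eq_on_basis)
    fix n
    have "blinfun_apply ?V (e n) = f n"
      using opser_apply_basis[OF e_suborth f, of "\<lambda>_. 1" 1 n] by (simp add: scaleC_one)
    moreover have "blinfun_apply X (f n) = norm (blinfun_apply X (f n)) *\<^sub>R g n"
      using Xf0[of n] by (simp add: g_def)
    moreover have "g n \<noteq> 0" using g1[of n] by auto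
    moreover have "blinfun_apply ?W (g n) = a n *\<^sub>C e n"
      using opser_apply_basis[OF g e_suborth, of a "1 / r" n, OF a] \<open>g n \<noteq> 0\<close> by simp
    ultimately have "blinfun_apply (?W o\<^sub>L (X o\<^sub>L ?V)) (e n) = norm (blinfun_apply X (f n)) *\<^sub>R (a n *\<^sub>C e n)"
      by (metis blinfun.scaleR_right blinfun_apply_blinfun_compose)
    then show "blinfun_apply (?W o\<^sub>L (X o\<^sub>L ?V)) (e n) = blinfun_apply id_blinfun (e n)"
      using Xf0[of n] by (simp add: a_def scaleR_scaleC scaleC_scaleC scaleC_one)
  qed (intro B_H_compose B_H_id W V X)+
  moreover have "?W o\<^sub>L (X o\<^sub>L ?V) \<in> I"
    by (intro proper_ideal_compose_left[OF I] proper_ideal_compose_right[OF I] XI W V)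
  ultimately show False using proper_ideal_id[OF I] by simp
qed

section \<open>Membership of diagonal operators in a proper ideal\<close>

context
  fixes I :: "('h \<Rightarrow>\<^sub>L 'h) set"
  assumes I: "proper_ideal I"
begin

lemma char_set_iff: "\<eta> \<in> char_set I \<longleftrightarrow> \<eta> \<in> c0_star \<and> diag_real e \<eta> \<in> I"
proof
  assume "\<eta> \<in> c0_star \<and> diag_real e \<eta> \<in> I"
  then show "\<eta> \<in> char_set I" unfolding char_set_def using singular_numbers_diag by (metis imageI)
next
  assume "\<eta> \<in> char_set I"
  then obtain X where X: "X \<in> I" "\<eta> = singular_numbers X" by (auto simp: char_set_def)
  obtain s f g where svd: "s \<in> c0_star" "suborth f" "suborth g" "\<And>n. f n = 0 \<longleftrightarrow> s n = 0"
    "\<And>n. g n = 0 \<longleftrightarrow> s n = 0" "X = opser (\<lambda>n. complex_of_real (s n)) f g"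
    by (rule svd[OF proper_ideal_compact[OF I X(1)]], rule that)
  have \<eta>: "\<eta> = s" unfolding X(2) svd(6) by (rule singular_numbers_opser[OF svd(1-5)])
  note sb = c0_star_cmod_le[OF svd(1)]
  have one: "cmod ((\<lambda>_. 1) n) \<le> (1::real)" for n :: nat by simp
  let ?c = "\<lambda>n. complex_of_real (s n)"
  \<comment> \<open>Partial isometries carry the basis to \<open>f\<close>, and \<open>g\<close>
    back to the basis. Nothing is lost, since \<open>f n\<close> and \<open>g n\<close> vanish only
    together with \<open>s n\<close>.\<close>
  have "X o\<^sub>L opser (\<lambda>_. 1) e f = opser (\<lambda>n. ?c n * 1) e g"
    unfolding svd(6) by (rule opser_compose[OF e_suborth svd(2,3) sb one]) (simp add: svd(4))
  moreover have "opser (\<lambda>_. 1) g e o\<^sub>L opser ?c e g = opser (\<lambda>n. 1 * ?c n) e e"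
    by (rule opser_compose[OF e_suborth svd(3) e_suborth one sb]) (simp add: svd(5))
  ultimately have "diag_real e s = opser (\<lambda>_. 1) g e o\<^sub>L (X o\<^sub>L opser (\<lambda>_. 1) e f)"
    by (simp add: diag_eq_opser)
  also have "\<dots> \<in> I"
    by (intro proper_ideal_compose_left[OF I] proper_ideal_compose_right[OF I] X
        opser_in_B_H[where M=1] svd(2,3) e_suborth) auto
  finally show "\<eta> \<in> c0_star \<and> diag_real e \<eta> \<in> I" using svd(1) \<eta> by simp
qed

lemma diag_mult_in_ideal:
  assumes "diag_real e x \<in> I" "\<And>n. \<bar>x n\<bar> \<le> M" "\<And>n. \<bar>c n\<bar> \<le> K"
  shows "diag_real e (\<lambda>n. c n * x n) \<in> I"
proof -
  have "opser (\<lambda>n. complex_of_real (c n)) e e o\<^sub>L opser (\<lambda>n. complex_of_real (x n)) e e =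
    opser (\<lambda>n. complex_of_real (c n) * complex_of_real (x n)) e e"
    by (rule opser_compose[where M=K and M'=M]) (use assms e_suborth in auto)
  then have "diag_real e (\<lambda>n. c n * x n) = opser (\<lambda>n. complex_of_real (c n)) e e o\<^sub>L diag_real e x"
    by (simp add: diag_eq_opser)
  then show ?thesis
    using proper_ideal_compose_left[OF I assms(1) opser_in_B_H[OF e_suborth e_suborth, of _ K]] assms(3) by simp
qed

text \<open>Multiplication by the quotient \<open>x n / y n\<close>, which lies between 0 and 1;
  where \<open>y n = 0\<close> the quotient is 0 and so is \<open>x n\<close>.\<close>

lemma diag_solid:
  assumes "diag_real e y \<in> I" "\<And>n. y n \<le> M" "\<And>n. 0 \<le> x n" "\<And>n. x n \<le> y n"
  shows "diag_real e x \<in> I"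
proof -
  have y0: "0 \<le> y n" for n using assms(3,4)[of n] by linarith
  have "diag_real e (\<lambda>n. x n / y n * y n) \<in> I"
  proof (rule diag_mult_in_ideal[OF assms(1)])
    show "\<bar>y n\<bar> \<le> M" for n using y0 assms(2) by simp
    show "\<bar>x n / y n\<bar> \<le> 1" for n
      using assms(3,4)[of n] y0[of n] by (cases "y n = 0") (auto simp: divide_simps)
  qed
  moreover have "x n / y n * y n = x n" for n using assms(3,4)[of n] by (cases "y n = 0") auto
  ultimately show ?thesis by simp
qed

lemma diag_add_in_ideal:
  assumes "diag_real e x \<in> I" "diag_real e y \<in> I" "\<And>n. \<bar>x n\<bar> \<le> M" "\<And>n. \<bar>y n\<bar> \<le> K"
  shows "diag_real e (\<lambda>n. x n + y n) \<in> I"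
proof -
  have "diag_real e (\<lambda>n. x n + y n) = diag_real e x + diag_real e y"
  proof (rule blinfun_eqI)
    fix v
    have b: "cmod (complex_of_real (x n)) \<le> M" "cmod (complex_of_real (y n)) \<le> K"
      "cmod (complex_of_real (x n + y n)) \<le> M + K" for n
      using assms(3,4)[of n] abs_triangle_ineq[of "x n" "y n"] by (auto simp del: of_real_add)
    have "(\<lambda>n. (complex_of_real (x n) * cinner v (e n)) *\<^sub>C e n + (complex_of_real (y n) * cinner v (e n)) *\<^sub>C e n)
      sums (blinfun_apply (diag_real e x) v + blinfun_apply (diag_real e y) v)"
      unfolding diag_eq_opser
      by (rule sums_add; rule opser_sums[OF e_suborth e_suborth]; rule b)
    then have "(\<lambda>n. (complex_of_real (x n + y n) * cinner v (e n)) *\<^sub>C e n)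
      sums (blinfun_apply (diag_real e x) v + blinfun_apply (diag_real e y) v)"
      by (simp add: distrib_right scaleC_add_left)
    from sums_unique2[OF opser_sums[OF e_suborth e_suborth b(3)] this]
    show "blinfun_apply (diag_real e (\<lambda>n. x n + y n)) v = blinfun_apply (diag_real e x + diag_real e y) v"
      by (simp add: diag_eq_opser blinfun.add_left)
  qed
  then show ?thesis using proper_ideal_add[OF I assms(1,2)] by simp
qed

lemma char_set_solid:
  assumes "\<eta> \<in> char_set I" "\<zeta> \<in> c0_star" "\<And>n. \<zeta> n \<le> \<eta> n"
  shows "\<zeta> \<in> char_set I"
  using assms diag_solid[of \<eta> "\<eta> 0" \<zeta>] c0_star_antimono[of \<eta> 0] unfolding char_set_iff
  by (auto simp: c0_star_nonneg)

lemma char_set_scale: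
  assumes "\<eta> \<in> char_set I" "0 \<le> M"
  shows "(\<lambda>n. M * \<eta> n) \<in> char_set I"
proof -
  have \<eta>: "\<eta> \<in> c0_star" "diag_real e \<eta> \<in> I" using assms(1) by (auto simp: char_set_iff)
  have "diag_real e (\<lambda>n. M * \<eta> n) \<in> I"
    by (rule diag_mult_in_ideal[OF \<eta>(2), of "\<eta> 0" _ "\<bar>M\<bar>"]) (use c0_star_cmod_le[OF \<eta>(1)] in auto)
  moreover have "(\<lambda>n. M * \<eta> n) \<in> c0_star"
    using \<eta>(1) assms(2) tendsto_mult_left[of \<eta> 0 sequentially M]
    by (auto simp: c0_star_def decseq_def mult_left_mono)
  ultimately show ?thesis by (simp add: char_set_iff)
qed

text \<open>The sum of \<zeta> and \<omega> need not be monotone, so the argument runs through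
  diagonal operators in \<open>I\<close> rather than through characteristic sequences.\<close>

lemma char_set_summable_dominated:
  assumes "trace_class \<subseteq> I" "\<zeta> \<in> char_set I" "summable \<omega>" "\<And>n. 0 \<le> \<omega> n"
    and "\<xi> \<in> c0_star" "\<And>n. \<xi> n \<le> \<zeta> n + \<omega> n"
  shows "\<xi> \<in> char_set I"
proof -
  have \<zeta>: "\<zeta> \<in> c0_star" "diag_real e \<zeta> \<in> I" using assms(2) by (auto simp: char_set_iff)
  have \<omega>: "diag_real e \<omega> \<in> I" using diag_summable_trace_class[OF assms(4,3)] assms(1) by blast
  have \<omega>M: "\<omega> n \<le> suminf \<omega>" for n
    using sum_le_suminf[OF assms(3), of "{n}"] assms(4) by simp
  have "diag_real e (\<lambda>n. \<zeta> n + \<omega> n) \<in> I"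
    by (rule diag_add_in_ideal[OF \<zeta>(2) \<omega>, of "\<zeta> 0" "suminf \<omega>"])
      (use \<omega>M assms(4) c0_star_cmod_le[OF \<zeta>(1)] in auto)
  then have "diag_real e \<xi> \<in> I"
  proof (rule diag_solid[where M="\<zeta> 0 + suminf \<omega>"])
    show "\<zeta> n + \<omega> n \<le> \<zeta> 0 + suminf \<omega>" for n using \<omega>M[of n] c0_star_antimono[OF \<zeta>(1), of 0 n] by simp
  qed (use assms c0_star_nonneg in auto)
  then show ?thesis using assms(5) by (simp add: char_set_iff)
qed

text \<open>An ideal with a nonzero element contains the rank-one projections onto the basis
  vectors, hence every finite diagonal.\<close>

lemma char_set_finite_support:
  assumes \<eta>: "\<eta> \<in> char_set I" "\<eta> 0 > 0" and \<xi>: "\<xi> \<in> c0_star" "\<And>n. n \<ge> N \<Longrightarrow> \<xi> n = 0"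
  shows "\<xi> \<in> char_set I"
proof -
  have \<eta>': "\<eta> \<in> c0_star" "diag_real e \<eta> \<in> I" using \<eta>(1) by (auto simp: char_set_iff)
  have one: "outer (e i) (e i) \<in> I" for i
  proof -
    have D: "blinfun_apply (diag_real e \<eta>) (e 0) = complex_of_real (\<eta> 0) *\<^sub>C e 0"
      unfolding diag_eq_opser using opser_apply_basis[OF e_suborth e_suborth, of "\<lambda>n. complex_of_real (\<eta> n)" "\<eta> 0" 0, OF c0_star_cmod_le[OF \<eta>'(1)]] by simp
    \<comment> \<open>The nonzero entry \<open>\<eta> 0\<close> is moved to place \<open>i\<close>
      and normalized.\<close>
    have "outer (e i) (e i) = outer (complex_of_real (1 / \<eta> 0) *\<^sub>C e i) (e 0) o\<^sub>L (diag_real e \<eta> o\<^sub>L outer (e 0) (e i))"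
      by (rule blinfun_eqI)
        (use \<eta>(2) D B_H_scaleC[OF proper_ideal_subset[OF I \<eta>'(2)]] in \<open>simp add: cinner_scaleC_left e_cinner scaleC_scaleC\<close>)
    then show ?thesis
      by (metis proper_ideal_compose_left[OF I] proper_ideal_compose_right[OF I] \<eta>'(2) outer_in_B_H)
  qed
  have "diag_real e (\<lambda>n. if n < M then \<xi> n else 0) \<in> I" for M
  proof (induction M)
    case 0
    have "diag_real e (\<lambda>n. 0 * \<eta> n) \<in> I"
      by (rule diag_mult_in_ideal[OF \<eta>'(2), of "\<eta> 0" _ 0]) (use c0_star_cmod_le[OF \<eta>'(1)] in auto)
    then show ?case by simp
  next
    case (Suc M)
    have b: "cmod (complex_of_real (if n = M then \<xi> M else 0)) \<le> \<bar>\<xi> M\<bar>" for n by simp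
    have "diag_real e (\<lambda>n. if n = M then \<xi> M else 0) = outer (complex_of_real (\<xi> M) *\<^sub>C e M) (e M) o\<^sub>L outer (e M) (e M)"
    proof (rule blinfun_eq_on_basis)
      show "diag_real e (\<lambda>n. if n = M then \<xi> M else 0) \<in> B_H"
        unfolding diag_eq_opser by (rule opser_in_B_H[OF e_suborth e_suborth b])
      fix n
      show "blinfun_apply (diag_real e (\<lambda>n. if n = M then \<xi> M else 0)) (e n) =
        blinfun_apply (outer (complex_of_real (\<xi> M) *\<^sub>C e M) (e M) o\<^sub>L outer (e M) (e M)) (e n)"
        unfolding diag_eq_opser
        using opser_apply_basis[OF e_suborth e_suborth, of "\<lambda>n. complex_of_real (if n = M then \<xi> M else 0)" "\<bar>\<xi> M\<bar>" n, OF b]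
        by (simp add: e_cinner scaleC_one)
    qed (intro B_H_compose outer_in_B_H)
    then have "diag_real e (\<lambda>n. if n = M then \<xi> M else 0) \<in> I"
      using proper_ideal_compose_left[OF I one outer_in_B_H] by simp
    with Suc have "diag_real e (\<lambda>n. (if n < M then \<xi> n else 0) + (if n = M then \<xi> M else 0)) \<in> I"
      by (rule diag_add_in_ideal[where M="\<xi> 0" and K="\<xi> 0"])
        (use c0_star_cmod_le[OF \<xi>(1)] c0_star_nonneg[OF \<xi>(1)] in auto)
    moreover have "(if n < M then \<xi> n else 0) + (if n = M then \<xi> M else 0) = (if n < Suc M then \<xi> n else 0)" for n
      by auto
    ultimately show ?case by (simp only:)
  qed
  then have "diag_real e (\<lambda>n. if n < N then \<xi> n else 0) \<in> I" .
  moreover have "(if n < N then \<xi> n else 0) = \<xi> n" for n using \<xi>(2) by auto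
  ultimately have "diag_real e \<xi> \<in> I" by (simp only:)
  then show ?thesis using \<xi>(1) by (simp add: char_set_iff)
qed

end

end

section \<open>Majorization\<close>

lemma weighted_sum_summable:
  assumes "decseq \<eta>" "\<And>n. 0 \<le> (\<eta> n :: real)" "\<And>j. 0 \<le> (c j :: real)" "summable c"
  shows "summable (\<lambda>j. c j * \<eta> j)"
proof (rule summable_comparison_test'[OF summable_mult2[OF assms(4), of "\<eta> 0"], of 0])
  fix j
  have "\<eta> j \<le> \<eta> 0" using assms(1) by (simp add: decseq_def)
  then show "norm (c j * \<eta> j) \<le> c j * \<eta> 0" using assms(2,3) by (simp add: mult_left_mono)
qed

text \<open>In the applications \<open>c j\<close> is the sum of the first \<open>n\<close> entries
  of column \<open>j\<close>. The weight from \<open>n\<close> on is at most the weight missing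
  before \<open>n\<close>, and it meets values of at most \<open>\<eta> n\<close>.\<close>

lemma weighted_sum_gap_all:
  fixes \<eta> c :: "nat \<Rightarrow> real"
  assumes \<eta>: "decseq \<eta>" "\<And>n. 0 \<le> \<eta> n" and c: "\<And>j. 0 \<le> c j" "summable c" "suminf c \<le> real n"
  shows "(\<Sum>j<n. (1 - c j) * (\<eta> j - \<eta> n)) \<le> (\<Sum>j<n. \<eta> j) - (\<Sum>j. c j * \<eta> j)"
proof -
  have s: "summable (\<lambda>j. c j * \<eta> j)" by (rule weighted_sum_summable[OF \<eta> c(1,2)])
  have "(\<Sum>j. c (j + n) * \<eta> (j + n)) \<le> (\<Sum>j. c (j + n) * \<eta> n)"
  proof (rule suminf_le)
    show "c (j + n) * \<eta> (j + n) \<le> c (j + n) * \<eta> n" for j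
      using \<eta>(1) c(1) by (intro mult_left_mono) (auto simp: decseq_def)
    show "summable (\<lambda>j. c (j + n) * \<eta> (j + n))" using s by (rule summable_ignore_initial_segment)
    show "summable (\<lambda>j. c (j + n) * \<eta> n)" by (intro summable_mult2 summable_ignore_initial_segment c)
  qed
  also have "\<dots> = (\<Sum>j. c (j + n)) * \<eta> n"
    by (intro suminf_mult2[symmetric] summable_ignore_initial_segment c)
  also have "\<dots> \<le> (\<Sum>j<n. 1 - c j) * \<eta> n"
    using suminf_split_initial_segment[OF c(2), of n] c(3) \<eta>(2)
    by (intro mult_right_mono) (auto simp: sum_subtractf)
  also have "\<dots> = (\<Sum>j<n. (1 - c j) * \<eta> n)" by (rule sum_distrib_right)
  finally have "(\<Sum>j. c j * \<eta> j) \<le> (\<Sum>j<n. (1 - c j) * \<eta> n) + (\<Sum>j<n. c j * \<eta> j)"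
    using suminf_split_initial_segment[OF s, of n] by simp
  also have "\<dots> = (\<Sum>j<n. \<eta> j) - (\<Sum>j<n. (1 - c j) * (\<eta> j - \<eta> n))"
    by (simp add: sum.distrib[symmetric] sum_subtractf[symmetric] algebra_simps)
  finally show ?thesis by simp
qed

text \<open>A single defective weight \<open>c k < 1\<close> already forces a gap; this detects
  columns that lose mass.\<close>

lemma weighted_sum_gap:
  fixes \<eta> c :: "nat \<Rightarrow> real"
  assumes \<eta>: "decseq \<eta>" "\<And>n. 0 \<le> \<eta> n" and c: "\<And>j. 0 \<le> c j" "\<And>j. c j \<le> 1" "summable c" "suminf c \<le> real n"
    and k: "k < n"
  shows "(1 - c k) * (\<eta> k - \<eta> n) \<le> (\<Sum>j<n. \<eta> j) - (\<Sum>j. c j * \<eta> j)"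
proof -
  have nn: "0 \<le> (1 - c j) * (\<eta> j - \<eta> n)" if "j < n" for j
    using that c(2)[of j] \<eta>(1) by (intro mult_nonneg_nonneg) (auto simp: decseq_def)
  have "(1 - c k) * (\<eta> k - \<eta> n) \<le> (\<Sum>j<n. (1 - c j) * (\<eta> j - \<eta> n))"
    using nn k by (intro member_le_sum) auto
  then show ?thesis using weighted_sum_gap_all[OF \<eta> c(1,3,4)] by linarith
qed

lemma weighted_sum_le:
  fixes \<eta> c :: "nat \<Rightarrow> real"
  assumes \<eta>: "decseq \<eta>" "\<And>n. 0 \<le> \<eta> n" and c: "\<And>j. 0 \<le> c j" "\<And>j. c j \<le> 1" "summable c" "suminf c \<le> real n"
  shows "(\<Sum>j. c j * \<eta> j) \<le> (\<Sum>j<n. \<eta> j)"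
proof -
  have "0 \<le> (\<Sum>j<n. (1 - c j) * (\<eta> j - \<eta> n))"
    using c(2) \<eta>(1) by (intro sum_nonneg mult_nonneg_nonneg) (auto simp: decseq_def)
  then show ?thesis using weighted_sum_gap_all[OF \<eta> c(1,3,4)] by linarith
qed

section \<open>Small gaps of partial sums and minimal majorants\<close>

lemma liminf_eq_0_iff:
  fixes g :: "nat \<Rightarrow> real"
  assumes "\<And>n. 0 \<le> g n"
  shows "liminf (\<lambda>n. ereal (g n)) = 0 \<longleftrightarrow> (\<forall>\<delta>>0. \<forall>N. \<exists>n\<ge>N. g n < \<delta>)"
proof
  assume L: "liminf (\<lambda>n. ereal (g n)) = 0"
  show "\<forall>\<delta>>0. \<forall>N. \<exists>n\<ge>N. g n < \<delta>"
  proof (rule ccontr)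
    assume "\<not> (\<forall>\<delta>>0. \<forall>N. \<exists>n\<ge>N. g n < \<delta>)"
    then obtain \<delta> N where \<delta>: "\<delta> > 0" "\<And>n. n \<ge> N \<Longrightarrow> \<delta> \<le> g n" by (auto simp: not_less)
    then have "ereal \<delta> \<le> liminf (\<lambda>n. ereal (g n))"
      by (intro Liminf_bounded) (auto simp: eventually_sequentially)
    with L \<delta>(1) show False by simp
  qed
next
  assume R: "\<forall>\<delta>>0. \<forall>N. \<exists>n\<ge>N. g n < \<delta>"
  have "0 \<le> liminf (\<lambda>n. ereal (g n))" using assms by (intro Liminf_bounded) auto
  moreover have "\<not> 0 < liminf (\<lambda>n. ereal (g n))"
  proof
    assume "0 < liminf (\<lambda>n. ereal (g n))"
    then obtain r where r: "0 < ereal r" "ereal r < liminf (\<lambda>n. ereal (g n))" using ereal_dense2 by blast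
    then obtain N where "\<And>n. n \<ge> N \<Longrightarrow> r < g n"
      using less_LiminfD[OF r(2)] by (auto simp: eventually_sequentially)
    moreover obtain n where "n \<ge> N" "g n < r" using R r(1) by auto
    ultimately show False by (meson less_asym)
  qed
  ultimately show "liminf (\<lambda>n. ereal (g n)) = 0" by simp
qed

lemma strongly_majorized_iff:
  fixes \<xi> \<eta> :: "nat \<Rightarrow> real"
  shows "\<xi> \<preceq> \<eta> \<longleftrightarrow> \<xi> \<prec> \<eta> \<and> (\<forall>\<delta>>0. \<forall>N. \<exists>n\<ge>N. (\<Sum>j<n. \<eta> j) - (\<Sum>j<n. \<xi> j) < \<delta>)"
proof (cases "\<xi> \<prec> \<eta>")
  case True
  then show ?thesis using liminf_eq_0_iff[of "\<lambda>n. \<Sum>j<n. \<eta> j - \<xi> j"]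
    by (simp add: strongly_majorized_def majorized_def sum_subtractf)
qed (simp add: strongly_majorized_def)

text \<open>Without a drop from \<open>p\<close> on, the sequence would stay at least
  \<open>\<zeta> p\<close> and could not tend to 0.\<close>

lemma c0_star_pos_drop:
  assumes "\<zeta> \<in> c0_star" "\<zeta> p > 0"
  shows "\<exists>q\<ge>p. \<zeta> (Suc q) < \<zeta> q"
proof (rule ccontr)
  assume "\<not> (\<exists>q\<ge>p. \<zeta> (Suc q) < \<zeta> q)"
  then have step: "\<zeta> q \<le> \<zeta> (Suc q)" if "q \<ge> p" for q using that by (simp add: not_less)
  have "\<zeta> p \<le> \<zeta> n" if "n \<ge> p" for n
    using that by (induction n rule: dec_induct) (auto intro: order_trans step)
  then have "\<zeta> p \<le> 0" by (intro LIMSEQ_le_const[OF c0_star_lim[OF assms(1)]]) auto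
  with assms(2) show False by simp
qed

text \<open>A pointwise minimal \<open>\<zeta>\<close> with \<open>\<xi> \<prec> \<zeta> \<le> \<eta>\<close> works: if the gaps of its partial sums
  stayed above some \<open>\<delta> > 0\<close>, one entry followed by a drop could be lowered.\<close>

lemma ex_strongly_majorized_below:
  fixes \<xi> \<eta> :: "nat \<Rightarrow> real"
  assumes \<xi>: "\<xi> \<in> c0_star" and \<eta>: "\<eta> \<in> c0_star" and maj: "\<xi> \<prec> \<eta>"
  shows "\<exists>\<zeta>\<in>c0_star. (\<forall>n. \<zeta> n \<le> \<eta> n) \<and> \<xi> \<preceq> \<zeta>"
proof -
  define A where "A = {\<zeta> \<in> c0_star. (\<forall>n. \<zeta> n \<le> \<eta> n) \<and> \<xi> \<prec> \<zeta>}"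
  \<comment> \<open>Reversed order, so that the maximal element given by Zorn's lemma is pointwise
    minimal.\<close>
  define P :: "(nat \<Rightarrow> real) \<Rightarrow> (nat \<Rightarrow> real) \<Rightarrow> bool" where "P x y \<longleftrightarrow> (\<forall>n. y n \<le> x n)" for x y
  have po: "partial_order_on A (relation_of P A)"
    by (rule partial_order_on_relation_ofI) (auto simp: P_def fun_eq_iff intro: order_trans order_antisym)
  have ch: "\<exists>u\<in>A. \<forall>a\<in>C. P a u" if C: "C \<in> Chains (relation_of P A)" for C
  proof (cases "C = {}")
    case True
    then show ?thesis using \<eta> maj by (intro bexI[of _ \<eta>]) (auto simp: A_def)
  next
    case False
    have CA: "\<And>a. a \<in> C \<Longrightarrow> a \<in> A" and tot: "\<And>a b. a \<in> C \<Longrightarrow> b \<in> C \<Longrightarrow> P a b \<or> P b a"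
      using C by (auto simp: Chains_def relation_of_def)
    have Cc: "\<And>a. a \<in> C \<Longrightarrow> a \<in> c0_star" using CA by (auto simp: A_def)
    define u where "u n = (INF a\<in>C. a n)" for n
    have bd: "bdd_below ((\<lambda>a. a n) ` C)" for n
      using c0_star_nonneg[OF Cc] by (intro bdd_belowI[where m=0]) auto
    have u_le: "u n \<le> a n" if "a \<in> C" for a n unfolding u_def by (rule cINF_lower[OF bd that])
    have u_ge: "r \<le> u n" if "\<And>a. a \<in> C \<Longrightarrow> r \<le> a n" for r n
      unfolding u_def using False that by (intro cINF_greatest)
    have u0: "0 \<le> u n" for n using u_ge c0_star_nonneg[OF Cc] by blast
    have "decseq u"
    proof (rule decseq_SucI, rule u_ge)
      fix n a assume a: "a \<in> C"
      show "u (Suc n) \<le> a n" using u_le[OF a, of "Suc n"] c0_star_antimono[OF Cc[OF a], of n "Suc n"] by simp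
    qed
    moreover have u\<eta>: "u n \<le> \<eta> n" for n
      using False u_le[of _ n] CA by (force simp: A_def intro: order_trans)
    have "u \<longlonglongrightarrow> 0"
      by (rule tendsto_sandwich[OF _ _ tendsto_const c0_star_lim[OF \<eta>]]) (use u0 u\<eta> in auto)
    ultimately have "u \<in> c0_star" using u0 by (simp add: c0_star_def)
    \<comment> \<open>One member of the chain is close to the infimum at finitely many indices at
      once: the smaller of two comparable members serves for both.\<close>
    moreover have approx: "\<exists>a\<in>C. \<forall>j<n. a j \<le> u j + \<delta>" if "\<delta> > 0" for \<delta> n
    proof (induction n)
      case 0 then show ?case using False by auto
    next
      case (Suc n)
      then obtain a where a: "a \<in> C" "\<And>j. j < n \<Longrightarrow> a j \<le> u j + \<delta>" by blast
      have "\<exists>b\<in>C. b n < u n + \<delta>"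
        using u_ge[of "u n + \<delta>" n] \<open>\<delta> > 0\<close> by (meson add_le_same_cancel1 not_le)
      then obtain b where b: "b \<in> C" "b n < u n + \<delta>" by blast
      from tot[OF a(1) b(1)] show ?case
      proof
        assume "P a b"
        then have "\<forall>j<Suc n. b j \<le> u j + \<delta>"
          using a(2) b(2) unfolding P_def by (metis less_Suc_eq less_imp_le order_trans)
        then show ?thesis using b(1) by (rule bexI)
      next
        assume "P b a"
        then have "\<forall>j<Suc n. a j \<le> u j + \<delta>"
          using a(2) b(2) unfolding P_def by (metis less_Suc_eq less_imp_le order_trans)
        then show ?thesis using a(1) by (rule bexI)
      qed
    qed
    have "\<xi> \<prec> u" unfolding majorized_def
    proof (rule allI, rule field_le_epsilon)
      fix n and r :: real assume r: "r > 0"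
      obtain a where a: "a \<in> C" "\<And>j. j < n \<Longrightarrow> a j \<le> u j + r / real (Suc n)"
        using approx[of "r / real (Suc n)" n] r by auto
      have "(\<Sum>j<n. \<xi> j) \<le> (\<Sum>j<n. a j)" using CA[OF a(1)] by (simp add: A_def majorized_def)
      also have "\<dots> \<le> (\<Sum>j<n. u j + r / real (Suc n))" using a(2) by (intro sum_mono) auto
      also have "\<dots> = (\<Sum>j<n. u j) + real n * r / real (Suc n)" by (simp add: sum.distrib)
      also have "\<dots> \<le> (\<Sum>j<n. u j) + r" using r by (simp add: field_simps)
      finally show "(\<Sum>j<n. \<xi> j) \<le> (\<Sum>j<n. u j) + r" .
    qed
    ultimately have "u \<in> A" using u\<eta> by (simp add: A_def)
    then show ?thesis using u_le by (auto simp: P_def)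
  qed
  obtain \<zeta> where \<zeta>: "\<zeta> \<in> A" and min: "\<And>a. a \<in> A \<Longrightarrow> P \<zeta> a \<Longrightarrow> a = \<zeta>"
    using predicate_Zorn[OF po ch] by blast
  have \<zeta>': "\<zeta> \<in> c0_star" "\<And>n. \<zeta> n \<le> \<eta> n" "\<xi> \<prec> \<zeta>" using \<zeta> by (auto simp: A_def)
  define gap where "gap n = (\<Sum>j<n. \<zeta> j) - (\<Sum>j<n. \<xi> j)" for n
  have "\<exists>n\<ge>N. gap n < \<delta>" if \<delta>: "\<delta> > 0" for \<delta> N
  proof (rule ccontr)
    assume "\<not> (\<exists>n\<ge>N. gap n < \<delta>)"
    then have big: "\<And>n. n \<ge> N \<Longrightarrow> \<delta> \<le> gap n" by (auto simp: not_less)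
    \<comment> \<open>If \<zeta> has finite support, \<open>p\<close> is its last positive index;
      after it the gap can only decrease, so the bound \<delta> for late gaps holds from there
      on.\<close>
    have "\<exists>p. \<zeta> p > 0 \<and> (\<forall>n>p. \<delta> \<le> gap n)"
    proof (cases "\<exists>p\<ge>N. \<zeta> p > 0")
      case True
      then obtain p where "p \<ge> N" "\<zeta> p > 0" by blast
      then show ?thesis using big by (meson less_imp_le order_trans)
    next
      case False
      then have z: "\<zeta> n = 0" if "n \<ge> N" for n using that c0_star_nonneg[OF \<zeta>'(1), of n] by force
      have "\<exists>p<N. \<zeta> p > 0"
      proof (rule ccontr)
        assume "\<not> ?thesis"
        then have "(\<Sum>j<N. \<zeta> j) \<le> 0" by (intro sum_nonpos) auto
        moreover have "0 \<le> (\<Sum>j<N. \<xi> j)" by (intro sum_nonneg c0_star_nonneg \<xi>)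
        ultimately show False using big[of N] \<delta> by (simp add: gap_def)
      qed
      then have ne: "{p. p < N \<and> \<zeta> p > 0} \<noteq> {}" and fin: "finite {p. p < N \<and> \<zeta> p > 0}" by auto
      define p where "p = Max {p. p < N \<and> \<zeta> p > 0}"
      have p: "p < N" "\<zeta> p > 0" using Max_in[OF fin ne] by (auto simp: p_def)
      have z': "\<zeta> n = 0" if "n > p" for n
        using z[of n] Max_ge[OF fin, of n] that c0_star_nonneg[OF \<zeta>'(1), of n] unfolding p_def[symmetric]
        by (cases "n \<ge> N") force+
      have anti: "gap m \<le> gap n" if "n > p" "m \<ge> n" for m n
        using that(2) that(1)
      proof (induction m rule: dec_induct)
        case (step m)
        have "gap (Suc m) = gap m - \<xi> m" using z'[of m] step by (simp add: gap_def)
        then show ?case using step c0_star_nonneg[OF \<xi>, of m] by simp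
      qed simp
      have "\<delta> \<le> gap n" if "n > p" for n
        using anti[OF that, of "max n N"] big[of "max n N"] by simp
      with p(2) show ?thesis by blast
    qed
    then obtain p where p: "\<zeta> p > 0" "\<And>n. n > p \<Longrightarrow> \<delta> \<le> gap n" by blast
    obtain q where q: "q \<ge> p" "\<zeta> (Suc q) < \<zeta> q" using c0_star_pos_drop[OF \<zeta>'(1) p(1)] by blast
    \<comment> \<open>The entry before a drop is lowered by at most \<delta> and not below its
      successor, so monotonicity and the majorization of \<xi> survive.\<close>
    define a where "a = \<zeta>(q := max (\<zeta> (Suc q)) (\<zeta> q - \<delta>))"
    have a_le: "a n \<le> \<zeta> n" for n using q(2) \<delta> by (simp add: a_def)
    have "a n \<ge> a (Suc n)" for n
      using c0_star_antimono[OF \<zeta>'(1), of n "Suc n"] q(2) \<delta> by (auto simp: a_def)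
    then have "decseq a" by (rule decseq_SucI)
    moreover have a0: "0 \<le> a n" for n
      using c0_star_nonneg[OF \<zeta>'(1), of n] c0_star_nonneg[OF \<zeta>'(1), of "Suc q"] by (simp add: a_def max.coboundedI1)
    moreover have "a \<longlonglongrightarrow> 0"
      by (rule tendsto_sandwich[OF _ _ tendsto_const c0_star_lim[OF \<zeta>'(1)]]) (use a0 a_le in auto)
    ultimately have "a \<in> c0_star" by (simp add: c0_star_def)
    moreover have "\<xi> \<prec> a" unfolding majorized_def
    proof
      fix n
      show "(\<Sum>j<n. \<xi> j) \<le> (\<Sum>j<n. a j)"
      proof (cases "n \<le> q")
        case True
        then have "(\<Sum>j<n. a j) = (\<Sum>j<n. \<zeta> j)" by (intro sum.cong) (auto simp: a_def)
        then show ?thesis using \<zeta>'(3) by (simp add: majorized_def)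
      next
        case False
        then have "\<delta> \<le> gap n" using p(2) q(1) by simp
        moreover have "(\<Sum>j<n. \<zeta> j) - (\<Sum>j<n. a j) = (\<Sum>j<n. if j = q then \<zeta> q - a q else 0)"
          unfolding sum_subtractf[symmetric] by (intro sum.cong) (auto simp: a_def)
        then have "(\<Sum>j<n. \<zeta> j) - (\<Sum>j<n. a j) \<le> \<delta>" using False by (simp add: a_def)
        ultimately show ?thesis by (simp add: gap_def)
      qed
    qed
    ultimately have "a \<in> A" using a_le \<zeta>'(2) order_trans unfolding A_def by blast
    then have "a = \<zeta>" using a_le by (intro min) (auto simp: P_def)
    then have "a q = \<zeta> q" by simp
    then show False using q(2) \<delta> by (simp add: a_def max_def split: if_splits)
  qed
  then have "\<xi> \<preceq> \<zeta>" using \<zeta>'(3) unfolding strongly_majorized_iff gap_def by blast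
  with \<zeta>' show ?thesis by blast
qed

text \<open>Partial sums of a nonincreasing sequence are concave in the number of terms; the
  right-hand side is a supporting line of slope \<open>s\<close> at \<open>M\<close>.\<close>

lemma partial_sum_tangent:
  fixes x :: "nat \<Rightarrow> real"
  assumes "\<And>j. j < M \<Longrightarrow> s \<le> x j" "\<And>j. j \<ge> M \<Longrightarrow> x j \<le> s"
  shows "(\<Sum>j<n. x j) \<le> (\<Sum>j<M. x j) + s * (real n - real M)"
proof (cases "n \<le> M")
  case True
  have "(\<Sum>j=n..<M. s) \<le> (\<Sum>j=n..<M. x j)" using assms(1) by (intro sum_mono) auto
  moreover have "(\<Sum>j<M. x j) = (\<Sum>j<n. x j) + (\<Sum>j=n..<M. x j)"
    using True by (metis atLeast0LessThan le0 sum.atLeastLessThan_concat)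
  ultimately show ?thesis using True by (simp add: of_nat_diff algebra_simps)
next
  case False
  have "(\<Sum>j=M..<n. x j) \<le> (\<Sum>j=M..<n. s)" using assms(2) by (intro sum_mono) auto
  moreover have "(\<Sum>j<n. x j) = (\<Sum>j<M. x j) + (\<Sum>j=M..<n. x j)"
    using False by (metis atLeast0LessThan le0 linorder_le_cases sum.atLeastLessThan_concat)
  ultimately show ?thesis using False by (simp add: of_nat_diff algebra_simps)
qed

lemma nonsummable_pos:
  assumes "\<xi> \<in> c0_star" "\<not> summable \<xi>" shows "\<xi> n > 0"
proof (rule ccontr)
  assume "\<not> \<xi> n > 0"
  then have "\<xi> m = 0" if "m \<ge> n" for m
    using c0_star_antimono[OF assms(1) that] c0_star_nonneg[OF assms(1), of m] by linarith
  then have "summable \<xi>" by (intro summable_finite[of "{..<n}"]) (auto simp: not_less)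
  with assms(2) show False ..
qed

text \<open>The partial sums of the new sequence are the minimum of those of \<open>\<zeta>\<close> and of tangents to the
  partial sums of \<open>\<xi>\<close>. The slopes of the tangents are chosen where the gap is small, so that each of
  them undercuts the partial sums of \<open>\<zeta>\<close> by little.\<close>

lemma ex_block_majorized_near:
  fixes \<xi> \<zeta> :: "nat \<Rightarrow> real"
  assumes \<xi>: "\<xi> \<in> c0_star" and \<zeta>: "\<zeta> \<in> c0_star" and ns: "\<not> summable \<xi>" and maj: "\<xi> \<preceq> \<zeta>"
  shows "\<exists>\<eta>\<in>c0_star. \<exists>\<omega>. summable \<omega> \<and> (\<forall>n. 0 \<le> \<omega> n \<and> \<eta> n \<le> \<zeta> n + \<omega> n) \<and> \<xi> \<prec>\<^sub>b \<eta>"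
proof -
  define X where "X n = (\<Sum>j<n. \<xi> j)" for n
  define Z where "Z n = (\<Sum>j<n. \<zeta> j)" for n
  have XZ: "X n \<le> Z n" for n using maj by (simp add: strongly_majorized_iff majorized_def X_def Z_def)
  have \<xi>pos: "\<xi> n > 0" for n by (rule nonsummable_pos[OF \<xi> ns])
  have "\<not> summable \<zeta>"
  proof
    assume sz: "summable \<zeta>"
    have "X n \<le> suminf \<zeta>" for n
      using XZ[of n] sum_le_suminf[OF sz, of "{..<n}"] c0_star_nonneg[OF \<zeta>] by (simp add: Z_def)
    then have "summable \<xi>"
      using c0_star_nonneg[OF \<xi>] by (intro summableI_nonneg_bounded[where x="suminf \<zeta>"]) (auto simp: X_def)
    with ns show False ..
  qed
  then have \<zeta>pos: "\<zeta> n > 0" for n using nonsummable_pos[OF \<zeta>] by blast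
  have "\<exists>m\<ge>k. Z m - X m < (1/2) ^ k" for k
    using maj unfolding strongly_majorized_iff X_def Z_def by simp
  \<comment> \<open>The geometric bounds on these gaps are what will make the perturbation
    summable.\<close>
  then obtain m where m: "\<And>k. m k \<ge> k" "\<And>k. Z (m k) - X (m k) < (1/2) ^ k" by metis
  define s where "s k = \<zeta> (m k)" for k
  have spos: "s k > 0" for k by (simp add: s_def \<zeta>pos)
  have "\<exists>n. \<xi> n \<le> s k" for k
    using order_tendstoD(2)[OF c0_star_lim[OF \<xi>] spos[of k]] unfolding eventually_sequentially
    by (meson order_refl less_imp_le)
  \<comment> \<open>The slope \<open>s k\<close>, which supports the sums of \<zeta> at
    \<open>m k\<close>, supports those of \<xi> at \<open>M k\<close>.\<close>
  define M where "M k = (LEAST n. \<xi> n \<le> s k)" for k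
  have M1: "s k \<le> \<xi> j" if "j < M k" for j k using not_less_Least[OF that[unfolded M_def]] by simp
  have M2: "\<xi> j \<le> s k" if "j \<ge> M k" for j k
    using LeastI_ex[OF \<open>\<And>k. \<exists>n. \<xi> n \<le> s k\<close>, of k] c0_star_antimono[OF \<xi> that] by (simp add: M_def)
  define T where "T k n = X (M k) + s k * (real n - real (M k))" for k n
  have T_X: "X n \<le> T k n" for k n unfolding T_def X_def by (rule partial_sum_tangent[OF M1 M2])
  \<comment> \<open>The supporting line of the sums of \<zeta> at \<open>m k\<close> is parallel to
    \<open>T k\<close>, and at \<open>m k\<close> it exceeds \<open>T k\<close> by less than
    \<open>(1/2) ^ k\<close>.\<close>
  have T_Z: "Z n \<le> T k n + (1/2) ^ k" for k n
  proof -
    have "Z n \<le> Z (m k) + s k * (real n - real (m k))" unfolding Z_def s_def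
      by (rule partial_sum_tangent) (auto intro: c0_star_antimono[OF \<zeta>])
    also have "\<dots> \<le> T k (m k) + (1/2) ^ k + s k * (real n - real (m k))"
      using m(2)[of k] T_X[of "m k" k] by simp
    also have "\<dots> = T k n + (1/2) ^ k" by (simp add: T_def algebra_simps)
    finally show ?thesis .
  qed
  define F where "F k n = min (Z n) (T k n)" for k n
  define V where "V n = (INF k. F k n)" for n
  have XF: "X n \<le> F k n" for k n using XZ T_X by (simp add: F_def)
  have bd: "bdd_below (range (\<lambda>k. F k n))" for n using XF by (intro bdd_belowI[where m="X n"]) auto
  have VF: "V n \<le> F k n" for k n unfolding V_def by (rule cINF_lower[OF bd UNIV_I])
  have Vge: "r \<le> V n" if "\<And>k. r \<le> F k n" for r n unfolding V_def using that by (intro cINF_greatest) auto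
  have XV: "X n \<le> V n" for n by (intro Vge XF)
  have VM: "V (M k) = X (M k)" for k
    using VF[of "M k" k] XV[of "M k"] by (simp add: F_def T_def)
  have V0: "V 0 = 0"
    using VF[of 0 0] XV[of 0] by (simp add: F_def X_def Z_def)
  have F_mono: "F k n \<le> F k (Suc n)" for k n
    using \<zeta>pos[of n] spos[of k] by (auto simp: F_def Z_def T_def min_def algebra_simps)
  have F_conc: "F k n + F k (Suc (Suc n)) \<le> 2 * F k (Suc n)" for k n
  proof -
    have "Z n + Z (Suc (Suc n)) \<le> 2 * Z (Suc n)"
      using c0_star_antimono[OF \<zeta>, of n "Suc n"] by (simp add: Z_def)
    moreover have "T k n + T k (Suc (Suc n)) = 2 * T k (Suc n)" by (simp add: T_def algebra_simps)
    ultimately show ?thesis unfolding F_def by linarith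
  qed
  \<comment> \<open>The amount cut off by the tangent. It grows up to \<open>m k\<close> and shrinks
    afterwards, so its total decrease is at most its value at \<open>m k\<close>.\<close>
  define D where "D k n = max 0 (Z n - T k n)" for k n
  have FD: "F k n = Z n - D k n" for k n by (auto simp: F_def D_def)
  have D0: "0 \<le> D k n" for k n by (simp add: D_def)
  have D2: "D k n \<le> (1/2) ^ k" for k n using T_Z[of n k] by (simp add: D_def)
  \<comment> \<open>Only a decrease of the cut can raise an increment of the infimum above that of
    \<open>Z\<close>; summing over \<open>k\<close> covers whichever tangent is active.\<close>
  define a where "a k n = max 0 (D k n - D k (Suc n))" for k n
  have a0: "0 \<le> a k n" for k n by (simp add: a_def)
  have a_sum: "(\<Sum>n<N. a k n) \<le> (if N \<le> m k then 0 else D k (m k) - D k N)" for k N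
  proof (induction N)
    case (Suc N)
    have step: "Z (Suc N) - T k (Suc N) = Z N - T k N + (\<zeta> N - s k)" by (simp add: Z_def T_def algebra_simps)
    show ?case
    proof (cases "N < m k")
      case True
      then have "s k \<le> \<zeta> N" unfolding s_def by (intro c0_star_antimono[OF \<zeta>]) simp
      then have "a k N = 0" using step by (simp add: a_def D_def)
      then show ?thesis using Suc True by simp
    next
      case False
      then have "\<zeta> N \<le> s k" unfolding s_def by (intro c0_star_antimono[OF \<zeta>]) simp
      then have "D k (Suc N) \<le> D k N" using step by (simp add: D_def)
      then have "a k N = D k N - D k (Suc N)" by (simp add: a_def)
      then show ?thesis using Suc False by (cases "N = m k") auto
    qed
  qed simp
  have a_sum': "(\<Sum>n<N. a k n) \<le> (1/2) ^ k" for k N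
    using a_sum[of k N] D2[of k "m k"] D0[of k N] D0[of k "m k"] by (auto split: if_splits)
  have a_le: "a k n \<le> (1/2) ^ k" for k n
    using D0[of k "Suc n"] D2[of k n] by (simp add: a_def)
  have geo: "summable (\<lambda>k. (1/2::real) ^ k)" by (rule summable_geometric) simp
  have a_summable: "summable (\<lambda>k. a k n)" for n
    by (rule summable_comparison_test'[OF geo, of 0]) (use a0 a_le in auto)
  define \<omega> where "\<omega> n = (\<Sum>k. a k n)" for n
  have \<omega>0: "0 \<le> \<omega> n" for n unfolding \<omega>_def by (intro suminf_nonneg a_summable a0)
  have a_\<omega>: "a k n \<le> \<omega> n" for k n
    unfolding \<omega>_def using sum_le_suminf[OF a_summable, of "{k}" n] a0 by simp
  have \<omega>_summable: "summable \<omega>"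
  proof (rule summableI_nonneg_bounded)
    fix N
    have "(\<Sum>n<N. \<omega> n) = (\<Sum>k. \<Sum>n<N. a k n)" unfolding \<omega>_def by (intro suminf_sum[symmetric] a_summable)
    also have "\<dots> \<le> (\<Sum>k. (1/2::real) ^ k)"
      by (intro suminf_le a_sum' summable_sum a_summable geo)
    finally show "(\<Sum>n<N. \<omega> n) \<le> (\<Sum>k. (1/2::real) ^ k)" .
  qed (rule \<omega>0)
  define \<eta> where "\<eta> n = V (Suc n) - V n" for n
  have \<eta>_sum: "(\<Sum>j<n. \<eta> j) = V n" for n
    unfolding \<eta>_def using sum_lessThan_telescope[of V n] V0 by simp
  have \<eta>_le: "\<eta> n \<le> \<zeta> n + \<omega> n" for n
  proof -
    have "V (Suc n) - \<zeta> n - \<omega> n \<le> V n"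
    proof (rule Vge)
      fix k
      have "V (Suc n) \<le> Z (Suc n) - D k (Suc n)" using VF[of "Suc n" k] by (simp add: FD)
      moreover have "D k n - D k (Suc n) \<le> \<omega> n" using a_\<omega>[of k n] by (simp add: a_def)
      ultimately show "V (Suc n) - \<zeta> n - \<omega> n \<le> F k n" by (simp add: FD Z_def)
    qed
    then show ?thesis by (simp add: \<eta>_def)
  qed
  have \<eta>0: "0 \<le> \<eta> n" for n
  proof -
    have "V n \<le> V (Suc n)" by (intro Vge order_trans[OF VF F_mono])
    then show ?thesis by (simp add: \<eta>_def)
  qed
  have "decseq \<eta>"
  proof (rule decseq_SucI)
    fix n
    \<comment> \<open>An infimum of concave sequences is concave, and concavity of \<open>V\<close>
      is monotonicity of \<eta>.\<close>
    have "(V n + V (Suc (Suc n))) / 2 \<le> V (Suc n)"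
    proof (rule Vge)
      fix k show "(V n + V (Suc (Suc n))) / 2 \<le> F k (Suc n)"
        using VF[of n k] VF[of "Suc (Suc n)" k] F_conc[of k n] by simp
    qed
    then show "\<eta> (Suc n) \<le> \<eta> n" by (simp add: \<eta>_def)
  qed
  moreover have "\<eta> \<longlonglongrightarrow> 0"
  proof (rule tendsto_sandwich[OF _ _ tendsto_const])
    show "(\<lambda>n. \<zeta> n + \<omega> n) \<longlonglongrightarrow> 0"
      using tendsto_add[OF c0_star_lim[OF \<zeta>] summable_LIMSEQ_zero[OF \<omega>_summable]] by simp
  qed (use \<eta>0 \<eta>_le in auto)
  ultimately have "\<eta> \<in> c0_star" using \<eta>0 by (simp add: c0_star_def)
  moreover have "\<xi> \<prec>\<^sub>b \<eta>"
  proof -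
    let ?S = "{n. 0 < n \<and> X n = V n}"
    have "infinite ?S" unfolding infinite_nat_iff_unbounded
    proof
      fix B
      \<comment> \<open>The slopes tend to 0 while all entries of \<xi> are positive, so the contact
        points \<open>M k\<close> are unbounded.\<close>
      have "s \<longlonglongrightarrow> 0"
      proof (rule tendsto_sandwich[OF _ _ tendsto_const c0_star_lim[OF \<zeta>]])
        show "\<forall>\<^sub>F k in sequentially. s k \<le> \<zeta> k" using m(1) by (auto simp: s_def c0_star_antimono[OF \<zeta>])
      qed (use less_imp_le[OF spos] in auto)
      then have "\<forall>\<^sub>F k in sequentially. s k < \<xi> B" using \<xi>pos order_tendstoD(2) by blast
      then obtain k where k: "s k < \<xi> B" by (auto simp: eventually_sequentially)
      then have "B < M k" using M2[of k B] by (meson not_le)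
      then show "\<exists>n>B. n \<in> ?S" using VM[of k] by (intro exI[of _ "M k"]) auto
    qed
    from infinite_enumerate[OF this] obtain r :: "nat \<Rightarrow> nat"
      where "strict_mono r" "\<forall>k. r k \<in> ?S" by (elim exE conjE)
    then show ?thesis using XV unfolding block_majorized_def majorized_def \<eta>_sum X_def by auto
  qed
  ultimately show ?thesis using \<omega>_summable \<omega>0 \<eta>_le by blast
qed

section \<open>Rows of an orthogonal matrix with prescribed diagonal\<close>

text \<open>The last clause excludes any mixing when the target is met already; it keeps a block of
  size one separate from the rest.\<close>

lemma ex_rotation:
  fixes a b x :: real
  assumes "b \<le> x" "x \<le> a"
  obtains c s where "c\<^sup>2 + s\<^sup>2 = 1" "c\<^sup>2 * a + s\<^sup>2 * b = x" "a = x \<Longrightarrow> s = 0"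
proof (cases "a = x")
  case True
  then show ?thesis using that[of 1 0] by simp
next
  case False
  define t where "t = (a - x) / (a - b)"
  have ab: "a - b > 0" using False assms by simp
  then have t: "0 \<le> t" "t \<le> 1" using assms by (auto simp: t_def)
  have "t * (a - b) = a - x" using ab by (simp add: t_def)
  then have "(1 - t) * a + t * b = x" by (simp add: algebra_simps)
  then show ?thesis using that[of "sqrt (1 - t)" "sqrt t"] t False by simp
qed

text \<open>A rotation preserves the trace of the pair, so the vector that remains carries the value
  \<open>\<eta> m + \<eta> (Suc m) - x\<close>. Later indices move down by one.\<close>

definition merge_pair :: "(nat \<Rightarrow> real) \<Rightarrow> nat \<Rightarrow> real \<Rightarrow> nat \<Rightarrow> real" where
  "merge_pair \<eta> m x j = (if j < m then \<eta> j else if j = m then \<eta> m + \<eta> (Suc m) - x else \<eta> (Suc j))"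

definition rotate_pair :: "(nat \<Rightarrow> 'h) \<Rightarrow> nat \<Rightarrow> real \<Rightarrow> real \<Rightarrow> nat \<Rightarrow> 'h::complex_hilbert_space" where
  "rotate_pair v m c s j = (if j < m then v j else if j = m then c *\<^sub>R v (Suc m) - s *\<^sub>R v m else v (Suc j))"

text \<open>The remaining value lies between \<open>\<eta> (Suc m)\<close> and
  \<open>\<eta> m\<close>, so it fits at place \<open>m\<close> without sorting.\<close>

lemma merge_pair_c0_star:
  assumes \<eta>: "\<eta> \<in> c0_star" and x: "\<eta> (Suc m) \<le> x" "x \<le> \<eta> m"
  shows "merge_pair \<eta> m x \<in> c0_star"
proof -
  have "merge_pair \<eta> m x (Suc n) \<le> merge_pair \<eta> m x n" for n
  proof -
    consider "Suc n < m" | "Suc n = m" | "n = m" | "n > m" by linarith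
    then show ?thesis
      using x c0_star_antimono[OF \<eta>, of n "Suc n"] c0_star_antimono[OF \<eta>, of "Suc n" "Suc (Suc n)"]
      by cases (auto simp: merge_pair_def)
  qed
  then have "decseq (merge_pair \<eta> m x)" by (rule decseq_SucI)
  moreover have "0 \<le> merge_pair \<eta> m x n" for n
    using c0_star_nonneg[OF \<eta>] x by (auto simp: merge_pair_def add_increasing2)
  moreover have "merge_pair \<eta> m x \<longlonglongrightarrow> 0"
  proof (rule Lim_transform_eventually)
    show "(\<lambda>n. \<eta> (Suc n)) \<longlonglongrightarrow> 0" using c0_star_lim[OF \<eta>] by (rule LIMSEQ_Suc)
    show "\<forall>\<^sub>F n in sequentially. \<eta> (Suc n) = merge_pair \<eta> m x n"
      using eventually_gt_at_top[of m] by eventually_elim (simp add: merge_pair_def)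
  qed
  ultimately show ?thesis by (simp add: c0_star_def)
qed

lemma sum_merge_pair: "(\<Sum>j<n. merge_pair \<eta> m x j) = (if n \<le> m then (\<Sum>j<n. \<eta> j) else (\<Sum>j<Suc n. \<eta> j) - x)"
proof (induction n)
  case (Suc n)
  consider "Suc n \<le> m" | "n = m" | "n > m" by linarith
  then show ?case using Suc by cases (auto simp: merge_pair_def)
qed simp

text \<open>Up to \<open>m\<close> the comparison is entrywise through \<open>x 0\<close>; beyond
  \<open>m\<close> both sums have lost exactly \<open>x 0\<close>.\<close>

lemma merge_pair_majorizes:
  fixes x \<eta> :: "nat \<Rightarrow> real"
  assumes x: "x \<in> c0_star" and \<eta>: "decseq \<eta>" and maj: "x \<prec> \<eta>" and m: "x 0 \<le> \<eta> m"
  shows "(\<lambda>j. x (Suc j)) \<prec> merge_pair \<eta> m (x 0)"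
  unfolding majorized_def
proof
  fix n
  show "(\<Sum>j<n. x (Suc j)) \<le> sum (merge_pair \<eta> m (x 0)) {..<n}"
  proof (cases "n \<le> m")
    case True
    have "x (Suc j) \<le> \<eta> j" if "j < n" for j
      using c0_star_antimono[OF x, of 0 "Suc j"] m \<eta> that True unfolding decseq_def
      by (meson le0 less_imp_le order_trans)
    then show ?thesis using True by (auto simp: sum_merge_pair intro: sum_mono)
  next
    case False
    have "(\<Sum>j<n. x (Suc j)) = (\<Sum>j<Suc n. x j) - x 0" by (simp add: sum.lessThan_Suc_shift del: sum.lessThan_Suc)
    moreover have "(\<Sum>j<Suc n. x j) \<le> (\<Sum>j<Suc n. \<eta> j)" using maj unfolding majorized_def by blast
    ultimately show ?thesis using False by (simp add: sum_merge_pair)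
  qed
qed

text \<open>Only the compression of \<open>D\<close> to the span is diagonal; being eigenvectors
  would be too much to ask, since rotation destroys this.\<close>

definition diagonal_system ::
    "('h::complex_hilbert_space \<Rightarrow>\<^sub>L 'h) \<Rightarrow> (nat \<Rightarrow> real) \<Rightarrow> (nat \<Rightarrow> 'h) \<Rightarrow> bool" where
  "diagonal_system D \<eta> v \<longleftrightarrow> (\<forall>i j. cinner (v i) (v j) = (if i = j then 1 else 0) \<and>
     cinner (blinfun_apply D (v i)) (v j) = (if i = j then of_real (\<eta> i) else 0))"

lemma diagonal_system_rotate:
  fixes D :: "'h::complex_hilbert_space \<Rightarrow>\<^sub>L 'h"
  assumes v: "diagonal_system D \<eta> v" and cs: "c\<^sup>2 + s\<^sup>2 = 1" and x: "c\<^sup>2 * \<eta> m + s\<^sup>2 * \<eta> (Suc m) = x"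
  defines "u \<equiv> c *\<^sub>R v m + s *\<^sub>R v (Suc m)"
  shows "diagonal_system D (merge_pair \<eta> m x) (rotate_pair v m c s)"
    and "cinner u u = 1" "cinner (blinfun_apply D u) u = of_real x"
    and "cinner u (rotate_pair v m c s j) = 0"
proof -
  have v1: "cinner (v i) (v j) = (if i = j then 1 else 0)" for i j using v by (simp add: diagonal_system_def)
  have v2: "cinner (blinfun_apply D (v i)) (v j) = (if i = j then of_real (\<eta> i) else 0)" for i j
    using v by (simp add: diagonal_system_def)
  have cs': "complex_of_real c * complex_of_real c + complex_of_real s * complex_of_real s = 1"
    using arg_cong[OF cs, of complex_of_real] by (simp add: power2_eq_square)
  have x': "complex_of_real c * (complex_of_real c * complex_of_real (\<eta> m)) +
      complex_of_real s * (complex_of_real s * complex_of_real (\<eta> (Suc m))) = complex_of_real x"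
    using arg_cong[OF x, of complex_of_real] by (simp add: power2_eq_square mult.assoc)
  have cx: "complex_of_real c * (complex_of_real c * complex_of_real (\<eta> (Suc m))) +
      complex_of_real s * (complex_of_real s * complex_of_real (\<eta> m)) =
      complex_of_real (\<eta> m) + complex_of_real (\<eta> (Suc m)) - complex_of_real x"
  proof -
    have s2: "s\<^sup>2 = 1 - c\<^sup>2" using cs by simp
    have "c\<^sup>2 * \<eta> (Suc m) + s\<^sup>2 * \<eta> m = \<eta> m + \<eta> (Suc m) - x"
      using x unfolding s2 by (simp add: algebra_simps)
    from arg_cong[OF this, of complex_of_real] show ?thesis by (simp add: power2_eq_square mult.assoc)
  qed
  note lin = cinner_linear blinfun.add_right blinfun.diff_right blinfun.scaleR_right v1 v2
  show "cinner u u = 1" using cs' by (simp add: u_def lin)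
  show "cinner (blinfun_apply D u) u = of_real x" using x' by (simp add: u_def lin mult.assoc)
  show "cinner u (rotate_pair v m c s j) = 0"
    by (simp add: u_def rotate_pair_def lin mult.commute)
  show "diagonal_system D (merge_pair \<eta> m x) (rotate_pair v m c s)"
    unfolding diagonal_system_def
  proof (intro allI conjI)
    fix i j
    show "cinner (rotate_pair v m c s i) (rotate_pair v m c s j) = (if i = j then 1 else 0)"
      using cs' by (auto simp: rotate_pair_def lin)
    show "cinner (blinfun_apply D (rotate_pair v m c s i)) (rotate_pair v m c s j) =
        (if i = j then of_real (merge_pair \<eta> m x i) else 0)"
      using cx by (auto simp: rotate_pair_def merge_pair_def lin mult.assoc)
  qed
qed

text \<open>The vector \<open>u\<close> is the next row and \<open>v'\<close> replaces \<open>v\<close>. The last clause says that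
  the step respects the blocks given by equalities of partial sums.\<close>

definition schur_horn_step ::
    "('h::complex_hilbert_space \<Rightarrow>\<^sub>L 'h) \<Rightarrow> (nat \<Rightarrow> real) \<Rightarrow> (nat \<Rightarrow> real) \<times> (nat \<Rightarrow> 'h) \<times> 'h
      \<Rightarrow> (nat \<Rightarrow> real) \<times> (nat \<Rightarrow> 'h) \<times> 'h \<Rightarrow> bool" where
  "schur_horn_step D x = (\<lambda>(\<eta>, v, _) (\<eta>', v', u).
     cinner u u = 1 \<and> cinner (blinfun_apply D u) u = of_real (x 0) \<and> (\<forall>j. cinner u (v' j) = 0) \<and>
     (\<forall>y. (\<forall>j. cinner (v j) y \<in> \<real>) \<longrightarrow> cinner u y \<in> \<real> \<and> (\<forall>j. cinner (v' j) y \<in> \<real>)) \<and>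
     (\<forall>y. (\<forall>j. cinner (v j) y = 0) \<longrightarrow> cinner u y = 0 \<and> (\<forall>j. cinner (v' j) y = 0)) \<and>
     (\<forall>N. (\<Sum>j<Suc N. x j) = (\<Sum>j<Suc N. \<eta> j) \<longrightarrow> (\<Sum>j<N. x (Suc j)) = (\<Sum>j<N. \<eta>' j) \<and>
        (\<forall>y. (\<forall>j<Suc N. cinner (v j) y = 0) \<longrightarrow> cinner u y = 0 \<and> (\<forall>j<N. cinner (v' j) y = 0))))"

lemma ex_schur_horn_step:
  fixes D :: "'h::complex_hilbert_space \<Rightarrow>\<^sub>L 'h" and x \<eta> :: "nat \<Rightarrow> real"
  assumes x: "x \<in> c0_star" "x 0 > 0" and \<eta>: "\<eta> \<in> c0_star" and maj: "x \<prec> \<eta>"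
    and v: "diagonal_system D \<eta> v"
  shows "\<exists>\<eta>' v' u. \<eta>' \<in> c0_star \<and> (\<lambda>j. x (Suc j)) \<prec> \<eta>' \<and> diagonal_system D \<eta>' v' \<and>
    schur_horn_step D x (\<eta>, v, w) (\<eta>', v', u)"
proof -
  \<comment> \<open>The first place where the target \<open>x 0\<close> fits between neighbouring
    entries; it exists because \<open>x 0 > 0\<close> and \<eta> tends to 0.\<close>
  define m where "m = (LEAST m. \<eta> (Suc m) \<le> x 0)"
  have "\<exists>m. \<eta> (Suc m) \<le> x 0"
    using order_tendstoD(2)[OF LIMSEQ_Suc[OF c0_star_lim[OF \<eta>]] x(2)] unfolding eventually_sequentially
    by (meson order_refl less_imp_le)
  then have m1: "\<eta> (Suc m) \<le> x 0" unfolding m_def by (rule LeastI_ex)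
  have least: "x 0 < \<eta> (Suc k)" if "k < m" for k using not_less_Least[OF that[unfolded m_def]] by simp
  have x0: "x 0 \<le> \<eta> 0" using maj[unfolded majorized_def, rule_format, of 1] by simp
  have m2: "x 0 \<le> \<eta> m"
    using x0 least[of "m - 1"] by (cases m) auto
  obtain c s where cs: "c\<^sup>2 + s\<^sup>2 = 1" "c\<^sup>2 * \<eta> m + s\<^sup>2 * \<eta> (Suc m) = x 0" "\<eta> m = x 0 \<Longrightarrow> s = 0"
    using ex_rotation[OF m1 m2] by metis
  define u where "u = c *\<^sub>R v m + s *\<^sub>R v (Suc m)"
  define v' where "v' = rotate_pair v m c s"
  \<comment> \<open>Equal sums up to \<open>Suc N\<close> force the rotated pair into the first
    \<open>Suc N\<close> indices: otherwise the entries of \<eta> there, past the first, exceed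
    \<open>x 0\<close> and the sums differ. For \<open>N = 0\<close> the rotation is
    trivial.\<close>
  have small: "Suc m < Suc N \<or> N = 0 \<and> m = 0 \<and> s = 0"
    if eq: "(\<Sum>j<Suc N. x j) = (\<Sum>j<Suc N. \<eta> j)" for N
  proof (cases "N = 0")
    case True
    then have e: "x 0 = \<eta> 0" using eq by simp
    then have "m = 0" unfolding m_def using c0_star_antimono[OF \<eta>, of 0 1] by (intro Least_equality) auto
    with True cs(3) e show ?thesis by simp
  next
    case False
    have "m < N"
    proof (rule ccontr)
      assume "\<not> m < N"
      then have big: "x 0 < \<eta> j" if "0 < j" "j < Suc N" for j
        using least[of "j - 1"] that by (cases j) auto
      have "(\<Sum>j<Suc N. x j) < (\<Sum>j<Suc N. \<eta> j)"
      proof (rule sum_strict_mono_ex1)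
        show "\<forall>j\<in>{..<Suc N}. x j \<le> \<eta> j"
        proof
          fix j assume "j \<in> {..<Suc N}"
          then show "x j \<le> \<eta> j"
            using big[of j] x0 c0_star_antimono[OF x(1), of 0 j] by (cases "j = 0") auto
        qed
        show "\<exists>j\<in>{..<Suc N}. x j < \<eta> j"
          using big[of 1] False c0_star_antimono[OF x(1), of 0 1] by (intro bexI[of _ 1]) auto
      qed simp
      with eq show False by simp
    qed
    then show ?thesis by simp
  qed
  have step: "schur_horn_step D x (\<eta>, v, w) (merge_pair \<eta> m (x 0), v', u)"
    unfolding schur_horn_step_def prod.case
  proof (intro conjI allI impI)
    show "cinner u u = 1" "cinner (blinfun_apply D u) u = of_real (x 0)" "cinner u (v' j) = 0" for j
      unfolding u_def v'_def using diagonal_system_rotate[OF v cs(1,2)] by auto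
    fix y
    show "cinner u y \<in> \<real>" if "\<forall>j. cinner (v j) y \<in> \<real>"
      using that by (simp add: u_def cinner_linear)
    show "cinner (v' j) y \<in> \<real>" if "\<forall>j. cinner (v j) y \<in> \<real>" for j
      using that by (simp add: v'_def rotate_pair_def cinner_linear)
    show "cinner u y = 0" if "\<forall>j. cinner (v j) y = 0"
      using that by (simp add: u_def cinner_linear)
    show "cinner (v' j) y = 0" if "\<forall>j. cinner (v j) y = 0" for j
      using that by (simp add: v'_def rotate_pair_def cinner_linear)
  next
    fix N assume eq: "(\<Sum>j<Suc N. x j) = (\<Sum>j<Suc N. \<eta> j)"
    have "(\<Sum>j<N. x (Suc j)) = (\<Sum>j<Suc N. x j) - x 0" by (simp add: sum.lessThan_Suc_shift del: sum.lessThan_Suc)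
    then show "(\<Sum>j<N. x (Suc j)) = (\<Sum>j<N. merge_pair \<eta> m (x 0) j)"
      using small[OF eq] eq by (auto simp: sum_merge_pair)
    fix y assume y: "\<forall>j<Suc N. cinner (v j) y = 0"
    show "cinner u y = 0" using small[OF eq] y by (auto simp: u_def cinner_linear)
    show "cinner (v' j) y = 0" if "j < N" for j
      using small[OF eq] y that by (auto simp: v'_def rotate_pair_def cinner_linear)
  qed
  show ?thesis
  proof (intro exI conjI)
    show "merge_pair \<eta> m (x 0) \<in> c0_star" by (rule merge_pair_c0_star[OF \<eta> m1 m2])
    show "(\<lambda>j. x (Suc j)) \<prec> merge_pair \<eta> m (x 0)"
      by (rule merge_pair_majorizes[OF x(1) c0_star_decseq[OF \<eta>] maj m2])
    show "diagonal_system D (merge_pair \<eta> m (x 0)) v'"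
      unfolding v'_def by (rule diagonal_system_rotate(1)[OF v cs(1,2)])
  qed (rule step)
qed

section \<open>Iterated rotations and completeness of the columns\<close>

lemma c0_star_shift: "\<xi> \<in> c0_star \<Longrightarrow> (\<lambda>j. \<xi> (n + j)) \<in> c0_star"
  using LIMSEQ_ignore_initial_segment[of \<xi> 0 n] by (auto simp: c0_star_def decseq_def add.commute)

context onb
begin

lemma diag_cinner_sums:
  assumes "\<eta> \<in> c0_star"
  shows "(\<lambda>j. \<eta> j * (cmod (cinner x (e j)))\<^sup>2) sums Re (cinner (blinfun_apply (diag_real e \<eta>) x) x)"
proof -
  have "(\<lambda>j. Re (complex_of_real (\<eta> j) * cinner x (e j) * cinner (e j) x)) sums
     Re (cinner (blinfun_apply (diag_real e \<eta>) x) x)"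
    unfolding diag_eq_opser
    by (intro bounded_linear.sums[OF bounded_linear_Re]
      opser_cinner_sums[OF e_suborth e_suborth, of "\<lambda>n. complex_of_real (\<eta> n)" "\<eta> 0", OF c0_star_cmod_le[OF assms]])
  then show ?thesis unfolding mult.assoc cinner_mult_commute by simp
qed

lemma ex_orthonormal_rows:
  fixes \<xi> \<eta> :: "nat \<Rightarrow> real"
  assumes \<xi>: "\<xi> \<in> c0_star" "\<And>n. \<xi> n > 0" and \<eta>: "\<eta> \<in> c0_star" and maj: "\<xi> \<prec> \<eta>"
  shows "\<exists>u. (\<forall>i j. cinner (u i) (u j) = (if i = j then 1 else 0)) \<and> (\<forall>i j. cinner (u i) (e j) \<in> \<real>) \<and>
    (\<forall>i. (\<lambda>j. \<eta> j * (cmod (cinner (u i) (e j)))\<^sup>2) sums \<xi> i) \<and>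
    (\<forall>N. (\<Sum>j<N. \<xi> j) = (\<Sum>j<N. \<eta> j) \<longrightarrow> (\<forall>i<N. \<forall>j\<ge>N. cinner (u i) (e j) = 0))"
proof -
  define D where "D = diag_real e \<eta>"
  define P where "P n = (\<lambda>(\<eta>', v, u :: 'h). \<eta>' \<in> c0_star \<and> (\<lambda>j. \<xi> (n + j)) \<prec> \<eta>' \<and> diagonal_system D \<eta>' v)" for n
  have De: "blinfun_apply D (e i) = complex_of_real (\<eta> i) *\<^sub>C e i" for i
    unfolding D_def diag_eq_opser
    using opser_apply_basis[OF e_suborth e_suborth, of "\<lambda>n. complex_of_real (\<eta> n)" "\<eta> 0" i, OF c0_star_cmod_le[OF \<eta>]] by simp
  \<comment> \<open>The last component of a state is the row just produced; the initial 0 is a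
    placeholder.\<close>
  have init: "P 0 (\<eta>, e, 0)"
    using \<eta> maj by (simp add: P_def diagonal_system_def De e_cinner cinner_scaleC_left)
  have "\<exists>f. \<forall>n. (P n (f n) \<and> (n = 0 \<longrightarrow> f n = (\<eta>, e, 0))) \<and> schur_horn_step D (\<lambda>j. \<xi> (n + j)) (f n) (f (Suc n))"
  proof (rule dependent_nat_choice)
    show "\<exists>st. P 0 st \<and> (0 = (0::nat) \<longrightarrow> st = (\<eta>, e, 0))" using init by blast
    fix st and n :: nat assume "P n st \<and> (n = 0 \<longrightarrow> st = (\<eta>, e, 0))"
    moreover obtain \<eta>1 v w where st: "st = (\<eta>1, v, w)" by (cases st)
    ultimately have "\<eta>1 \<in> c0_star" "(\<lambda>j. \<xi> (n + j)) \<prec> \<eta>1" "diagonal_system D \<eta>1 v"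
      by (auto simp: P_def)
    from ex_schur_horn_step[OF c0_star_shift[OF \<xi>(1)] _ this, of w] \<xi>(2)
    obtain \<eta>' v' u where "\<eta>' \<in> c0_star" "(\<lambda>j. \<xi> (n + Suc j)) \<prec> \<eta>'" "diagonal_system D \<eta>' v'"
      "schur_horn_step D (\<lambda>j. \<xi> (n + j)) st (\<eta>', v', u)" unfolding st by blast
    then show "\<exists>st'. (P (Suc n) st' \<and> (Suc n = 0 \<longrightarrow> st' = (\<eta>, e, 0))) \<and>
        schur_horn_step D (\<lambda>j. \<xi> (n + j)) st st'"
      by (intro exI[of _ "(\<eta>', v', u)"]) (simp add: P_def)
  qed
  then obtain f where f0: "f 0 = (\<eta>, e, 0)"
    and step: "\<And>n. schur_horn_step D (\<lambda>j. \<xi> (n + j)) (f n) (f (Suc n))" by blast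
  define h where "h n = fst (f n)" for n
  define v where "v n = fst (snd (f n))" for n
  \<comment> \<open>The step from \<open>n\<close> to \<open>Suc n\<close> produces row
    \<open>n\<close>, hence the shift.\<close>
  define u where "u n = snd (snd (f (Suc n)))" for n
  have v0: "v 0 = e" and h0: "h 0 = \<eta>" by (simp_all add: v_def h_def f0)
  have st: "schur_horn_step D (\<lambda>j. \<xi> (n + j)) (h n, v n, snd (snd (f n))) (h (Suc n), v (Suc n), u n)" for n
    using step[of n] by (simp add: h_def v_def u_def)
  note S = st[unfolded schur_horn_step_def prod.case]
  have u1: "cinner (u n) (u n) = 1" and uD: "cinner (blinfun_apply D (u n)) (u n) = of_real (\<xi> n)"
    and uv: "cinner (u n) (v (Suc n) j) = 0" for n j
    using S[of n] by auto
  have real_step: "cinner (u n) y \<in> \<real> \<and> (\<forall>j. cinner (v (Suc n) j) y \<in> \<real>)" if "\<forall>j. cinner (v n j) y \<in> \<real>" for n y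
    using S[of n] that by blast
  have zero_step: "cinner (u n) y = 0 \<and> (\<forall>j. cinner (v (Suc n) j) y = 0)" if "\<forall>j. cinner (v n j) y = 0" for n y
    using S[of n] that by blast
  have touch_step: "(\<Sum>j<N. \<xi> (Suc n + j)) = (\<Sum>j<N. h (Suc n) j) \<and>
      (\<forall>y. (\<forall>j<Suc N. cinner (v n j) y = 0) \<longrightarrow> cinner (u n) y = 0 \<and> (\<forall>j<N. cinner (v (Suc n) j) y = 0))"
    if "(\<Sum>j<Suc N. \<xi> (n + j)) = (\<Sum>j<Suc N. h n j)" for n N
    using S[of n] that by simp
  have v_real: "\<forall>j. cinner (v n j) (e k) \<in> \<real>" for n k
  proof (induction n)
    case 0 show ?case by (simp add: v0 e_cinner)
  next
    case (Suc n) then show ?case using real_step by blast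
  qed
  have u_real: "cinner (u i) (e k) \<in> \<real>" for i k using real_step v_real by blast
  \<comment> \<open>Each row is orthogonal to the system that follows it, and orthogonality to a
    whole system is inherited by all later systems and rows.\<close>
  have vu: "\<forall>j. cinner (v k j) (u i) = 0" if "i < k" for i k
    using that
  proof (induction k)
    case (Suc k)
    then consider "i < k" | "i = k" by linarith
    then show ?case
    proof cases
      case 1 then show ?thesis using Suc zero_step by blast
    next
      case 2 then show ?thesis using uv by (simp add: cinner_eq_zero_commute)
    qed
  qed simp
  have uu: "cinner (u k) (u i) = 0" if "i < k" for i k using zero_step[of k "u i"] vu[OF that] by blast
  have ortho: "cinner (u i) (u j) = (if i = j then 1 else 0)" for i j
    using uu[of i j] uu[of j i] u1 by (cases i j rule: linorder_cases) (auto simp: cinner_eq_zero_commute)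
  have sums: "(\<lambda>j. \<eta> j * (cmod (cinner (u i) (e j)))\<^sup>2) sums \<xi> i" for i
    using diag_cinner_sums[OF \<eta>, of "u i"] uD[of i] by (simp add: D_def)
  have touch: "cinner (u i) (e l) = 0" if eq: "(\<Sum>j<N. \<xi> j) = (\<Sum>j<N. \<eta> j)" and "i < N" "N \<le> l" for N i l
  proof -
    \<comment> \<open>A block of length \<open>N\<close> shrinks by one index per step, so equal
      sums and vanishing coordinates persist for the remaining length \<open>N - n\<close>.\<close>
    have inv: "(\<Sum>j<N - n. \<xi> (n + j)) = (\<Sum>j<N - n. h n j) \<and> (\<forall>j<N - n. cinner (v n j) (e l) = 0)" if "n < N" for n
      using that
    proof (induction n)
      case 0 then show ?case using eq \<open>N \<le> l\<close> by (simp add: v0 h0 e_cinner)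
    next
      case (Suc n)
      then have "N - n = Suc (N - Suc n)" by simp
      with Suc touch_step[where n=n and N="N - Suc n"] show ?case by simp
    qed
    have "N - i = Suc (N - Suc i)" using \<open>i < N\<close> by simp
    then show ?thesis using inv[OF \<open>i < N\<close>] touch_step[where n=i and N="N - Suc i"] by simp
  qed
  show ?thesis using ortho u_real sums touch by (intro exI[of _ u]) blast
qed

text \<open>Since the gaps of the partial sums have lower limit zero, no column can lose mass.\<close>

lemma column_full:
  fixes \<xi> \<eta> :: "nat \<Rightarrow> real"
  assumes \<eta>: "\<eta> \<in> c0_star" and maj: "\<xi> \<preceq> \<eta>" and u: "suborth u" "\<And>i. norm (u i) = 1"
    and sums: "\<And>i. (\<lambda>j. \<eta> j * (cmod (cinner (u i) (e j)))\<^sup>2) sums \<xi> i" and k: "\<eta> k > 0"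
  shows "blinfun_apply (opser (\<lambda>_. 1) u u) (e k) = e k"
proof -
  define b where "b i j = (cmod (cinner (u i) (e j)))\<^sup>2" for i j
  have row: "b i sums 1" for i using e_parseval[of "u i"] u(2) by (simp add: b_def[abs_def])
  have col_eq: "b i j = (cmod (cinner (e j) (u i)))\<^sup>2" for i j
    unfolding b_def by (metis cnj_cinner complex_mod_cnj)
  have col: "(\<Sum>i<n. b i j) \<le> 1" for n j
    unfolding col_eq using bessel_finite[OF u(1), of "{..<n}" "e j"] by simp
  have col_summable: "summable (\<lambda>i. b i k)" unfolding col_eq by (rule bessel_summable[OF u(1)])
  have col_le: "(\<Sum>i. b i k) \<le> 1" unfolding col_eq using bessel[OF u(1), of "e k"] by simp
  have b0: "0 \<le> b i j" for i j by (simp add: b_def)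
  have full: "(\<Sum>i. b i k) = 1"
  proof (rule ccontr)
    assume "(\<Sum>i. b i k) \<noteq> 1"
    define \<delta> where "\<delta> = 1 - (\<Sum>i. b i k)"
    have \<delta>: "\<delta> > 0" using col_le \<open>(\<Sum>i. b i k) \<noteq> 1\<close> by (simp add: \<delta>_def)
    obtain N where N: "\<And>n. n \<ge> N \<Longrightarrow> \<eta> n < \<eta> k / 2"
      using order_tendstoD(2)[OF c0_star_lim[OF \<eta>], of "\<eta> k / 2"] k by (auto simp: eventually_sequentially)
    have gap: "\<delta> * (\<eta> k / 2) \<le> (\<Sum>j<n. \<eta> j) - (\<Sum>j<n. \<xi> j)" if n: "n \<ge> max N (Suc k)" for n
    proof -
      \<comment> \<open>Column sums of the first \<open>n\<close> rows; weighted with \<eta> they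
        add up to the partial sum of \<xi>.\<close>
      let ?c = "\<lambda>j. \<Sum>i<n. b i j"
      have c_sums: "?c sums (\<Sum>i<n. 1)" by (intro sums_sum row)
      have "(\<lambda>j. \<Sum>i<n. \<eta> j * b i j) sums (\<Sum>i<n. \<xi> i)"
        unfolding b_def by (intro sums_sum sums)
      then have "(\<lambda>j. ?c j * \<eta> j) sums (\<Sum>i<n. \<xi> i)"
        by (simp add: sum_distrib_left[symmetric] mult.commute)
      then have \<xi>n: "(\<Sum>j. ?c j * \<eta> j) = (\<Sum>i<n. \<xi> i)" by (rule sums_unique[symmetric])
      have "(1 - ?c k) * (\<eta> k - \<eta> n) \<le> (\<Sum>j<n. \<eta> j) - (\<Sum>j. ?c j * \<eta> j)"
        by (rule weighted_sum_gap)
          (use n c0_star_decseq[OF \<eta>] c0_star_nonneg[OF \<eta>] b0 col c_sums in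
            \<open>auto intro: sum_nonneg dest: sums_summable sums_unique[symmetric]\<close>)
      moreover have "\<delta> \<le> 1 - ?c k"
        using sum_le_suminf[OF col_summable, of "{..<n}"] b0 by (simp add: \<delta>_def)
      moreover have "\<eta> k / 2 \<le> \<eta> k - \<eta> n" using N[of n] n by simp
      ultimately show ?thesis
        using mult_mono[of \<delta> "1 - ?c k" "\<eta> k / 2" "\<eta> k - \<eta> n"] \<delta> k \<xi>n by simp
    qed
    have "\<delta> * (\<eta> k / 2) > 0" using \<delta> k by simp
    then obtain n where "n \<ge> max N (Suc k)" "(\<Sum>j<n. \<eta> j) - (\<Sum>j<n. \<xi> j) < \<delta> * (\<eta> k / 2)"
      using maj unfolding strongly_majorized_iff by blast
    then show False using gap[of n] by simp
  qed
  let ?P = "opser (\<lambda>_. 1) u u"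
  \<comment> \<open>Full mass means that the projection of \<open>e k\<close> to the span of the
    rows has product 1 with \<open>e k\<close>. The remainder \<open>z\<close> is thus orthogonal to
    \<open>e k\<close> and to all rows, hence to itself.\<close>
  define z where "z = e k - blinfun_apply ?P (e k)"
  have one: "cmod ((\<lambda>_. 1) n) \<le> (1::real)" for n :: nat by simp
  have "(\<lambda>i. cinner (e k) (u i) * cinner (u i) (e k)) sums cinner (blinfun_apply ?P (e k)) (e k)"
    using opser_cinner_sums[OF u(1) u(1), of "\<lambda>_. 1" 1 "e k" "e k"] by simp
  then have "(\<lambda>i. complex_of_real (b i k)) sums cinner (blinfun_apply ?P (e k)) (e k)"
    unfolding cinner_mult_commute col_eq .
  moreover have "(\<lambda>i. complex_of_real (b i k)) sums complex_of_real 1"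
    unfolding sums_of_real_iff using summable_sums[OF col_summable] full by simp
  ultimately have "cinner (blinfun_apply ?P (e k)) (e k) = 1" using sums_unique2 by fastforce
  then have zk: "cinner z (e k) = 0" by (simp add: z_def cinner_diff_left e_cinner)
  have zu: "cinner z (u i) = 0" for i
    using opser_cinner_basis[OF u(1) u(1), of "\<lambda>_. 1" 1 "e k" i] u(2)[of i]
    by (auto simp: z_def cinner_diff_left)
  have "(\<lambda>i. cinner (e k) (u i) * cinner (u i) z) sums cinner (blinfun_apply ?P (e k)) z"
    using opser_cinner_sums[OF u(1) u(1), of "\<lambda>_. 1" 1 "e k" z] by simp
  moreover have "cinner (u i) z = 0" for i using zu cinner_eq_zero_commute by blast
  ultimately have "(\<lambda>i. 0) sums cinner (blinfun_apply ?P (e k)) z" by simp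
  then have "cinner (blinfun_apply ?P (e k)) z = 0" using sums_unique2 sums_zero by blast
  moreover have "cinner (e k) z = 0" using zk by (simp add: cinner_eq_zero_commute)
  ultimately have "cinner z z = 0" by (subst (1) z_def) (simp add: cinner_diff_left)
  then show ?thesis by (simp add: cinner_self z_def)
qed

end

section \<open>Orthogonal matrices\<close>

context onb
begin

lemma entry_adj: "A \<in> B_H \<Longrightarrow> cinner (blinfun_apply (adj A) (e i)) (e j) = cnj (entry e A i j)"
  by (simp add: entry_def cinner_adj_left cnj_cinner)

lemma unitary_opI:
  fixes U V :: "'h \<Rightarrow>\<^sub>L 'h"
  assumes "U \<in> B_H" "V \<in> B_H" "\<And>x y. cinner (blinfun_apply U x) y = cinner x (blinfun_apply V y)"
    "V o\<^sub>L U = id_blinfun" "U o\<^sub>L V = id_blinfun"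
  shows "unitary_op U"
  using assms adjI[OF assms(2,3)] by (simp add: unitary_op_def)

lemma unitary_cinner:
  "unitary_op (U :: 'h \<Rightarrow>\<^sub>L 'h) \<Longrightarrow> cinner (blinfun_apply U x) (blinfun_apply U y) = cinner x y"
  "unitary_op U \<Longrightarrow> cinner (blinfun_apply (adj U) x) (blinfun_apply (adj U) y) = cinner x y"
proof -
  assume U: "unitary_op U"
  then have B: "U \<in> B_H" and 1: "adj U o\<^sub>L U = id_blinfun" and 2: "U o\<^sub>L adj U = id_blinfun"
    by (auto simp: unitary_op_def)
  show "cinner (blinfun_apply U x) (blinfun_apply U y) = cinner x y"
    unfolding cinner_adj_right[OF B] blinfun_apply_blinfun_compose[symmetric] 1 by simp
  show "cinner (blinfun_apply (adj U) x) (blinfun_apply (adj U) y) = cinner x y"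
    unfolding cinner_adj_left[OF B] blinfun_apply_blinfun_compose[symmetric] 2 by simp
qed

lemma unitary_norm_le: "unitary_op (U :: 'h \<Rightarrow>\<^sub>L 'h) \<Longrightarrow> norm U \<le> 1"
proof (rule norm_blinfun_bound)
  fix x assume "unitary_op U"
  then have "complex_of_real ((norm (blinfun_apply U x))\<^sup>2) = of_real ((norm x)\<^sup>2)"
    unfolding cinner_self[symmetric] by (rule unitary_cinner)
  then have "(norm (blinfun_apply U x))\<^sup>2 = (norm x)\<^sup>2" by (simp only: of_real_eq_iff)
  then show "norm (blinfun_apply U x) \<le> 1 * norm x" by (simp add: power2_eq_iff_nonneg)
qed simp

lemma orthogonal_id: "orthogonal_matrix_op e id_blinfun"
  unfolding orthogonal_matrix_op_def
  by (auto intro: unitary_opI[where V=id_blinfun] simp: B_H_id entry_def e_cinner blinfun_eqI)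

text \<open>Orthonormal rows make \<open>U o\<^sub>L adj U\<close> the identity; the reverse product
  is the projection to their span, which is the identity by \<open>full\<close>. Real coordinates
  make \<open>cinner (u i) (e j)\<close> equal to its conjugate, the matrix entry.\<close>

lemma orthogonal_rows:
  assumes "\<And>i j. cinner (u i) (u j) = (if i = j then 1 else (0::complex))" "\<And>i j. cinner (u i) (e j) \<in> \<real>"
    and full: "\<And>k. blinfun_apply (opser (\<lambda>_. 1) u u) (e k) = e k"
  shows "orthogonal_matrix_op e (opser (\<lambda>_. 1) u e)" "entry e (opser (\<lambda>_. 1) u e) i j = cinner (u i) (e j)"
proof -
  have n1: "norm (u i) = 1" for i by (rule norm_eq_1I) (simp add: assms(1))
  have u: "suborth u" using assms(1) n1 by (auto simp: suborth_def)
  have one: "cmod ((\<lambda>_. 1) n) \<le> (1::real)" for n :: nat by simp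
  have ent: "entry e (opser (\<lambda>_. 1) u e) i j = cinner (u i) (e j)" for i j
  proof -
    have "entry e (opser (\<lambda>_. 1) u e) i j = cinner (e j) (u i)"
      unfolding entry_def using opser_cinner_basis[OF u e_suborth, of "\<lambda>_. 1" 1 "e j" i] by simp
    also have "\<dots> = cinner (u i) (e j)"
      using assms(2)[of i j] by (metis Reals_cnj_iff cnj_cinner)
    finally show ?thesis .
  qed
  then show "entry e (opser (\<lambda>_. 1) u e) i j = cinner (u i) (e j)" .
  have ue: "opser (\<lambda>_. 1) u e o\<^sub>L opser (\<lambda>_. 1) e u = id_blinfun"
  proof -
    have "opser (\<lambda>_. 1) u e o\<^sub>L opser (\<lambda>_. 1) e u = opser (\<lambda>_. 1 * 1) e e"
      by (rule opser_compose[OF e_suborth u e_suborth one one]) (metis n1 norm_zero zero_neq_one)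
    then show ?thesis by (simp add: opser_one_complete[OF e_suborth e_complete])
  qed
  have eu: "opser (\<lambda>_. 1) e u o\<^sub>L opser (\<lambda>_. 1) u e = id_blinfun"
  proof -
    have "opser (\<lambda>_. 1) e u o\<^sub>L opser (\<lambda>_. 1) u e = opser (\<lambda>_. 1 * 1) u u"
      by (rule opser_compose[OF u e_suborth u one one]) simp
    moreover have "opser (\<lambda>_. 1) u u = id_blinfun"
      by (rule blinfun_eq_on_basis) (use full B_H_id opser_in_B_H[OF u u one] in auto)
    ultimately show ?thesis by simp
  qed
  have "unitary_op (opser (\<lambda>_. 1) u e)"
  proof (rule unitary_opI[OF opser_in_B_H[OF u e_suborth one] opser_in_B_H[OF e_suborth u one] _ eu ue])
    fix x y
    show "cinner (blinfun_apply (opser (\<lambda>_. 1) u e) x) y = cinner x (blinfun_apply (opser (\<lambda>_. 1) e u) y)"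
      using opser_adjoint[OF u e_suborth, of "\<lambda>_. 1" 1 x y] by simp
  qed
  then show "orthogonal_matrix_op e (opser (\<lambda>_. 1) u e)"
    using assms(2) by (simp add: orthogonal_matrix_op_def ent)
qed

lemma cinner_real_coordinates:
  assumes "\<And>k. cinner x (e k) \<in> \<real>" "\<And>k. cinner y (e k) \<in> \<real>" shows "cinner x y \<in> \<real>"
proof -
  have "Im (cinner x (e k) * cinner (e k) y) = 0" for k
    using assms[of k] by (metis Reals_cnj_iff Reals_mult cnj_cinner complex_is_Real_iff)
  then have "(\<lambda>k. 0) sums Im (cinner x y)"
    using bounded_linear.sums[OF bounded_linear_Im e_parseval_cinner[of x y]] by simp
  then show ?thesis by (metis complex_is_Real_iff sums_unique2 sums_zero)
qed

text \<open>The Householder reflection along \<open>a - b\<close> exchanges \<open>a\<close> and \<open>b\<close>.\<close>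

lemma ex_reflection:
  assumes a: "norm a = 1" "\<And>k. cinner a (e k) \<in> \<real>" and b: "norm b = 1" "\<And>k. cinner b (e k) \<in> \<real>"
  shows "\<exists>R. orthogonal_matrix_op e R \<and> blinfun_apply R a = b \<and>
    (\<forall>x. cinner x a = cinner x b \<longrightarrow> blinfun_apply R x = x) \<and>
    (\<forall>x. (\<forall>k. cinner x (e k) \<in> \<real>) \<longrightarrow> (\<forall>k. cinner (blinfun_apply R x) (e k) \<in> \<real>))"
proof (cases "a = b")
  case True
  then show ?thesis using orthogonal_id by (intro exI[of _ id_blinfun]) auto
next
  case False
  define h where "h = (1 / norm (a - b)) *\<^sub>R (a - b)"
  define R where "R = id_blinfun - outer (2 *\<^sub>R h) h"
  have n: "norm (a - b) > 0" using False by simp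
  have h1: "cinner h h = 1" using n by (simp add: h_def cinner_scaleR_left cinner_scaleR_right cinner_self power2_eq_square)
  have h_real: "cinner h (e k) \<in> \<real>" for k using a b by (simp add: h_def cinner_linear)
  have R: "blinfun_apply R x = x - cinner x h *\<^sub>C (2 *\<^sub>R h)" for x by (simp add: R_def blinfun.diff_left)
  have RB: "R \<in> B_H" unfolding R_def by (intro B_H_diff B_H_id outer_in_B_H)
  have RR: "R o\<^sub>L R = id_blinfun"
    by (rule blinfun_eqI) (simp add: R cinner_linear h1 scaleR_scaleC scaleC_scaleC cvs.scale_left_diff_distrib
        flip: cvs.scale_minus_left)
  have Rsa: "cinner (blinfun_apply R x) y = cinner x (blinfun_apply R y)" for x y
    by (simp add: R cinner_linear cnj_cinner)
  have R_real: "cinner (blinfun_apply R x) (e k) \<in> \<real>" if "\<And>k. cinner x (e k) \<in> \<real>" for x k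
    using that h_real cinner_real_coordinates[of x h] by (simp add: R cinner_linear)
  have "orthogonal_matrix_op e R" unfolding orthogonal_matrix_op_def entry_def
    using unitary_opI[OF RB RB Rsa RR RR] R_real[of "e _"] by (auto simp: e_cinner)
  moreover have "blinfun_apply R a = b"
  proof -
    have ab: "cinner a b = cinner b a"
      using cinner_real_coordinates[OF a(2) b(2)] by (metis Reals_cnj_iff cnj_cinner)
    have aa: "cinner a a = 1" "cinner b b = 1" using a(1) b(1) by (simp_all add: cinner_self)
    \<comment> \<open>The vectors have norm one and a real product, so twice
      \<open>cinner a (a - b)\<close> is \<open>(norm (a - b))\<^sup>2\<close>, and the reflection
      subtracts exactly \<open>a - b\<close> from \<open>a\<close>.\<close>
    have "of_real ((norm (a - b))\<^sup>2) = cinner (a - b) (a - b)" by (simp add: cinner_self)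
    also have "\<dots> = 2 * cinner a (a - b)" by (simp add: cinner_linear aa ab)
    finally have "2 * cinner a (a - b) = of_real (norm (a - b)) * of_real (norm (a - b))"
      by (simp add: power2_eq_square)
    then have "2 * cinner a h = of_real (norm (a - b))"
      using n by (simp add: h_def cinner_scaleR_right)
    then have "cinner a h *\<^sub>C (2 *\<^sub>R h) = a - b"
      using n by (simp add: h_def scaleR_scaleC scaleC_scaleC scaleC_one mult.commute)
    then show ?thesis by (simp add: R)
  qed
  moreover have "blinfun_apply R x = x" if "cinner x a = cinner x b" for x
    using that by (simp add: R h_def cinner_linear)
  ultimately show ?thesis using R_real by blast
qed

text \<open>A reflection carrying the image of \<open>e r\<close> to \<open>c r\<close> fixes the
  earlier columns, because these are orthogonal to both vectors.\<close>

lemma ex_orthogonal_columns: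
  assumes c: "\<And>i j. i < r \<Longrightarrow> j < r \<Longrightarrow> cinner (c i) (c j) = (if i = j then 1 else 0)"
    and "\<And>j k. j < r \<Longrightarrow> cinner (c j) (e k) \<in> \<real>"
  shows "\<exists>W. orthogonal_matrix_op e W \<and> (\<forall>j<r. blinfun_apply W (e j) = c j)"
  using assms
proof (induction r)
  case 0
  then show ?case using orthogonal_id by auto
next
  case (Suc r)
  then obtain W where W: "orthogonal_matrix_op e W" "\<And>j. j < r \<Longrightarrow> blinfun_apply W (e j) = c j"
    by (metis less_Suc_eq)
  have U: "unitary_op W" and Wr: "\<And>i j. cinner (blinfun_apply W (e j)) (e i) \<in> \<real>"
    using W(1) by (auto simp: orthogonal_matrix_op_def entry_def)
  have n1: "norm (blinfun_apply W (e r)) = 1"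
    by (rule norm_eq_1I) (simp add: unitary_cinner[OF U] e_cinner)
  have n2: "norm (c r) = 1" by (rule norm_eq_1I) (simp add: Suc.prems(1))
  obtain R where R: "orthogonal_matrix_op e R" "blinfun_apply R (blinfun_apply W (e r)) = c r"
    "\<And>x. cinner x (blinfun_apply W (e r)) = cinner x (c r) \<Longrightarrow> blinfun_apply R x = x"
    "\<And>x k. (\<And>k. cinner x (e k) \<in> \<real>) \<Longrightarrow> cinner (blinfun_apply R x) (e k) \<in> \<real>"
    using ex_reflection[OF n1 Wr n2, of] Suc.prems(2) by (metis lessI)
  have UR: "unitary_op R" using R(1) by (simp add: orthogonal_matrix_op_def)
  have UB: "W \<in> B_H" "R \<in> B_H" using U UR by (auto simp: unitary_op_def)
  have "orthogonal_matrix_op e (R o\<^sub>L W)"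
    unfolding orthogonal_matrix_op_def
  proof (intro conjI allI)
    show "unitary_op (R o\<^sub>L W)"
    proof (rule unitary_opI[where V="adj W o\<^sub>L adj R"])
      show "cinner (blinfun_apply (R o\<^sub>L W) x) y = cinner x (blinfun_apply (adj W o\<^sub>L adj R) y)" for x y
        by (simp add: cinner_adj_right[OF UB(1)] cinner_adj_right[OF UB(2)])
      have "blinfun_apply (adj W) (blinfun_apply W x) = x" "blinfun_apply W (blinfun_apply (adj W) x) = x"
        "blinfun_apply (adj R) (blinfun_apply R x) = x" "blinfun_apply R (blinfun_apply (adj R) x) = x" for x
        using U UR unfolding unitary_op_def by (metis blinfun_apply_blinfun_compose id_blinfun.rep_eq id_apply)+
      then show "adj W o\<^sub>L adj R o\<^sub>L (R o\<^sub>L W) = id_blinfun" "R o\<^sub>L W o\<^sub>L (adj W o\<^sub>L adj R) = id_blinfun"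
        by (auto intro!: blinfun_eqI)
    qed (intro B_H_compose UB adj_in_B_H)+
    show "entry e (R o\<^sub>L W) i j \<in> \<real>" for i j
      using R(4)[OF Wr] by (simp add: entry_def)
  qed
  moreover have "blinfun_apply (R o\<^sub>L W) (e j) = c j" if "j < Suc r" for j
  proof (cases "j = r")
    case True then show ?thesis using R(2) by simp
  next
    case False
    then have j: "j < r" using that by simp
    have "cinner (c j) (blinfun_apply W (e r)) = 0"
      using unitary_cinner(1)[OF U, of "e j" "e r"] W(2)[OF j] j by (simp add: e_cinner)
    then have "blinfun_apply R (c j) = c j" using Suc.prems(1)[of j r] j by (intro R(3)) simp
    then show ?thesis using W(2)[OF j] by simp
  qed
  ultimately show ?case by blast
qed

lemma orthogonal_entry_sums:
  assumes "orthogonal_matrix_op e U"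
  shows "(\<lambda>l. entry e U i l * entry e U j l) sums (if i = j then 1 else 0)"
    and "(\<lambda>l. entry e U l i * entry e U l j) sums (if i = j then 1 else 0)"
proof -
  have U: "unitary_op U" "U \<in> B_H" and r: "cnj (entry e U i j) = entry e U i j" for i j
    using assms by (auto simp: orthogonal_matrix_op_def unitary_op_def Reals_cnj_iff)
  have adj_e: "cinner (blinfun_apply (adj U) (e i)) (e l) = entry e U i l" for i l
    using entry_adj[OF U(2)] r by simp
  have e_adj: "cinner (e l) (blinfun_apply (adj U) (e i)) = entry e U i l" for i l
    using adj_e[of i l] r by (metis cnj_cinner)
  show "(\<lambda>l. entry e U i l * entry e U j l) sums (if i = j then 1 else 0)"
    using e_parseval_cinner[of "blinfun_apply (adj U) (e i)" "blinfun_apply (adj U) (e j)"]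
    by (simp add: adj_e e_adj unitary_cinner(2)[OF U(1)] e_cinner)
  have Ue: "cinner (e l) (blinfun_apply U (e i)) = entry e U l i" for i l
    using r[of l i] by (metis cnj_cinner entry_def)
  show "(\<lambda>l. entry e U l i * entry e U l j) sums (if i = j then 1 else 0)"
    using e_parseval_cinner[of "blinfun_apply U (e i)" "blinfun_apply U (e j)"]
    by (simp add: Ue unitary_cinner(1)[OF U(1)] e_cinner flip: entry_def)
qed

lemma orthogonal_square_sums:
  assumes "orthogonal_matrix_op e U"
  shows "(\<lambda>l. (cmod (entry e U i l))\<^sup>2) sums 1" and "(\<lambda>l. (cmod (entry e U l i))\<^sup>2) sums 1"
proof -
  have sq: "entry e U i j * entry e U i j = of_real ((cmod (entry e U i j))\<^sup>2)" for i j
    using assms by (metis Reals_cnj_iff complex_norm_square of_real_power orthogonal_matrix_op_def)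
  have "(\<lambda>l. complex_of_real ((cmod (entry e U i l))\<^sup>2)) sums of_real 1"
    "(\<lambda>l. complex_of_real ((cmod (entry e U l i))\<^sup>2)) sums of_real 1"
    using orthogonal_entry_sums[OF assms, of i i] unfolding sq by simp_all
  then show "(\<lambda>l. (cmod (entry e U i l))\<^sup>2) sums 1" and "(\<lambda>l. (cmod (entry e U l i))\<^sup>2) sums 1"
    by (simp_all only: sums_of_real_iff)
qed

text \<open>The upper left block carries the mass \<open>N\<close> of its rows, which exhausts its columns.\<close>

lemma orthogonal_block_columns:
  assumes U: "orthogonal_matrix_op e U" and rows: "\<And>i j. i < N \<Longrightarrow> j \<ge> N \<Longrightarrow> entry e U i j = 0"
    and "i \<ge> N" "j < N"
  shows "entry e U i j = 0"
proof -
  define b where "b i j = (cmod (entry e U i j))\<^sup>2" for i j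
  have row: "(\<Sum>j<N. b i j) = 1" if "i < N" for i
  proof -
    have "(\<lambda>j. if j \<in> {..<N} then b i j else 0) = b i" using rows[OF that] by (auto simp: b_def)
    then show ?thesis
      using sums_If_finite_set[of "{..<N}" "b i"] orthogonal_square_sums(1)[OF U, of i] sums_unique2
      by (fastforce simp: b_def[abs_def])
  qed
  have col: "(\<lambda>i. b i j) sums 1" for j unfolding b_def by (rule orthogonal_square_sums(2)[OF U])
  have col_le: "(\<Sum>i\<in>F. b i j) \<le> 1" if "finite F" for F j
    using sum_le_suminf[OF sums_summable[OF col] that] sums_unique[OF col] by (simp add: b_def)
  have "(\<Sum>j<N. 1 - (\<Sum>i<N. b i j)) = 0"
    using sum.swap[of "\<lambda>i j. b i j" "{..<N}" "{..<N}"] row by (simp add: sum_subtractf)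
  then have "1 - (\<Sum>i<N. b i j) = 0"
    using col_le sum_nonneg_eq_0_iff[of "{..<N}" "\<lambda>j. 1 - (\<Sum>i<N. b i j)"] \<open>j < N\<close> by simp
  moreover have "(\<Sum>i'\<in>insert i {..<N}. b i' j) \<le> 1" by (rule col_le) simp
  ultimately have "b i j \<le> 0" using \<open>i \<ge> N\<close> by simp
  then show ?thesis by (simp add: b_def)
qed

text \<open>Zeros to the right of each \<open>m k\<close> force zeros below, so a comparison at both
  ends of a block isolates it. The relations of the finite blocks are those of the whole matrix with
  vanishing terms removed.\<close>

lemma direct_sum_of_orthogonal:
  fixes m :: "nat \<Rightarrow> nat"
  assumes U: "orthogonal_matrix_op e U" and m: "strict_mono m" "m 0 = 0"
    and rows: "\<And>k i j. i < m k \<Longrightarrow> j \<ge> m k \<Longrightarrow> entry e U i j = 0"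
  shows "direct_sum_finite_orthogonal e U"
proof -
  have UB: "U \<in> B_H" using U by (simp add: orthogonal_matrix_op_def unitary_op_def)
  have off: "entry e U i j = 0 \<and> entry e U j i = 0"
    if "i \<in> {m k..<m (Suc k)}" "j \<notin> {m k..<m (Suc k)}" for i j k
  proof (cases "j < m k")
    case True
    then show ?thesis using that rows[of j k i] orthogonal_block_columns[where N="m k" and i=i and j=j, OF U rows] by auto
  next
    case False
    then have "j \<ge> m (Suc k)" "i < m (Suc k)" using that by auto
    then show ?thesis using rows[of i "Suc k" j] orthogonal_block_columns[where N="m (Suc k)" and i=j and j=i, OF U rows] by auto
  qed
  have fin: "finite_orthogonal_matrix {m k..<m (Suc k)} (entry e U)" for k
    unfolding finite_orthogonal_matrix_def
  proof (intro conjI ballI)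
    let ?B = "{m k..<m (Suc k)}"
    fix i j assume i: "i \<in> ?B" and j: "j \<in> ?B"
    show "entry e U i j \<in> \<real>" using U by (simp add: orthogonal_matrix_op_def)
    have "(\<lambda>l. if l \<in> ?B then entry e U i l * entry e U j l else 0) = (\<lambda>l. entry e U i l * entry e U j l)"
      using off[OF i] by auto
    then have "(\<lambda>l. entry e U i l * entry e U j l) sums (\<Sum>l\<in>?B. entry e U i l * entry e U j l)"
      using sums_If_finite_set[of ?B "\<lambda>l. entry e U i l * entry e U j l"] by simp
    then show "(\<Sum>l\<in>?B. entry e U i l * entry e U j l) = (if i = j then 1 else 0)"
      using orthogonal_entry_sums(1)[OF U] by (rule sums_unique2)
    have "(\<lambda>l. if l \<in> ?B then entry e U l i * entry e U l j else 0) = (\<lambda>l. entry e U l i * entry e U l j)"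
      using off[OF i] by auto
    then have "(\<lambda>l. entry e U l i * entry e U l j) sums (\<Sum>l\<in>?B. entry e U l i * entry e U l j)"
      using sums_If_finite_set[of ?B "\<lambda>l. entry e U l i * entry e U l j"] by simp
    then show "(\<Sum>l\<in>?B. entry e U l i * entry e U l j) = (if i = j then 1 else 0)"
      using orthogonal_entry_sums(2)[OF U] by (rule sums_unique2)
  qed simp
  show ?thesis
    unfolding direct_sum_finite_orthogonal_def using off
    by (intro conjI exI[of _ m] allI ballI impI UB m fin) blast
qed

text \<open>The clause on zeros assumes all entries of \<eta> positive: completing finitely many
  columns to an orthogonal matrix may spoil the zeros of the rows.\<close>

lemma ex_orthogonal_matrix:
  fixes \<xi> \<eta> :: "nat \<Rightarrow> real"
  assumes \<xi>: "\<xi> \<in> c0_star" "\<And>n. \<xi> n > 0" and \<eta>: "\<eta> \<in> c0_star" and maj: "\<xi> \<preceq> \<eta>"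
  shows "\<exists>U. orthogonal_matrix_op e U \<and> (\<forall>i. (\<lambda>j. \<eta> j * (cmod (entry e U i j))\<^sup>2) sums \<xi> i) \<and>
    ((\<forall>n. \<eta> n > 0) \<longrightarrow> (\<forall>N. (\<Sum>j<N. \<xi> j) = (\<Sum>j<N. \<eta> j) \<longrightarrow> (\<forall>i<N. \<forall>j\<ge>N. entry e U i j = 0)))"
proof -
  have maj': "\<xi> \<prec> \<eta>" using maj by (simp add: strongly_majorized_def)
  from ex_orthonormal_rows[OF \<xi> \<eta> maj'] obtain u :: "nat \<Rightarrow> 'h" where
    ortho: "\<forall>i j. cinner (u i) (u j) = (if i = j then 1 else 0)" and real: "\<forall>i j. cinner (u i) (e j) \<in> \<real>"
    and sums: "\<forall>i. (\<lambda>j. \<eta> j * (cmod (cinner (u i) (e j)))\<^sup>2) sums \<xi> i"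
    and touch: "\<forall>N. (\<Sum>j<N. \<xi> j) = (\<Sum>j<N. \<eta> j) \<longrightarrow> (\<forall>i<N. \<forall>j\<ge>N. cinner (u i) (e j) = 0)"
    by (elim exE conjE)
  note ortho = ortho[rule_format] and real = real[rule_format] and sums = sums[rule_format]
  have n1: "norm (u i) = 1" for i by (rule norm_eq_1I) (simp add: ortho)
  have u: "suborth u" using ortho n1 by (auto simp: suborth_def)
  have full: "blinfun_apply (opser (\<lambda>_. 1) u u) (e k) = e k" if "\<eta> k > 0" for k
    by (rule column_full[OF \<eta> maj u n1 sums that])
  show ?thesis
  proof (cases "\<forall>n. \<eta> n > 0")
    case True
    then have full': "\<And>k. blinfun_apply (opser (\<lambda>_. 1) u u) (e k) = e k" using full by blast
    show ?thesis
      using orthogonal_rows[OF ortho real full'] sums touch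
      by (intro exI[of _ "opser (\<lambda>_. 1) u e"]) simp
  next
    case False
    define r where "r = (LEAST n. \<not> \<eta> n > 0)"
    have pos: "\<eta> n > 0" if "n < r" for n using not_less_Least[OF that[unfolded r_def]] by simp
    have "\<not> \<eta> r > 0" unfolding r_def by (rule LeastI_ex) (use False in blast)
    then have zero: "\<eta> n = 0" if "n \<ge> r" for n
      using c0_star_antimono[OF \<eta> that] c0_star_nonneg[OF \<eta>, of n] by linarith
    let ?V = "opser (\<lambda>_. 1) u e"
    have V: "cinner (blinfun_apply ?V (e j)) (e i) = cinner (e j) (u i)" for i j
      using opser_cinner_basis[OF u e_suborth, of "\<lambda>_. 1" 1 "e j" i] by simp
    have V': "cinner (blinfun_apply ?V (e j)) (e i) = cinner (u i) (e j)" for i j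
      unfolding V using real[of i j] by (metis Reals_cnj_iff cnj_cinner)
    \<comment> \<open>Products of columns are entries of the projection to the span of the rows,
      which fixes \<open>e i\<close> for \<open>i < r\<close>.\<close>
    have V2: "cinner (blinfun_apply ?V (e i)) (blinfun_apply ?V (e j)) = (if i = j then 1 else 0)"
      if "i < r" for i j
    proof -
      have "(\<lambda>l. cinner (e i) (u l) * cinner (u l) (e j)) sums cinner (blinfun_apply ?V (e i)) (blinfun_apply ?V (e j))"
        using e_parseval_cinner[of "blinfun_apply ?V (e i)" "blinfun_apply ?V (e j)"]
        unfolding V using V[of j] by (metis (no_types, lifting) V cnj_cinner sums_cong)
      moreover have "(\<lambda>l. cinner (e i) (u l) * cinner (u l) (e j)) sums cinner (blinfun_apply (opser (\<lambda>_. 1) u u) (e i)) (e j)"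
        using opser_cinner_sums[OF u u, of "\<lambda>_. 1" 1 "e i" "e j"] by simp
      ultimately show ?thesis using full[OF pos[OF that]] sums_unique2 by (fastforce simp: e_cinner)
    qed
    obtain W where W: "orthogonal_matrix_op e W" "\<And>j. j < r \<Longrightarrow> blinfun_apply W (e j) = blinfun_apply ?V (e j)"
      using ex_orthogonal_columns[of r "\<lambda>j. blinfun_apply ?V (e j)"] V2 V' real by auto
    \<comment> \<open>The columns from \<open>r\<close> on may differ, but there \<eta>
      vanishes.\<close>
    have "(\<lambda>j. \<eta> j * (cmod (entry e W i j))\<^sup>2) = (\<lambda>j. \<eta> j * (cmod (cinner (u i) (e j)))\<^sup>2)" for i
    proof
      fix j show "\<eta> j * (cmod (entry e W i j))\<^sup>2 = \<eta> j * (cmod (cinner (u i) (e j)))\<^sup>2"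
        using W(2)[of j] zero[of j] V'[of j i] by (cases "j < r") (auto simp: entry_def)
    qed
    then show ?thesis using W(1) sums False by (intro exI[of _ W]) auto
  qed
qed

end

section \<open>Equivalence of the conditions\<close>

text \<open>Membership in the am-closure asks for the means to lie in a characteristic set, which
  consists of such sequences.\<close>

lemma arith_mean_c0_star:
  assumes \<xi>: "\<xi> \<in> c0_star" shows "arith_mean \<xi> \<in> c0_star"
proof -
  have nn: "0 \<le> arith_mean \<xi> n" for n
    unfolding arith_mean_def by (intro divide_nonneg_nonneg sum_nonneg) (simp_all add: c0_star_nonneg[OF \<xi>])
  have "arith_mean \<xi> (Suc n) \<le> arith_mean \<xi> n" for n
  proof -
    have "(\<Sum>j\<le>n. \<xi> (Suc n)) \<le> (\<Sum>j\<le>n. \<xi> j)" by (intro sum_mono c0_star_antimono[OF \<xi>]) auto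
    then show ?thesis by (simp add: arith_mean_def field_simps)
  qed
  then have "decseq (arith_mean \<xi>)" by (rule decseq_SucI)
  moreover have "arith_mean \<xi> \<longlonglongrightarrow> 0"
  proof (rule LIMSEQ_I)
    fix r :: real assume r: "r > 0"
    obtain N where N: "\<And>n. n \<ge> N \<Longrightarrow> \<xi> n < r / 2"
      using order_tendstoD(2)[OF c0_star_lim[OF \<xi>], of "r / 2"] r by (auto simp: eventually_sequentially)
    define C where "C = (\<Sum>j<N. \<xi> j)"
    have C: "0 \<le> C" unfolding C_def by (intro sum_nonneg c0_star_nonneg \<xi>)
    \<comment> \<open>From \<open>K\<close> on the first \<open>N\<close> entries contribute less
      than \<open>r / 2\<close> to the mean, and so do the later ones, each below
      \<open>r / 2\<close>.\<close>
    obtain K :: nat where K: "C / (r / 2) < real K" using reals_Archimedean2 by blast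
    show "\<exists>n0. \<forall>n\<ge>n0. norm (arith_mean \<xi> n - 0) < r"
    proof (intro exI allI impI)
      fix n assume n: "n \<ge> K"
      have "(\<Sum>j\<le>n. \<xi> j) \<le> (\<Sum>j\<le>n. (if j < N then \<xi> j else 0) + r / 2)"
        using N r c0_star_nonneg[OF \<xi>] by (intro sum_mono) (auto simp: not_less intro: less_imp_le)
      also have "\<dots> = (\<Sum>j\<in>{..n} \<inter> {..<N}. \<xi> j) + real (Suc n) * (r / 2)"
        by (simp add: sum.distrib sum.inter_restrict lessThan_def)
      also have "\<dots> \<le> C + real (Suc n) * (r / 2)"
        unfolding C_def using c0_star_nonneg[OF \<xi>] by (intro add_right_mono sum_mono2) auto
      also have "C < real K * (r / 2)" using K r by (simp only: pos_divide_less_eq half_gt_zero)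
      also have "real K * (r / 2) \<le> real (Suc n) * (r / 2)" using n r by (intro mult_right_mono) auto
      finally have "(\<Sum>j\<le>n. \<xi> j) < real (Suc n) * r" by (simp add: field_simps)
      then have "arith_mean \<xi> n < r" by (simp add: arith_mean_def pos_divide_less_eq mult.commute del: of_nat_Suc)
      then show "norm (arith_mean \<xi> n - 0) < r" using nn by simp
    qed
  qed
  ultimately show ?thesis using nn by (simp add: c0_star_def)
qed

lemma substochastic_majorized:
  fixes \<eta> :: "nat \<Rightarrow> real"
  assumes P: "substochastic P" and \<eta>: "\<eta> \<in> c0_star"
  shows "mat_apply P \<eta> \<prec> \<eta>"
  unfolding majorized_def
proof
  fix n
  have P0: "0 \<le> P i j" and row: "summable (P i)" "suminf (P i) \<le> 1"
    and col: "summable (\<lambda>i. P i j)" "(\<Sum>i. P i j) \<le> 1" for i j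
    using P by (auto simp: substochastic_def)
  \<comment> \<open>Bounded by 1 through the columns of \<open>P\<close>, with total at most
    \<open>n\<close> through its rows.\<close>
  define c where "c j = (\<Sum>i<n. P i j)" for j
  have "(\<Sum>i<n. mat_apply P \<eta> i) = (\<Sum>j. \<Sum>i<n. P i j * \<eta> j)"
    unfolding mat_apply_def
    by (intro suminf_sum[symmetric] weighted_sum_summable c0_star_decseq c0_star_nonneg \<eta> P0 row)
  also have "\<dots> = (\<Sum>j. c j * \<eta> j)" by (simp add: c_def sum_distrib_right)
  also have "\<dots> \<le> (\<Sum>j<n. \<eta> j)"
  proof (rule weighted_sum_le)
    show "decseq \<eta>" "\<And>n. 0 \<le> \<eta> n" using \<eta> by (auto simp: c0_star_def)
    show "0 \<le> c j" for j unfolding c_def by (intro sum_nonneg P0)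
    show "c j \<le> 1" for j
      using sum_le_suminf[OF col(1), of "{..<n}" j] P0 col(2)[of j] by (simp add: c_def)
    show "summable c" unfolding c_def by (intro summable_sum row)
    have "suminf c = (\<Sum>i<n. suminf (P i))" unfolding c_def by (intro suminf_sum row)
    also have "\<dots> \<le> (\<Sum>i<n. 1)" by (intro sum_mono row)
    finally show "suminf c \<le> real n" by simp
  qed
  finally show "sum (mat_apply P \<eta>) {..<n} \<le> sum \<eta> {..<n}" .
qed

lemma Reals_cmod_square: "z \<in> \<real> \<Longrightarrow> complex_of_real ((cmod z)\<^sup>2) = z\<^sup>2"
  by (metis Reals_cnj_iff complex_norm_square of_real_power power2_eq_square)

lemma strict_mono_block:
  fixes m :: "nat \<Rightarrow> nat"
  assumes "strict_mono m" "m 0 = 0"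
  obtains k where "i \<in> {m k..<m (Suc k)}"
proof -
  define k where "k = (LEAST k. i < m (Suc k))"
  have "i < m (Suc i)" using strict_mono_imp_increasing[OF assms(1), of "Suc i"] by simp
  then have 1: "i < m (Suc k)" unfolding k_def by (rule LeastI)
  have "m k \<le> i"
    using not_less_Least[of "k - 1" "\<lambda>k. i < m (Suc k)"] assms(2) by (cases k) (auto simp: k_def[symmetric])
  with 1 show ?thesis by (intro that) simp
qed

section \<open>From matrices and conditional expectations to weighted sums\<close>

context onb
begin

text \<open>With \<open>x = adj A (e i)\<close> the diagonal entry is the quadratic form of the
  diagonal operator at \<open>x\<close>, whose coordinates have the moduli of row \<open>i\<close>
  of \<open>A\<close>.\<close>

lemma entry_conjugated_diag:
  fixes A :: "'h \<Rightarrow>\<^sub>L 'h"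
  assumes A: "A \<in> B_H" and \<eta>: "\<eta> \<in> c0_star"
  shows "\<exists>r. entry e (A o\<^sub>L diag_real e \<eta> o\<^sub>L adj A) i i = complex_of_real r \<and>
    (\<lambda>j. \<eta> j * (cmod (entry e A i j))\<^sup>2) sums r"
proof -
  define x where "x = blinfun_apply (adj A) (e i)"
  have sq: "(cmod (cinner x (e j)))\<^sup>2 = (cmod (entry e A i j))\<^sup>2" for j by (simp add: x_def entry_adj[OF A])
  have "(\<lambda>j. complex_of_real (\<eta> j) * cinner x (e j) * cinner (e j) x) sums
      cinner (blinfun_apply (diag_real e \<eta>) x) x"
    unfolding diag_eq_opser
    by (rule opser_cinner_sums[OF e_suborth e_suborth c0_star_cmod_le[OF \<eta>]])
  then have 1: "(\<lambda>j. complex_of_real (\<eta> j * (cmod (entry e A i j))\<^sup>2)) sums cinner (blinfun_apply (diag_real e \<eta>) x) x"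
    unfolding mult.assoc cinner_mult_commute sq of_real_mult .
  have 2: "(\<lambda>j. \<eta> j * (cmod (entry e A i j))\<^sup>2) sums Re (cinner (blinfun_apply (diag_real e \<eta>) x) x)"
    using diag_cinner_sums[OF \<eta>, of x] by (simp add: sq)
  then have "(\<lambda>j. complex_of_real (\<eta> j * (cmod (entry e A i j))\<^sup>2)) sums
      complex_of_real (Re (cinner (blinfun_apply (diag_real e \<eta>) x) x))" by (simp only: sums_of_real_iff)
  with 1 have "cinner (blinfun_apply (diag_real e \<eta>) x) x = complex_of_real (Re (cinner (blinfun_apply (diag_real e \<eta>) x) x))"
    by (rule sums_unique2)
  moreover have "entry e (A o\<^sub>L diag_real e \<eta> o\<^sub>L adj A) i i = cinner (blinfun_apply (diag_real e \<eta>) x) x"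
    by (simp add: entry_def x_def cinner_adj_right[OF A])
  ultimately show ?thesis using 2 by metis
qed

lemma diag_inject:
  assumes "diag e a = diag e b" "\<And>n. cmod (a n) \<le> M" "\<And>n. cmod (b n) \<le> K"
  shows "a n = b n"
  using opser_cinner_basis[OF e_suborth e_suborth, of a M "e n" n, OF assms(2)]
    opser_cinner_basis[OF e_suborth e_suborth, of b K "e n" n, OF assms(3)] assms(1)
  by (simp add: diag_eq_opser e_cinner)

lemma entry_bound: "cmod (entry e A i j) \<le> norm A"
  using cinner_Cauchy_Schwarz[of "blinfun_apply A (e j)" "e i"] norm_blinfun[of A "e j"]
  by (simp add: entry_def)

text \<open>Conditions on diagonals become conditions on the matrix of squared moduli. Comparing
  diagonals is legitimate because both sequences are bounded.\<close>

lemma diag_eq_cond_exp_iff: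
  fixes A :: "'h \<Rightarrow>\<^sub>L 'h"
  assumes A: "A \<in> B_H" and \<eta>: "\<eta> \<in> c0_star" and \<xi>: "\<xi> \<in> c0_star"
  shows "diag_real e \<xi> = cond_exp e (A o\<^sub>L diag_real e \<eta> o\<^sub>L adj A) \<longleftrightarrow>
    (\<forall>i. (\<lambda>j. \<eta> j * (cmod (entry e A i j))\<^sup>2) sums \<xi> i)"
proof
  assume eq: "diag_real e \<xi> = cond_exp e (A o\<^sub>L diag_real e \<eta> o\<^sub>L adj A)"
  show "\<forall>i. (\<lambda>j. \<eta> j * (cmod (entry e A i j))\<^sup>2) sums \<xi> i"
  proof
    fix i
    obtain r where r: "entry e (A o\<^sub>L diag_real e \<eta> o\<^sub>L adj A) i i = complex_of_real r"
      "(\<lambda>j. \<eta> j * (cmod (entry e A i j))\<^sup>2) sums r"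
      using entry_conjugated_diag[OF A \<eta>] by blast
    have "complex_of_real (\<xi> i) = entry e (A o\<^sub>L diag_real e \<eta> o\<^sub>L adj A) i i"
      by (rule diag_inject[OF eq[unfolded cond_exp_def] c0_star_cmod_le[OF \<xi>] entry_bound])
    then have "\<xi> i = r" using r(1) by simp
    then show "(\<lambda>j. \<eta> j * (cmod (entry e A i j))\<^sup>2) sums \<xi> i" using r(2) by simp
  qed
next
  assume s: "\<forall>i. (\<lambda>j. \<eta> j * (cmod (entry e A i j))\<^sup>2) sums \<xi> i"
  have "entry e (A o\<^sub>L diag_real e \<eta> o\<^sub>L adj A) i i = complex_of_real (\<xi> i)" for i
    using entry_conjugated_diag[OF A \<eta>, of i] s sums_unique2 by metis
  then show "diag_real e \<xi> = cond_exp e (A o\<^sub>L diag_real e \<eta> o\<^sub>L adj A)"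
    by (simp add: cond_exp_def)
qed

lemma contraction_substochastic:
  fixes L :: "'h \<Rightarrow>\<^sub>L 'h"
  assumes L: "L \<in> B_H" "norm L \<le> 1"
  shows "substochastic (\<lambda>i j. (cmod (entry e L i j))\<^sup>2)"
proof -
  have "(\<lambda>j. (cmod (entry e L i j))\<^sup>2) sums (norm (blinfun_apply (adj L) (e i)))\<^sup>2" for i
    using e_parseval[of "blinfun_apply (adj L) (e i)"] by (simp add: entry_adj[OF L(1)])
  moreover have "(norm (blinfun_apply (adj L) (e i)))\<^sup>2 \<le> 1" for i
    using norm_adj_apply[OF L(1), of "e i"] L(2) by (simp add: power_le_one)
  moreover have "(\<lambda>i. (cmod (entry e L i j))\<^sup>2) sums (norm (blinfun_apply L (e j)))\<^sup>2" for j
    using e_parseval[of "blinfun_apply L (e j)"] by (simp add: entry_def)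
  moreover have "(norm (blinfun_apply L (e j)))\<^sup>2 \<le> 1" for j
    using norm_blinfun[of L "e j"] L(2) by (simp add: power_le_one)
  ultimately show ?thesis unfolding substochastic_def by (auto simp: sums_iff)
qed

text \<open>The blocks give row and column sums of squares equal to 1 directly, without a detour
  through unitary operators.\<close>

lemma direct_sum_entries:
  assumes "direct_sum_finite_orthogonal e U"
  shows "entry e U i j \<in> \<real>" and "substochastic (\<lambda>i j. (cmod (entry e U i j))\<^sup>2)"
proof -
  obtain m where m: "strict_mono m" "m 0 = 0"
    and fin: "\<And>k. finite_orthogonal_matrix {m k..<m (Suc k)} (entry e U)"
    and off: "\<And>k i j. i \<in> {m k..<m (Suc k)} \<Longrightarrow> j \<notin> {m k..<m (Suc k)} \<Longrightarrow> entry e U i j = 0"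
    using assms unfolding direct_sum_finite_orthogonal_def by metis
  have real: "entry e U i j \<in> \<real>" for i j
  proof -
    obtain k where i: "i \<in> {m k..<m (Suc k)}" by (rule strict_mono_block[OF m])
    show ?thesis
      using fin[of k] off[OF i, of j] i by (cases "j \<in> {m k..<m (Suc k)}") (auto simp: finite_orthogonal_matrix_def)
  qed
  then show "entry e U i j \<in> \<real>" .
  have sq: "complex_of_real ((cmod (entry e U i j))\<^sup>2) = entry e U i j * entry e U i j" for i j
    using Reals_cmod_square[OF real] by (simp add: power2_eq_square)
  \<comment> \<open>The definition gives zeros along rows only; along a column they follow because
    different blocks are disjoint.\<close>
  have off': "entry e U i j = 0" if j: "j \<in> {m k..<m (Suc k)}" and i: "i \<notin> {m k..<m (Suc k)}" for i j k
  proof -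
    obtain k' where k': "i \<in> {m k'..<m (Suc k')}" by (rule strict_mono_block[OF m])
    have "j \<notin> {m k'..<m (Suc k')}"
    proof
      assume j': "j \<in> {m k'..<m (Suc k')}"
      have "\<not> k < k'" "\<not> k' < k"
        using j j' strict_mono_leD[OF m(1), of "Suc k" k'] strict_mono_leD[OF m(1), of "Suc k'" k] by auto
      then show False using i k' by simp
    qed
    then show ?thesis by (rule off[OF k'])
  qed
  have row: "(\<lambda>j. (cmod (entry e U i j))\<^sup>2) sums 1" for i
  proof -
    obtain k where i: "i \<in> {m k..<m (Suc k)}" by (rule strict_mono_block[OF m])
    let ?B = "{m k..<m (Suc k)}"
    have "complex_of_real (\<Sum>j\<in>?B. (cmod (entry e U i j))\<^sup>2) = of_real 1"
      unfolding of_real_sum sq using fin[of k] i by (simp add: finite_orthogonal_matrix_def)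
    then have "(\<Sum>j\<in>?B. (cmod (entry e U i j))\<^sup>2) = 1" by (simp only: of_real_eq_iff)
    moreover have "(\<lambda>j. if j \<in> ?B then (cmod (entry e U i j))\<^sup>2 else 0) = (\<lambda>j. (cmod (entry e U i j))\<^sup>2)"
      using off[OF i] by auto
    ultimately show ?thesis using sums_If_finite_set[of ?B "\<lambda>j. (cmod (entry e U i j))\<^sup>2"] by simp
  qed
  have col: "(\<lambda>i. (cmod (entry e U i j))\<^sup>2) sums 1" for j
  proof -
    obtain k where j: "j \<in> {m k..<m (Suc k)}" by (rule strict_mono_block[OF m])
    let ?B = "{m k..<m (Suc k)}"
    have "complex_of_real (\<Sum>i\<in>?B. (cmod (entry e U i j))\<^sup>2) = of_real 1"
      unfolding of_real_sum sq using fin[of k] j by (simp add: finite_orthogonal_matrix_def)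
    then have "(\<Sum>i\<in>?B. (cmod (entry e U i j))\<^sup>2) = 1" by (simp only: of_real_eq_iff)
    moreover have "(\<lambda>i. if i \<in> ?B then (cmod (entry e U i j))\<^sup>2 else 0) = (\<lambda>i. (cmod (entry e U i j))\<^sup>2)"
      using off'[OF j] by auto
    ultimately show ?thesis using sums_If_finite_set[of ?B "\<lambda>i. (cmod (entry e U i j))\<^sup>2"] by simp
  qed
  show "substochastic (\<lambda>i j. (cmod (entry e U i j))\<^sup>2)"
    unfolding substochastic_def using row col by (auto simp: sums_iff)
qed

lemma identity_sums:
  "(\<lambda>j. \<xi> j * (cmod (entry e id_blinfun i j))\<^sup>2) sums \<xi> i"
proof -
  have "(\<lambda>j. \<xi> j * (cmod (entry e id_blinfun i j))\<^sup>2) = (\<lambda>j. if j = i then \<xi> j else 0)"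
    by (auto simp: entry_def e_cinner)
  then show ?thesis using sums_single[of i \<xi>] by simp
qed

lemma mat_apply_squares:
  assumes "\<And>i. (\<lambda>j. \<eta> j * (cmod (entry e U i j))\<^sup>2) sums \<xi> i"
  shows "\<xi> = mat_apply (\<lambda>i j. (cmod (entry e U i j))\<^sup>2) \<eta>"
  using assms by (auto simp: mat_apply_def fun_eq_iff mult.commute sums_iff)

lemma squares_eq:
  assumes "\<And>i j. entry e U i j \<in> \<real>" "\<And>i j. complex_of_real (Q i j) = (entry e U i j)\<^sup>2"
  shows "Q = (\<lambda>i j. (cmod (entry e U i j))\<^sup>2)"
proof (intro ext)
  fix i j
  have "complex_of_real (Q i j) = complex_of_real ((cmod (entry e U i j))\<^sup>2)"
    using assms Reals_cmod_square by metis
  then show "Q i j = (cmod (entry e U i j))\<^sup>2" by (simp only: of_real_eq_iff)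
qed

context
  fixes I :: "('h \<Rightarrow>\<^sub>L 'h) set"
  assumes I: "proper_ideal I"
begin

lemma char_set_am_closure_iff:
  fixes \<xi> :: "nat \<Rightarrow> real"
  assumes \<xi>: "\<xi> \<in> c0_star"
  shows "\<xi> \<in> char_set (am_closure I) \<longleftrightarrow> (\<exists>\<eta>\<in>char_set I. \<xi> \<prec> \<eta>)"
proof -
  have "\<xi> \<in> char_set (am_closure I) \<longleftrightarrow> (\<exists>\<eta>\<in>char_set I. \<exists>M. \<forall>n. arith_mean \<xi> n \<le> M * arith_mean \<eta> n)"
    using \<xi> arith_mean_c0_star[OF \<xi>]
    by (simp add: am_closure_def pre_am_def am_def char_set_ideal_of_char_set)
  also have "\<dots> \<longleftrightarrow> (\<exists>\<eta>\<in>char_set I. \<xi> \<prec> \<eta>)"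
  proof
    assume "\<exists>\<eta>\<in>char_set I. \<exists>M. \<forall>n. arith_mean \<xi> n \<le> M * arith_mean \<eta> n"
    then obtain \<eta> M where \<eta>: "\<eta> \<in> char_set I" and M: "\<And>n. arith_mean \<xi> n \<le> M * arith_mean \<eta> n" by blast
    have \<eta>0: "0 \<le> \<eta> n" for n using \<eta> c0_star_nonneg by (simp add: char_set_iff[OF I])
    \<comment> \<open>\<open>M\<close> may be negative, but a characteristic set is closed under
      nonnegative factors only.\<close>
    have "\<xi> \<prec> (\<lambda>n. max 0 M * \<eta> n)" unfolding majorized_def
    proof
      fix n show "(\<Sum>j<n. \<xi> j) \<le> (\<Sum>j<n. max 0 M * \<eta> j)"
      proof (cases n)
        case (Suc k)
        have "(\<Sum>j\<le>k. \<xi> j) \<le> M * (\<Sum>j\<le>k. \<eta> j)"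
          using M[of k] by (simp add: arith_mean_def divide_le_cancel del: of_nat_Suc)
        also have "\<dots> \<le> max 0 M * (\<Sum>j\<le>k. \<eta> j)" by (intro mult_right_mono sum_nonneg \<eta>0) simp
        finally show ?thesis by (simp add: Suc lessThan_Suc_atMost sum_distrib_left)
      qed simp
    qed
    then show "\<exists>\<eta>\<in>char_set I. \<xi> \<prec> \<eta>" using char_set_scale[OF I \<eta>, of "max 0 M"] by auto
  next
    assume "\<exists>\<eta>\<in>char_set I. \<xi> \<prec> \<eta>"
    then obtain \<eta> where \<eta>: "\<eta> \<in> char_set I" "\<xi> \<prec> \<eta>" by blast
    have "arith_mean \<xi> n \<le> 1 * arith_mean \<eta> n" for n
      using \<eta>(2)[unfolded majorized_def, rule_format, of "Suc n"]
      by (simp add: arith_mean_def lessThan_Suc_atMost divide_right_mono)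
    then show "\<exists>\<eta>\<in>char_set I. \<exists>M. \<forall>n. arith_mean \<xi> n \<le> M * arith_mean \<eta> n" using \<eta>(1) by blast
  qed
  finally show ?thesis .
qed

text \<open>For \<xi> = 0 solidity suffices, which also covers the zero ideal; otherwise
  \<open>\<eta> 0 \<ge> \<xi> 0 > 0\<close> shows the ideal to be nonzero, and it contains all
  finite diagonals.\<close>

lemma char_set_if_finite_support:
  fixes \<xi> \<eta> :: "nat \<Rightarrow> real"
  assumes \<xi>: "\<xi> \<in> c0_star" "\<not> (\<forall>n. \<xi> n > 0)" and \<eta>: "\<eta> \<in> char_set I" "\<xi> \<prec> \<eta>"
  shows "\<xi> \<in> char_set I"
proof -
  obtain N where "\<xi> N \<le> 0" using \<xi>(2) by (auto simp: not_less)
  then have z: "\<xi> n = 0" if "n \<ge> N" for n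
    using c0_star_antimono[OF \<xi>(1) that] c0_star_nonneg[OF \<xi>(1), of n] by linarith
  show ?thesis
  proof (cases "\<xi> 0 = 0")
    case True
    then have "\<xi> n = 0" for n
      using c0_star_antimono[OF \<xi>(1), of 0 n] c0_star_nonneg[OF \<xi>(1), of n] by simp
    then show ?thesis
      using char_set_solid[OF I \<eta>(1) \<xi>(1)] \<eta>(1) c0_star_nonneg by (simp add: char_set_iff[OF I])
  next
    case False
    then have "\<eta> 0 > 0"
      using \<eta>(2)[unfolded majorized_def, rule_format, of 1] c0_star_nonneg[OF \<xi>(1), of 0] by simp
    then show ?thesis using char_set_finite_support[OF I \<eta>(1) _ \<xi>(1) z] by blast
  qed
qed

lemma ex_orthogonal_in_ideal:
  fixes \<xi> :: "nat \<Rightarrow> real"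
  assumes \<xi>: "\<xi> \<in> c0_star" and "\<exists>\<eta>\<in>char_set I. \<xi> \<preceq> \<eta>"
  shows "\<exists>\<eta>\<in>char_set I. \<exists>U. orthogonal_matrix_op e U \<and> (\<forall>i. (\<lambda>j. \<eta> j * (cmod (entry e U i j))\<^sup>2) sums \<xi> i)"
proof -
  obtain \<eta> where \<eta>: "\<eta> \<in> char_set I" "\<xi> \<preceq> \<eta>" using assms(2) by blast
  show ?thesis
  proof (cases "\<forall>n. \<xi> n > 0")
    case True
    have "\<eta> \<in> c0_star" using \<eta>(1) by (simp add: char_set_iff[OF I])
    from ex_orthogonal_matrix[OF \<xi> True[rule_format] this \<eta>(2)] show ?thesis using \<eta>(1) by blast
  next
    case False
    have "\<xi> \<in> char_set I"
      by (rule char_set_if_finite_support[OF \<xi> False \<eta>(1)]) (use \<eta>(2) in \<open>simp add: strongly_majorized_def\<close>)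
    then show ?thesis using orthogonal_id identity_sums by blast
  qed
qed

lemma ex_direct_sum_in_ideal:
  fixes \<xi> :: "nat \<Rightarrow> real"
  assumes \<xi>: "\<xi> \<in> c0_star" and "\<exists>\<eta>\<in>char_set I. \<xi> \<prec>\<^sub>b \<eta>"
  shows "\<exists>\<eta>\<in>char_set I. \<exists>U. direct_sum_finite_orthogonal e U \<and> (\<forall>i. (\<lambda>j. \<eta> j * (cmod (entry e U i j))\<^sup>2) sums \<xi> i)"
proof -
  obtain \<eta> where \<eta>: "\<eta> \<in> char_set I" "\<xi> \<prec>\<^sub>b \<eta>" using assms(2) by blast
  then have maj: "\<xi> \<prec> \<eta>" by (simp add: block_majorized_def)
  have \<eta>c: "\<eta> \<in> c0_star" using \<eta>(1) by (simp add: char_set_iff[OF I])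
  from \<eta>(2) obtain n :: "nat \<Rightarrow> nat" where n: "strict_mono n" "\<forall>k. 0 < n k" "\<forall>k. (\<Sum>j<n k. \<xi> j) = (\<Sum>j<n k. \<eta> j)"
    unfolding block_majorized_def by (elim conjE exE)
  note n = n(1) n(2,3)[rule_format]
  show ?thesis
  proof (cases "\<forall>n. \<xi> n > 0")
    case True
    have "\<xi> \<preceq> \<eta>" unfolding strongly_majorized_iff
    proof (intro conjI maj allI impI)
      fix \<delta> :: real and N assume "\<delta> > 0"
      then show "\<exists>k\<ge>N. (\<Sum>j<k. \<eta> j) - (\<Sum>j<k. \<xi> j) < \<delta>"
        using n(3)[of N] strict_mono_imp_increasing[OF n(1), of N] by (intro exI[of _ "n N"]) simp
    qed
    \<comment> \<open>If \<eta> vanished from \<open>k\<close> on, its sums would agree at two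
      contact points past \<open>k\<close>, while those of the positive \<xi> differ.\<close>
    moreover have "\<eta> k > 0" for k
    proof (rule ccontr)
      assume "\<not> \<eta> k > 0"
      then have z: "\<eta> i = 0" if "i \<ge> k" for i
        using c0_star_antimono[OF \<eta>c that] c0_star_nonneg[OF \<eta>c, of i] by linarith
      have k: "k \<le> n k" by (rule strict_mono_imp_increasing[OF n(1)])
      have lt: "n k < n (Suc k)" using n(1) by (simp add: strict_mono_Suc_iff)
      have "(\<Sum>j<n k. \<xi> j) < (\<Sum>j<n (Suc k). \<xi> j)"
        using lt True by (intro sum_strict_mono2[of _ _ "n k"]) (auto intro: less_imp_le)
      moreover have "(\<Sum>j<n k. \<eta> j) = (\<Sum>j<n (Suc k). \<eta> j)"
        using lt k z by (intro sum.mono_neutral_left) auto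
      ultimately show False using n(3) by simp
    qed
    ultimately obtain U where U: "orthogonal_matrix_op e U" "\<And>i. (\<lambda>j. \<eta> j * (cmod (entry e U i j))\<^sup>2) sums \<xi> i"
      and touch: "\<And>N i j. (\<Sum>j<N. \<xi> j) = (\<Sum>j<N. \<eta> j) \<Longrightarrow> i < N \<Longrightarrow> N \<le> j \<Longrightarrow> entry e U i j = 0"
      using ex_orthogonal_matrix[OF \<xi> _ \<eta>c] True by meson
    \<comment> \<open>Block boundaries start at 0, which is not among the contact points.\<close>
    define m where "m k = (case k of 0 \<Rightarrow> 0 | Suc k \<Rightarrow> n k)" for k
    have "strict_mono m" unfolding strict_mono_Suc_iff
      using n(1,2) by (auto simp: m_def strict_mono_Suc_iff split: nat.split)
    moreover have "m 0 = 0" by (simp add: m_def)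
    moreover have "entry e U i j = 0" if "i < m k" "j \<ge> m k" for i j k
      using touch[OF n(3)] that by (cases k) (auto simp: m_def)
    ultimately have "direct_sum_finite_orthogonal e U" by (rule direct_sum_of_orthogonal[OF U(1)])
    then show ?thesis using U(2) \<eta>(1) by blast
  next
    case False
    have "\<xi> \<in> char_set I" by (rule char_set_if_finite_support[OF \<xi> False \<eta>(1) maj])
    moreover have "direct_sum_finite_orthogonal e id_blinfun"
      by (rule direct_sum_of_orthogonal[OF orthogonal_id, of "\<lambda>k. k"])
        (auto simp: strict_mono_def entry_def e_cinner)
    ultimately show ?thesis using identity_sums by blast
  qed
qed

text \<open>A summable \<xi> lies in the ideal and touches itself everywhere. Otherwise the tangents
  are used, and the trace class absorbs the summable error they cause.\<close>

lemma ex_block_majorized_in_ideal: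
  fixes \<xi> :: "nat \<Rightarrow> real"
  assumes tr: "trace_class \<subseteq> I" and \<xi>: "\<xi> \<in> c0_star" and "\<exists>\<eta>\<in>char_set I. \<xi> \<preceq> \<eta>"
  shows "\<exists>\<eta>\<in>char_set I. \<xi> \<prec>\<^sub>b \<eta>"
proof (cases "summable \<xi>")
  case True
  then have "diag_real e \<xi> \<in> I"
    by (intro subsetD[OF tr] diag_summable_trace_class c0_star_nonneg[OF \<xi>])
  then have "\<xi> \<in> char_set I" using \<xi> by (simp add: char_set_iff[OF I])
  moreover have "\<xi> \<prec>\<^sub>b \<xi>"
    by (auto simp: block_majorized_def majorized_def intro!: exI[of _ Suc] strict_monoI)
  ultimately show ?thesis by blast
next
  case False
  obtain \<zeta> where \<zeta>: "\<zeta> \<in> char_set I" "\<xi> \<preceq> \<zeta>" using assms(3) by blast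
  then have "\<zeta> \<in> c0_star" by (simp add: char_set_iff[OF I])
  then obtain \<eta> \<omega> where "\<eta> \<in> c0_star" "summable \<omega>" "\<forall>n. 0 \<le> \<omega> n \<and> \<eta> n \<le> \<zeta> n + \<omega> n" "\<xi> \<prec>\<^sub>b \<eta>"
    using ex_block_majorized_near[OF \<xi> _ False \<zeta>(2)] by blast
  then show ?thesis using char_set_summable_dominated[OF I tr \<zeta>(1)] by blast
qed

end

end

theorem proposition4p1:
  fixes e :: "nat \<Rightarrow> 'h::complex_hilbert_space"
    and I :: "('h \<Rightarrow>\<^sub>L 'h) set"
    and \<xi> :: "nat \<Rightarrow> real"
  assumes "orthonormal_basis e"
    and "proper_ideal I"
    and "\<xi> \<in> c0_star"
  shows
    "(\<xi> \<in> char_set (am_closure I) \<longleftrightarrow> (\<exists>\<eta>\<in>char_set I. \<xi> \<prec> \<eta>)) \<and>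
     (\<xi> \<in> char_set (am_closure I) \<longleftrightarrow> (\<exists>\<eta>\<in>char_set I. \<xi> \<preceq> \<eta>)) \<and>
     (\<xi> \<in> char_set (am_closure I) \<longleftrightarrow>
        (\<exists>\<eta>\<in>char_set I. \<exists>P. substochastic P \<and> \<xi> = mat_apply P \<eta>)) \<and>
     (\<xi> \<in> char_set (am_closure I) \<longleftrightarrow>
        (\<exists>\<eta>\<in>char_set I. \<exists>Q. orthostochastic e Q \<and> \<xi> = mat_apply Q \<eta>)) \<and>
     (\<xi> \<in> char_set (am_closure I) \<longleftrightarrow>
        (\<exists>\<eta>\<in>char_set I. \<exists>L\<in>B_H. norm L \<le> 1 \<and>
           diag_real e \<xi> = cond_exp e (L o\<^sub>L diag_real e \<eta> o\<^sub>L adj L))) \<and>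
     (\<xi> \<in> char_set (am_closure I) \<longleftrightarrow>
        (\<exists>\<eta>\<in>char_set I. \<exists>U. orthogonal_matrix_op e U \<and>
           diag_real e \<xi> = cond_exp e (U o\<^sub>L diag_real e \<eta> o\<^sub>L adj U))) \<and>
     (trace_class \<subseteq> I \<longrightarrow>
       (\<xi> \<in> char_set (am_closure I) \<longleftrightarrow> (\<exists>\<eta>\<in>char_set I. \<xi> \<prec>\<^sub>b \<eta>)) \<and>
       (\<xi> \<in> char_set (am_closure I) \<longleftrightarrow>
          (\<exists>\<eta>\<in>char_set I. \<exists>Q. block_orthostochastic e Q \<and> \<xi> = mat_apply Q \<eta>)) \<and>
       (\<xi> \<in> char_set (am_closure I) \<longleftrightarrow>
          (\<exists>\<eta>\<in>char_set I. \<exists>U. direct_sum_finite_orthogonal e U \<and>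
             diag_real e \<xi> = cond_exp e (U o\<^sub>L diag_real e \<eta> o\<^sub>L adj U))))"
    (is "(?i \<longleftrightarrow> ?ii) \<and> (?i \<longleftrightarrow> ?ii') \<and> (?i \<longleftrightarrow> ?iii) \<and> (?i \<longleftrightarrow> ?iii') \<and> (?i \<longleftrightarrow> ?iv) \<and> (?i \<longleftrightarrow> ?iv') \<and>
      (_ \<longrightarrow> (?i \<longleftrightarrow> ?ii'') \<and> (?i \<longleftrightarrow> ?iii'') \<and> (?i \<longleftrightarrow> ?iv''))")
proof -
  interpret onb e by (rule onb.intro[OF assms(1)])
  note I = assms(2) and \<xi> = assms(3)
  have c0: "\<eta> \<in> c0_star" if "\<eta> \<in> char_set I" for \<eta> using that by (simp add: char_set_iff[OF I])
  have i_ii: "?i \<longleftrightarrow> ?ii" by (rule char_set_am_closure_iff[OF I \<xi>])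
  have ii_ii': "?ii'" if h: "?ii"
  proof -
    obtain \<eta> where \<eta>: "\<eta> \<in> char_set I" "\<xi> \<prec> \<eta>" using h by blast
    obtain \<zeta> where "\<zeta> \<in> c0_star" "\<forall>n. \<zeta> n \<le> \<eta> n" "\<xi> \<preceq> \<zeta>"
      using ex_strongly_majorized_below[OF \<xi> c0[OF \<eta>(1)] \<eta>(2)] by blast
    then show ?thesis using char_set_solid[OF I \<eta>(1)] by blast
  qed
  have ii'_ii: "?ii" if "?ii'" using that by (auto simp: strongly_majorized_def)
  have iii_ii: "?ii" if "?iii" using that substochastic_majorized c0 by blast
  have sub: "?iii" if "\<eta> \<in> char_set I" "substochastic (\<lambda>i j. (cmod (entry e A i j))\<^sup>2)"
    "\<And>i. (\<lambda>j. \<eta> j * (cmod (entry e A i j))\<^sup>2) sums \<xi> i" for \<eta> A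
    using that mat_apply_squares[OF that(3)] by blast
  have orth_sub: "substochastic (\<lambda>i j. (cmod (entry e U i j))\<^sup>2)"
    and orth_BH: "U \<in> B_H" "norm U \<le> 1" "\<And>i j. entry e U i j \<in> \<real>"
    if "orthogonal_matrix_op e U" for U
    using that contraction_substochastic unitary_norm_le
    by (auto simp: orthogonal_matrix_op_def unitary_op_def)
  have iv_iii: "?iii" if h: "?iv"
  proof -
    obtain \<eta> L where L: "\<eta> \<in> char_set I" "L \<in> B_H" "norm L \<le> 1"
      "diag_real e \<xi> = cond_exp e (L o\<^sub>L diag_real e \<eta> o\<^sub>L adj L)" using h by blast
    then show ?thesis
      using sub[OF L(1) contraction_substochastic[OF L(2,3)]] diag_eq_cond_exp_iff[OF L(2) c0[OF L(1)] \<xi>] by blast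
  qed
  have iv'_iv: "?iv" if "?iv'" using that orth_BH by blast
  have iii'_iii: "?iii" if h: "?iii'"
  proof -
    obtain \<eta> Q U where Q: "\<eta> \<in> char_set I" "\<xi> = mat_apply Q \<eta>" "orthogonal_matrix_op e U"
      "\<And>i j. complex_of_real (Q i j) = (entry e U i j)\<^sup>2" using h unfolding orthostochastic_def by blast
    have "Q = (\<lambda>i j. (cmod (entry e U i j))\<^sup>2)" by (rule squares_eq[OF orth_BH(3)[OF Q(3)] Q(4)])
    then show ?thesis using Q orth_sub by blast
  qed
  \<comment> \<open>One matrix serves both conditions, by its squared entries for the first and as
    an operator for the second.\<close>
  have ii'_iii'_iv': "?iii' \<and> ?iv'" if h: "?ii'"
  proof -
    obtain \<eta> U where U: "\<eta> \<in> char_set I" "orthogonal_matrix_op e U"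
      "\<And>i. (\<lambda>j. \<eta> j * (cmod (entry e U i j))\<^sup>2) sums \<xi> i" using ex_orthogonal_in_ideal[OF I \<xi> h] by blast
    have "diag_real e \<xi> = cond_exp e (U o\<^sub>L diag_real e \<eta> o\<^sub>L adj U)"
      using diag_eq_cond_exp_iff[OF orth_BH(1)[OF U(2)] c0[OF U(1)] \<xi>] U(3) by blast
    moreover have "orthostochastic e (\<lambda>i j. (cmod (entry e U i j))\<^sup>2)"
      unfolding orthostochastic_def using U(2) Reals_cmod_square[OF orth_BH(3)[OF U(2)]] by blast
    ultimately show ?thesis using U mat_apply_squares[OF U(3)] by blast
  qed
  have ii''_ii: "?ii" if "?ii''" using that by (auto simp: block_majorized_def)
  have iv''_iii: "?iii" if h: "?iv''"
  proof -
    obtain \<eta> U where U: "\<eta> \<in> char_set I" "direct_sum_finite_orthogonal e U"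
      "diag_real e \<xi> = cond_exp e (U o\<^sub>L diag_real e \<eta> o\<^sub>L adj U)" using h by blast
    have "U \<in> B_H" using U(2) by (simp add: direct_sum_finite_orthogonal_def)
    then show ?thesis
      using sub[OF U(1) direct_sum_entries(2)[OF U(2)]] diag_eq_cond_exp_iff[OF _ c0[OF U(1)] \<xi>] U(3) by blast
  qed
  have iii''_iii: "?iii" if h: "?iii''"
  proof -
    obtain \<eta> Q U where Q: "\<eta> \<in> char_set I" "\<xi> = mat_apply Q \<eta>" "direct_sum_finite_orthogonal e U"
      "\<And>i j. complex_of_real (Q i j) = (entry e U i j)\<^sup>2" using h unfolding block_orthostochastic_def by blast
    have "Q = (\<lambda>i j. (cmod (entry e U i j))\<^sup>2)" by (rule squares_eq[OF direct_sum_entries(1)[OF Q(3)] Q(4)])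
    then show ?thesis using Q direct_sum_entries(2)[OF Q(3)] by blast
  qed
  have ii''_iii''_iv'': "?iii'' \<and> ?iv''" if h: "?ii''"
  proof -
    obtain \<eta> U where U: "\<eta> \<in> char_set I" "direct_sum_finite_orthogonal e U"
      "\<And>i. (\<lambda>j. \<eta> j * (cmod (entry e U i j))\<^sup>2) sums \<xi> i" using ex_direct_sum_in_ideal[OF I \<xi> h] by blast
    have "U \<in> B_H" using U(2) by (simp add: direct_sum_finite_orthogonal_def)
    then have "diag_real e \<xi> = cond_exp e (U o\<^sub>L diag_real e \<eta> o\<^sub>L adj U)"
      using diag_eq_cond_exp_iff[OF _ c0[OF U(1)] \<xi>] U(3) by blast
    moreover have "block_orthostochastic e (\<lambda>i j. (cmod (entry e U i j))\<^sup>2)"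
      unfolding block_orthostochastic_def using U(2) Reals_cmod_square[OF direct_sum_entries(1)[OF U(2)]] by blast
    ultimately show ?thesis using U mat_apply_squares[OF U(3)] by blast
  qed
  have ii'_ii'': "?ii''" if "trace_class \<subseteq> I" "?ii'"
    by (rule ex_block_majorized_in_ideal[OF I that(1) \<xi> that(2)])
  \<comment> \<open>Every equivalence leaves through strong majorization, the source of all
    matrices, and comes back through plain majorization.\<close>
  have fwd: "?ii'" if "?i" by (rule ii_ii'[OF iffD1[OF i_ii that]])
  have bwd: "?i" if "?ii" by (rule iffD2[OF i_ii that])
  show ?thesis
  proof (intro conjI impI i_ii)
    show "?i \<longleftrightarrow> ?ii'" by (rule iffI[OF fwd bwd[OF ii'_ii]])
    show "?i \<longleftrightarrow> ?iii"
      by (rule iffI[OF iii'_iii[OF conjunct1[OF ii'_iii'_iv'[OF fwd]]] bwd[OF iii_ii]])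
    show "?i \<longleftrightarrow> ?iii'"
      by (rule iffI[OF conjunct1[OF ii'_iii'_iv'[OF fwd]] bwd[OF iii_ii[OF iii'_iii]]])
    show "?i \<longleftrightarrow> ?iv"
      by (rule iffI[OF iv'_iv[OF conjunct2[OF ii'_iii'_iv'[OF fwd]]] bwd[OF iii_ii[OF iv_iii]]])
    show "?i \<longleftrightarrow> ?iv'"
      by (rule iffI[OF conjunct2[OF ii'_iii'_iv'[OF fwd]] bwd[OF iii_ii[OF iv_iii[OF iv'_iv]]]])
    assume tr: "trace_class \<subseteq> I"
    show "?i \<longleftrightarrow> ?ii''" by (rule iffI[OF ii'_ii''[OF tr fwd] bwd[OF ii''_ii]])
    show "?i \<longleftrightarrow> ?iii''"
      by (rule iffI[OF conjunct1[OF ii''_iii''_iv''[OF ii'_ii''[OF tr fwd]]] bwd[OF iii_ii[OF iii''_iii]]])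
    show "?i \<longleftrightarrow> ?iv''"
      by (rule iffI[OF conjunct2[OF ii''_iii''_iv''[OF ii'_ii''[OF tr fwd]]] bwd[OF iii_ii[OF iv''_iii]]])
  qed
qed

end
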